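(* Let $\mathbb F$ be a field of characteristic other than $2$ and $3$ and let $\beta\in\mathbb F\setminus\{\tfrac12\}$ (with $0,1,4\beta,\beta$ pairwise distinct). Let $V$ be a $2$-generated primitive axial algebra of Monster type $(4\beta,\beta)$ over $\mathbb F$ with generating axes $a_0,a_1$. Then, with $\langle\,\cdot\,\rangle$ denoting linear span over $\mathbb F$: (1) if $\lambda_{a_0}(a_1)\neq\frac{18\beta-1}{8}\neq\lambda_{a_1}(a_0)$, then $V=\langle a_{-1},a_0,a_1,a_2,s_{0,1},s_{0,2}\rangle$; (2) if $\lambda_{a_0}(a_1)\neq\frac{18\beta-1}{8}=\lambda_{a_1}(a_0)$, then $V=\langle a_{-2},a_{-1},a_0,a_1,a_2,s_{0,1},s_{0,2}\rangle$; (3) if $\lambda_{a_0}(a_1)=\frac{18\beta-1}{8}\neq\lambda_{a_1}(a_0)$, then $V=\langle a_{-3},a_{-2},a_{-1},a_0,a_1,s_{0,1},s_{1,2}\rangle$; (4) if $\lambda_{a_0}(a_1)=\lambda_{a_1}(a_0)=\frac{18\beta-1}{8}$, then $V=\langle a_{-2},a_{-1},a_0,a_1,a_2,a_3,s_{0,1},s_{0,2}\rangle$.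
   Context: Put $\alpha=4\beta$. For a commutative, not necessarily associative $\mathbb F$-algebra $V$, $a\in V$ and $\lambda\in\mathbb F$, let $V_\lambda^a=\{v\in V : va=\lambda v\}$. The Monster fusion law $\mathcal M(\alpha,\beta)$ is the symmetric map $\star$ from $\{1,0,\alpha,\beta\}^2$ to the set of subsets of $\{1,0,\alpha,\beta\}$ given by $1\star1=\{1\}$, $1\star0=\emptyset$, $1\star\alpha=\{\alpha\}$, $1\star\beta=\{\beta\}$, $0\star0=\{0\}$, $0\star\alpha=\{\alpha\}$, $0\star\beta=\{\beta\}$, $\alpha\star\alpha=\{1,0\}$, $\alpha\star\beta=\{\beta\}$, $\beta\star\beta=\{1,0,\alpha\}$. A primitive axis of Monster type $(\alpha,\beta)$ in $V$ is a nonzero idempotent $a$ such that $V=V_1^a\oplus V_0^a\oplus V_\alpha^a\oplus V_\beta^a$, $V_\lambda^aV_\mu^a\subseteq\sum_{\nu\in\lambda\star\mu}V_\nu^a$ for all $\lambda,\mu$, and $V_1^a=\mathbb Fa$. A $2$-generated primitive axial algebra of Monster type $(\alpha,\beta)$ is a commutative non-associative $\mathbb F$-algebra generated, as an algebra, by two such axes $a_0,a_1$. For a primitive axis $a$, $\lambda_a\colon V\to\mathbb F$ is the linear map such that $\lambda_a(v)a$ is the component of $v$ in $V_1^a$ with respect to the eigenspace decomposition of $V$. The Miyamoto involution $\tau_a$ is the algebra automorphism of $V$ that is the identity on $V_1^a\oplus V_0^a\oplus V_\alpha^a$ and $-1$ on $V_\beta^a$. Let $\rho=\tau_{a_0}\tau_{a_1}$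 (maps act on the right) and $a_{2i}=a_0^{\rho^i}$, $a_{2i+1}=a_1^{\rho^i}$ for $i\in\mathbb Z$ (so $a_i^{\tau_{a_j}}=a_{2j-i}$). For a positive integer $m$ and $0\le i\le m-1$, $s_{i,m}=a_ia_{i+m}-\beta(a_i+a_{i+m})$. *)

theory Defs
  imports Complex_Main
begin

text \<open>
  A commutative, not necessarily associative algebra over a field \<open>'f\<close> is a vector space
  structure \<open>scale\<close> on the type \<open>'v\<close> together with a commutative bilinear product \<open>mult\<close>;
  the underlying space of the algebra is all of \<open>'v\<close>.
\<close>

locale comm_nonassoc_algebra = vector_space scale
  for scale :: "'f::field \<Rightarrow> 'v::ab_group_add \<Rightarrow> 'v" +
  fixes mult :: "'v \<Rightarrow> 'v \<Rightarrow> 'v"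
  assumes mult_commute: "mult x y = mult y x"
    and mult_add_left: "mult (x + y) z = mult x z + mult y z"
    and mult_scale_left: "mult (scale c x) y = scale c (mult x y)"

definition subalgebra ::
    "('f::field \<Rightarrow> 'v::ab_group_add \<Rightarrow> 'v) \<Rightarrow> ('v \<Rightarrow> 'v \<Rightarrow> 'v) \<Rightarrow> 'v set \<Rightarrow> bool"
  where "subalgebra scale mult S \<longleftrightarrow>
    module.subspace scale S \<and> (\<forall>x\<in>S. \<forall>y\<in>S. mult x y \<in> S)"

definition algebra_automorphism ::
    "('f::field \<Rightarrow> 'v::ab_group_add \<Rightarrow> 'v) \<Rightarrow> ('v \<Rightarrow> 'v \<Rightarrow> 'v) \<Rightarrow> ('v \<Rightarrow> 'v) \<Rightarrow> bool"
  where "algebra_automorphism scale mult t \<longleftrightarrow>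
    Vector_Spaces.linear scale scale t \<and> bij t \<and> (\<forall>x y. t (mult x y) = mult (t x) (t y))"

definition eigenspace ::
    "('f::field \<Rightarrow> 'v::ab_group_add \<Rightarrow> 'v) \<Rightarrow> ('v \<Rightarrow> 'v \<Rightarrow> 'v) \<Rightarrow> 'v \<Rightarrow> 'f \<Rightarrow> 'v set"
  where "eigenspace scale mult a l = {v. mult v a = scale l v}"

definition eigenspace_sum ::
    "('f::field \<Rightarrow> 'v::ab_group_add \<Rightarrow> 'v) \<Rightarrow> ('v \<Rightarrow> 'v \<Rightarrow> 'v) \<Rightarrow> 'v \<Rightarrow> 'f set \<Rightarrow> 'v set"
  where "eigenspace_sum scale mult a N =
    {(\<Sum>l\<in>N. u l) | u. \<forall>l\<in>N. u l \<in> eigenspace scale mult a l}"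

text \<open>
  \<open>u l\<close> is the component of \<open>v\<close> for the eigenvalue \<open>l \<in> N\<close>; the requirement \<open>u l = 0\<close>
  for \<open>l \<notin> N\<close> only makes the family \<open>u\<close> determined by its values on \<open>N\<close>.
\<close>

definition eigen_decomposition ::
    "('f::field \<Rightarrow> 'v::ab_group_add \<Rightarrow> 'v) \<Rightarrow> ('v \<Rightarrow> 'v \<Rightarrow> 'v) \<Rightarrow> 'v \<Rightarrow> 'f set \<Rightarrow> 'v
      \<Rightarrow> ('f \<Rightarrow> 'v) \<Rightarrow> bool"
  where "eigen_decomposition scale mult a N v u \<longleftrightarrow>
    (\<forall>l\<in>N. u l \<in> eigenspace scale mult a l) \<and> (\<forall>l. l \<notin> N \<longrightarrow> u l = 0) \<and> v = (\<Sum>l\<in>N. u l)"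

text \<open>
  The Monster fusion law on the field elements \<open>1, 0, \<alpha>, \<beta>\<close>, which are meant to be pairwise
  distinct. It is symmetric because it depends only on the set \<open>{l, m}\<close>; its values on
  arguments outside \<open>{1, 0, \<alpha>, \<beta>}\<close> are irrelevant.
\<close>

definition monster_fusion :: "'f::field \<Rightarrow> 'f \<Rightarrow> 'f \<Rightarrow> 'f \<Rightarrow> 'f set"
  where "monster_fusion \<alpha> \<beta> l m =
    (if {l, m} = {1} then {1}
     else if {l, m} = {1, 0} then {}
     else if {l, m} = {1, \<alpha>} then {\<alpha>}
     else if {l, m} = {1, \<beta>} then {\<beta>}
     else if {l, m} = {0} then {0}
     else if {l, m} = {0, \<alpha>} then {\<alpha>}
     else if {l, m} = {0, \<beta>} then {\<beta>}
     else if {l, m} = {\<alpha>} then {1, 0}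
     else if {l, m} = {\<alpha>, \<beta>} then {\<beta>}
     else if {l, m} = {\<beta>} then {1, 0, \<alpha>}
     else {})"

text \<open>
  The second conjunct says that the whole space is the direct sum of the four eigenspaces.
\<close>

definition primitive_monster_axis ::
    "('f::field \<Rightarrow> 'v::ab_group_add \<Rightarrow> 'v) \<Rightarrow> ('v \<Rightarrow> 'v \<Rightarrow> 'v) \<Rightarrow> 'f \<Rightarrow> 'f \<Rightarrow> 'v \<Rightarrow> bool"
  where "primitive_monster_axis scale mult \<alpha> \<beta> a \<longleftrightarrow>
    a \<noteq> 0 \<and> mult a a = a \<and>
    (\<forall>v. \<exists>!u. eigen_decomposition scale mult a {1, 0, \<alpha>, \<beta>} v u) \<and>
    (\<forall>l\<in>{1, 0, \<alpha>, \<beta>}. \<forall>m\<in>{1, 0, \<alpha>, \<beta>}.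
       \<forall>x\<in>eigenspace scale mult a l. \<forall>y\<in>eigenspace scale mult a m.
         mult x y \<in> eigenspace_sum scale mult a (monster_fusion \<alpha> \<beta> l m)) \<and>
    eigenspace scale mult a 1 = range (\<lambda>c. scale c a)"

definition two_generated_primitive_monster_algebra ::
    "('f::field \<Rightarrow> 'v::ab_group_add \<Rightarrow> 'v) \<Rightarrow> ('v \<Rightarrow> 'v \<Rightarrow> 'v) \<Rightarrow> 'f \<Rightarrow> 'f \<Rightarrow> 'v \<Rightarrow> 'v \<Rightarrow> bool"
  where "two_generated_primitive_monster_algebra scale mult \<alpha> \<beta> a0 a1 \<longleftrightarrow>
    comm_nonassoc_algebra scale mult \<and>
    primitive_monster_axis scale mult \<alpha> \<beta> a0 \<and>
    primitive_monster_axis scale mult \<alpha> \<beta> a1 \<and>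
    subalgebra scale mult hull {a0, a1} = UNIV"

text \<open>\<open>axis_lambda scale mult \<alpha> \<beta> a v\<close> is the scalar \<open>\<lambda>\<^sub>a(v)\<close>.\<close>

definition axis_lambda ::
    "('f::field \<Rightarrow> 'v::ab_group_add \<Rightarrow> 'v) \<Rightarrow> ('v \<Rightarrow> 'v \<Rightarrow> 'v) \<Rightarrow> 'f \<Rightarrow> 'f \<Rightarrow> 'v \<Rightarrow> 'v \<Rightarrow> 'f"
  where "axis_lambda scale mult \<alpha> \<beta> a v =
    (THE c. scale c a = (THE u. eigen_decomposition scale mult a {1, 0, \<alpha>, \<beta>} v u) 1)"

definition miyamoto ::
    "('f::field \<Rightarrow> 'v::ab_group_add \<Rightarrow> 'v) \<Rightarrow> ('v \<Rightarrow> 'v \<Rightarrow> 'v) \<Rightarrow> 'f \<Rightarrow> 'f \<Rightarrow> 'v \<Rightarrow> 'v \<Rightarrow> 'v"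
  where "miyamoto scale mult \<alpha> \<beta> a =
    (THE t. algebra_automorphism scale mult t \<and>
       (\<forall>v\<in>eigenspace_sum scale mult a {1, 0, \<alpha>}. t v = v) \<and>
       (\<forall>v\<in>eigenspace scale mult a \<beta>. t v = - v))"

definition bij_int_power :: "('v \<Rightarrow> 'v) \<Rightarrow> int \<Rightarrow> 'v \<Rightarrow> 'v"
  where "bij_int_power t k = (if 0 \<le> k then t ^^ nat k else inv t ^^ nat (- k))"

text \<open>
  Maps act on the right in the definition of \<open>\<rho> = \<tau>\<^bsub>a0\<^esub> \<tau>\<^bsub>a1\<^esub>\<close>, so as a function \<open>\<rho>\<close> applies
  \<open>\<tau>\<^bsub>a0\<^esub>\<close> first. Note that \<open>(2 * k + 1) div 2 = k\<close> also for negative integers \<open>k\<close>.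
\<close>

definition axis_seq ::
    "('f::field \<Rightarrow> 'v::ab_group_add \<Rightarrow> 'v) \<Rightarrow> ('v \<Rightarrow> 'v \<Rightarrow> 'v) \<Rightarrow> 'f \<Rightarrow> 'f \<Rightarrow> 'v \<Rightarrow> 'v \<Rightarrow> int \<Rightarrow> 'v"
  where "axis_seq scale mult \<alpha> \<beta> a0 a1 i =
    (let \<rho> = miyamoto scale mult \<alpha> \<beta> a1 \<circ> miyamoto scale mult \<alpha> \<beta> a0
     in bij_int_power \<rho> (i div 2) (if even i then a0 else a1))"

definition axis_s ::
    "('f::field \<Rightarrow> 'v::ab_group_add \<Rightarrow> 'v) \<Rightarrow> ('v \<Rightarrow> 'v \<Rightarrow> 'v) \<Rightarrow> 'f \<Rightarrow> 'f \<Rightarrow> 'v \<Rightarrow> 'v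
      \<Rightarrow> int \<Rightarrow> int \<Rightarrow> 'v"
  where "axis_s scale mult \<alpha> \<beta> a0 a1 i m =
    (let a = axis_seq scale mult \<alpha> \<beta> a0 a1
     in mult (a i) (a (i + m)) - scale \<beta> (a i + a (i + m)))"

end

theory Submission
  imports Defs
begin

text \<open>
  Multiply the product by \<open>2 / \<beta>\<close>. The axes then have the eigenvalues \<open>\<kappa> = 2 / \<beta>, 0, 8, 2\<close>, and all
  structure constants below become polynomials in \<open>\<kappa>\<close> and the projections with small integer
  coefficients. The axes \<open>a i\<close> form an orbit of the dihedral group generated by \<open>\<tau> 0\<close> and \<open>\<tau> 1\<close>, which
  acts by \<open>i \<mapsto> - i\<close> and \<open>i \<mapsto> 2 - i\<close> on the indices. Exchanging the two generators is the mirror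
  \<open>i \<mapsto> 1 - i\<close>, and every identity has a mirror image; both are instances of one reindexing lemma.

  The engine is \<open>pair_fusion\<close>. Up to multiples of \<open>a 0\<close>, the vectors \<open>a m + a (- m)\<close> and \<open>s 0 m\<close> span
  the same plane as the parts of \<open>a m\<close> for the eigenvalues \<open>0\<close> and \<open>8\<close> of \<open>a 0\<close>, so the fusion law
  determines the products of two such planes from less data. For \<open>m = n = 1\<close> this computes \<open>a 0 \<bullet> s 1 2\<close>
  and the square of \<open>\<sigma> = s 0 1\<close>. The square does not depend on the axis from which it is
  computed: comparing \<open>a 0\<close> with \<open>a 1\<close> yields the linear relation \<open>rel\<close>. Its coefficients at
  \<open>a (-1)\<close> and \<open>a 2\<close> are multiples of \<open>P 0\<close> and \<open>P 1\<close>, where \<open>P i = 0\<close> says exactly that the projection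
  from \<open>a i\<close> has the exceptional value \<open>(18 * \<beta> - 1) / 8\<close>. Antisymmetrising by \<open>\<tau> 0\<close> gives
  \<open>3 * P 1 * (a 2 - a (-2)) = - g 1 * (a 1 - a (-1))\<close>.

  Let \<open>U\<close> be the span of all axes, \<open>\<sigma>\<close> and \<open>s 0 2\<close>. By \<open>pair_fusion\<close> it is a subalgebra as soon as
  it contains all products of two axes. So it remains to find a short window of indices
  whose axes span a space that is stable under \<open>\<tau> 0\<close> and \<open>\<tau> 1\<close>, and this is where the cases separate.

  If \<open>P 0\<close> and \<open>P 1\<close> are nonzero, the relation and its mirror image express all axes by those with
  the indices \<open>-1, ..., 2\<close>. If only \<open>P 1\<close> vanishes, then either the odd axes coincide, or \<open>g 1 = 0\<close> and multiplying
  the relation by \<open>a 0\<close> and \<open>a 1\<close> gives a further relation that bounds the even indices. The case of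
  \<open>P 0 = 0\<close> is its mirror image.

  If \<open>P 0 = P 1 = 0\<close>, the relation says that \<open>s 1 2 = s 0 2\<close>, unless axes coincide, and then
  \<open>a 0 \<bullet> s 1 2 = a 0 \<bullet> s 0 2\<close> makes \<open>(\<kappa> - 4) * (\<kappa> - 24)\<close> times \<open>a 1 + a (-1) + \<sigma>\<close> a multiple of \<open>a 0\<close>.
  Only \<open>\<kappa> = 24\<close> with all near projections equal to \<open>1 / 16\<close> is left. There \<open>pair_fusion\<close> for \<open>m = 1\<close>,
  \<open>n = 2\<close> gives \<open>\<sigma> \<bullet> s 0 2\<close>, and its invariance under \<open>\<tau> 1\<close> leads to
  \<open>2 * (a 4 + a 3 - a (-2) - a (-3)) = c * (a 2 - a (-1))\<close>. If \<open>c \<noteq> 0\<close>, multiplying this by the two outer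
  axes expresses \<open>a (-3)\<close> by the window \<open>-2, ..., 3\<close>. If \<open>c = 0\<close>, then \<open>a 6 = a 0 + d\<close> where \<open>d = a (-3) - a 3\<close>
  is negated by \<open>\<tau> 0\<close>; idempotency of both axes makes \<open>d\<close> a nonzero multiple of \<open>d \<bullet> d\<close>, which \<open>\<tau> 0\<close>
  fixes, so \<open>d = 0\<close>.
\<close>

section \<open>Orbits of axes\<close>

lemma index_induct:
  fixes i :: int
  assumes "Q 0" "Q 1" "\<And>i. Q i \<Longrightarrow> Q (- i)" "\<And>i. Q i \<Longrightarrow> Q (2 - i)"
  shows "Q i"
proof -
  have up: "Q (i + 2)" and down: "Q (i - 2)" if "Q i" for i
    using assms(4)[OF assms(3)[OF that]] assms(3)[OF assms(4)[OF that]] by (simp_all add: add.commute)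
  have "Q (2 * k) \<and> Q (2 * k + 1)" for k :: int
  proof (induction k rule: int_induct[where k = 0])
    case base
    then show ?case using assms by simp
  next
    case (step1 k)
    then show ?case using up[of "2 * k"] up[of "2 * k + 1"] by (simp add: algebra_simps)
  next
    case (step2 k)
    then show ?case using down[of "2 * k"] down[of "2 * k + 1"] by (simp add: algebra_simps)
  qed
  from this[of "i div 2"] show ?thesis by (cases "even i") simp_all
qed

context comm_nonassoc_algebra
begin

definition lin_fun :: "('v \<Rightarrow> 'f) \<Rightarrow> bool"
  where "lin_fun f \<longleftrightarrow> (\<forall>x y::'v. f (x + y) = f x + f y) \<and> (\<forall>c (x::'v). f (scale c x) = c * f x)"

lemma lin_fun_simps:
  fixes f :: "'v \<Rightarrow> 'f" and x y :: 'v and c :: 'f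
  assumes "lin_fun f"
  shows "f (x + y) = f x + f y" "f (scale c x) = c * f x" "f 0 = 0" "f (- x) = - f x"
    "f (x - y) = f x - f y"
proof -
  show add: "f (x + y) = f x + f y" for x y using assms by (simp add: lin_fun_def)
  show sc: "f (scale c x) = c * f x" for c x using assms by (simp add: lin_fun_def)
  show "f 0 = 0" using sc[of 0 0] by simp
  show neg: "f (- x) = - f x" for x using sc[of "-1" x] by simp
  show "f (x - y) = f x - f y" using add[of x "- y"] neg by simp
qed

text \<open>
  This turns identities between vectors into identities between scalars, where a known vector
  identity can be used with any coefficient. All the longer computations below have this form:
  the difference of the two sides under an arbitrary functional is exhibited as a linear combination
  of differences that are known to vanish, and what is left is an identity of polynomials.
\<close>

lemma vec_eqI:
  fixes x y :: 'v
  assumes "\<And>f. lin_fun f \<Longrightarrow> f x = f y"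
  shows "x = y"
proof -
  define B where "B = extend_basis {}"
  have ind: "independent B" and sp: "span B = UNIV"
    unfolding B_def using independent_extend_basis[of "{}"] span_extend_basis[of "{}"]
    by (auto simp: independent_empty)
  have "representation B x = representation B y"
  proof
    fix b
    have "lin_fun (\<lambda>v. representation B v b)"
      unfolding lin_fun_def using ind sp by (simp add: representation_add representation_scale)
    then show "representation B x b = representation B y b" by (rule assms)
  qed
  then show ?thesis
    using sum_nonzero_representation_eq[OF ind] sp by (metis UNIV_I)
qed

end

text \<open>
  The sequence of axes with the product scaled so that the eigenvalues \<open>\<alpha> = 4 * \<beta>\<close> and \<open>\<beta>\<close> become \<open>8\<close>
  and \<open>2\<close>. The functional \<open>L i\<close> is the projection to \<open>a i\<close>, and \<open>\<tau> i\<close> is the involution of \<open>a i\<close>. The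
  exclusions \<open>\<kappa> \<noteq> 4\<close>, \<open>\<kappa> \<noteq> 2\<close> and \<open>\<kappa> \<noteq> 8\<close> stand for \<open>\<beta> \<noteq> 1 / 2\<close>, \<open>\<beta> \<noteq> 1\<close> and \<open>\<alpha> \<noteq> 1\<close>. Generation is left
  out so that subsequences such as \<open>a 0, a 2, a 4, ...\<close> are instances too.
\<close>

locale axis_orbit = comm_nonassoc_algebra scale mult
  for scale :: "'f::field \<Rightarrow> 'v::ab_group_add \<Rightarrow> 'v" (infixr "*s" 75)
    and mult :: "'v \<Rightarrow> 'v \<Rightarrow> 'v" (infixl "\<bullet>" 70) +
  fixes \<kappa> :: 'f
    and a :: "int \<Rightarrow> 'v"
    and \<tau> :: "int \<Rightarrow> 'v \<Rightarrow> 'v"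
    and L :: "int \<Rightarrow> 'v \<Rightarrow> 'f"
  assumes two: "(2::'f) \<noteq> 0" and three: "(3::'f) \<noteq> 0"
    and k0: "\<kappa> \<noteq> 0" and k2: "\<kappa> \<noteq> 2" and k4: "\<kappa> \<noteq> 4" and k8: "\<kappa> \<noteq> 8"
    and a_nonzero: "a i \<noteq> 0"
    and idem: "a i \<bullet> a i = \<kappa> *s a i"
    and L_lin: "lin_fun (L i)"
    and L_self: "L i (a i) = 1"
    and L_axis_mult: "L i (a i \<bullet> x) = \<kappa> * L i x"
    and \<tau>_add: "\<tau> i (x + y) = \<tau> i x + \<tau> i y"
    and \<tau>_scale: "\<tau> i (c *s x) = c *s \<tau> i x"
    and \<tau>_mult: "\<tau> i (x \<bullet> y) = \<tau> i x \<bullet> \<tau> i y"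
    and \<tau>_axis: "\<tau> j (a i) = a (2 * j - i)"
    and \<tau>_cong: "a i = a j \<Longrightarrow> \<tau> i = \<tau> j"
    and L_\<tau>: "L (2 * j - i) (\<tau> j v) = L i v"
    and eigen_split: "\<exists>x y z. v = L i v *s a i + x + y + z \<and>
      a i \<bullet> x = 0 \<and> a i \<bullet> y = 8 *s y \<and> a i \<bullet> z = 2 *s z \<and>
      \<tau> i x = x \<and> \<tau> i y = y \<and> \<tau> i z = - z"
    and fusion_00: "a i \<bullet> x = 0 \<Longrightarrow> a i \<bullet> y = 0 \<Longrightarrow> a i \<bullet> (x \<bullet> y) = 0"
    and fusion_08: "a i \<bullet> x = 0 \<Longrightarrow> a i \<bullet> y = 8 *s y \<Longrightarrow> a i \<bullet> (x \<bullet> y) = 8 *s (x \<bullet> y)"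
    and fusion_88: "a i \<bullet> x = 8 *s x \<Longrightarrow> a i \<bullet> y = 8 *s y \<Longrightarrow>
      a i \<bullet> (x \<bullet> y) = (\<kappa> * L i (x \<bullet> y)) *s a i"
begin

text \<open>
  Translations, the mirror \<open>i \<mapsto> 1 - i\<close>, and passing to every second axis are all affine, so each
  statement that is proved near index \<open>0\<close> holds around every axis and for the subsequences.
\<close>

lemma reindex:
  "axis_orbit scale mult \<kappa> (\<lambda>i. a (c * i + d)) (\<lambda>i. \<tau> (c * i + d)) (\<lambda>i. L (c * i + d))"
proof -
  have ix: "2 * (c * j + d) - (c * i + d) = c * (2 * j - i) + d" for i j
    by (simp add: algebra_simps)
  have T: "\<tau> (c * j + d) (a (c * i + d)) = a (c * (2 * j - i) + d)" for i j
    by (simp only: \<tau>_axis ix)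
  have LT: "L (c * (2 * j - i) + d) (\<tau> (c * j + d) v) = L (c * i + d) v" for i j v
    using L_\<tau>[of "c * j + d" "c * i + d" v] by (simp only: ix)
  show ?thesis
    by unfold_locales
      (fact two three k0 k2 k4 k8 a_nonzero idem L_lin L_self L_axis_mult \<tau>_add \<tau>_scale
        \<tau>_mult T LT eigen_split | rule fusion_00 fusion_08 fusion_88 \<tau>_cong; assumption)+
qed

lemma mult_add_right: "x \<bullet> (y + z) = x \<bullet> y + x \<bullet> z"
  by (metis mult_commute mult_add_left)

lemma mult_scale_right: "x \<bullet> (c *s y) = c *s (x \<bullet> y)"
  by (metis mult_commute mult_scale_left)

lemma prod_zero_left: "0 \<bullet> x = 0"
  using mult_scale_left[of 0 0 x] by simp

lemma mult_minus_left: "(- x) \<bullet> y = - (x \<bullet> y)"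
  using mult_scale_left[of "-1" x y] by simp

lemma mult_minus_right: "x \<bullet> (- y) = - (x \<bullet> y)"
  by (metis mult_commute mult_minus_left)

lemma mult_diff_left: "(x - y) \<bullet> z = x \<bullet> z - y \<bullet> z"
  using mult_add_left[of x "- y" z] by (simp add: mult_minus_left)

lemma mult_diff_right: "x \<bullet> (y - z) = x \<bullet> y - x \<bullet> z"
  by (metis mult_commute mult_diff_left)

lemmas bilin = mult_add_left mult_add_right mult_scale_left mult_scale_right
  mult_diff_left mult_diff_right mult_minus_left mult_minus_right

lemmas L_simps = lin_fun_simps[OF L_lin]

lemma \<tau>_minus: "\<tau> i (- x) = - \<tau> i x"
  using \<tau>_scale[of i "-1" x] by simp

lemma \<tau>_diff: "\<tau> i (x - y) = \<tau> i x - \<tau> i y"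
  using \<tau>_add[of i x "- y"] by (simp add: \<tau>_minus)

lemmas \<tau>_simps = \<tau>_add \<tau>_scale \<tau>_mult \<tau>_minus \<tau>_diff \<tau>_axis

definition s :: "int \<Rightarrow> int \<Rightarrow> 'v"
  where "s i n = a i \<bullet> a (i + n) - 2 *s (a i + a (i + n))"

definition lam :: "int \<Rightarrow> int \<Rightarrow> 'f"
  where "lam i n = L i (a (i + n))"

text \<open>
  \<open>- e i n\<close> is the projection of \<open>s i n\<close> to \<open>a i\<close>, so that \<open>S i n\<close> below has none.
\<close>

definition e :: "int \<Rightarrow> int \<Rightarrow> 'f"
  where "e i n = 2 + (2 - \<kappa>) * lam i n"

lemma lam_minus: "lam i (- n) = lam i n"
proof -
  have "L (2 * i - i) (\<tau> i (a (i + n))) = L i (a (i + n))" by (rule L_\<tau>)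
  then show ?thesis by (simp add: lam_def \<tau>_axis algebra_simps)
qed

lemma lam_reflect: "lam (2 * j - i) n = lam i n"
proof -
  have "lam (2 * j - i) (- n) = lam i n"
    using L_\<tau>[of j i "a (i + n)"] by (simp add: lam_def \<tau>_axis algebra_simps)
  then show ?thesis by (simp add: lam_minus)
qed

lemma lam_parity: "even (i - j) \<Longrightarrow> lam i n = lam j n"
proof -
  assume "even (i - j)"
  then obtain c where "i = j + 2 * c" by (metis dvdE diff_add_cancel add.commute)
  then have "i = 2 * (j + c) - j" by simp
  then show ?thesis using lam_reflect by metis
qed

lemma axis_mult_axis: "a i \<bullet> a j = s i (j - i) + 2 *s (a i + a j)"
  by (simp add: s_def)

lemma s_sym: "s (i + n) (- n) = s i n"
  by (simp add: s_def mult_commute add.commute)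

definition B :: "int \<Rightarrow> int \<Rightarrow> 'v"
  where "B i n = a (i + n) + a (i - n) - (2 * lam i n) *s a i"

definition S :: "int \<Rightarrow> int \<Rightarrow> 'v"
  where "S i n = s i n + e i n *s a i"

text \<open>
  Twice the parts \<open>U\<close> and \<open>V\<close> of \<open>a (i + n)\<close> for the eigenvalues \<open>0\<close> and \<open>8\<close> are recovered from \<open>B\<close> and
  \<open>S\<close>, because the reflection \<open>\<tau> i\<close> moves \<open>a (i + n)\<close> to \<open>a (i - n)\<close> and changes the sign of the third part
  only. In particular \<open>s i n\<close> is fixed by \<open>\<tau> i\<close>, hence depends only on \<open>i\<close> modulo \<open>n\<close>.
\<close>
lemma split_BS:
  obtains U V where "a i \<bullet> U = 0" "a i \<bullet> V = 8 *s V" "\<tau> i U = U" "\<tau> i V = V"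
    "B i n = U + V" "S i n = 3 *s V - U"
proof -
  obtain x y z where v: "a (i + n) = lam i n *s a i + x + y + z"
    and e: "a i \<bullet> x = 0" "a i \<bullet> y = 8 *s y" "a i \<bullet> z = 2 *s z"
    and t: "\<tau> i x = x" "\<tau> i y = y" "\<tau> i z = - z"
    using eigen_split[of "a (i + n)" i] unfolding lam_def by blast
  have "\<tau> i (a (i + n)) = a (i - n)" by (simp add: \<tau>_axis)
  then have v': "a (i - n) = lam i n *s a i + x + y - z"
    by (simp add: v \<tau>_simps t)
  have 1: "B i n = 2 *s x + 2 *s y"
    unfolding B_def v v' by (rule vec_eqI) (simp add: lin_fun_simps algebra_simps)
  have 2: "S i n = 3 *s (2 *s y) - 2 *s x"
    unfolding S_def s_def e_def v
    by (rule vec_eqI) (simp add: lin_fun_simps bilin e idem algebra_simps)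
  show ?thesis
    by (rule that[of "2 *s x" "2 *s y"]) (simp_all add: 1 2 e t bilin \<tau>_simps)
qed

lemma s_\<tau>: "\<tau> i (s i n) = s i n"
proof -
  obtain U V where "\<tau> i U = U" "\<tau> i V = V" "S i n = 3 *s V - U" by (rule split_BS)
  then have "\<tau> i (S i n) = S i n" by (simp add: \<tau>_simps)
  then show ?thesis by (simp add: S_def \<tau>_simps)
qed

lemma s_shift: "s (i - n) n = s i n"
  using s_\<tau>[of i n] s_sym[of "i - n" n]
  by (simp add: s_def \<tau>_simps mult_commute add.commute)

lemma axis_mult_S: "a i \<bullet> S i n = 6 *s (B i n + S i n)"
  and L_S: "L i (S i n) = 0"
proof -
  obtain U V where *: "a i \<bullet> U = 0" "a i \<bullet> V = 8 *s V" "B i n = U + V" "S i n = 3 *s V - U"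
    by (rule split_BS)
  have "L i U = 0" using L_axis_mult[of i U] k0 by (simp add: * L_simps)
  moreover have "L i V = 0" using L_axis_mult[of i V] k8 by (simp add: * L_simps)
  ultimately show "L i (S i n) = 0" by (simp add: * L_simps)
  show "a i \<bullet> S i n = 6 *s (B i n + S i n)"
    by (rule vec_eqI) (simp add: * lin_fun_simps bilin)
qed

text \<open>
  With \<open>B = U + V\<close> and \<open>S = 3 V - U\<close> for both indices, the products \<open>p, q1, q2, r\<close> are combinations of
  \<open>U \<bullet> U'\<close>, \<open>U \<bullet> V'\<close>, \<open>V \<bullet> U'\<close> and \<open>V \<bullet> V'\<close>, on which \<open>a 0\<close> acts with the eigenvalues \<open>0, 8, 8\<close> and, on the last
  one, by projection to \<open>a 0\<close>. The first two equations combine them so that at most one action survives: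
  \<open>2 p - q1 - q2 = 4 (U \<bullet> U' - V \<bullet> V')\<close> and \<open>a 0 \<bullet> (3 p - q2) = 32 (U \<bullet> V')\<close>. The second one
  computes the product \<open>r\<close> of two elements \<open>S\<close> from products in which \<open>B\<close> or \<open>a 0\<close> is a factor.
\<close>
lemma pair_fusion:
  fixes m n :: int
  defines "p \<equiv> B 0 m \<bullet> B 0 n" and "q1 \<equiv> B 0 m \<bullet> S 0 n" and "q2 \<equiv> S 0 m \<bullet> B 0 n"
    and "r \<equiv> S 0 m \<bullet> S 0 n"
  shows "a 0 \<bullet> (2 *s p - q1 - q2) = - ((4 * \<kappa> * L 0 p) *s a 0)"
    and "2 *s r = 6 *s p + 6 *s q1 - 2 *s q2 - a 0 \<bullet> (3 *s p - q2)"
    and "L 0 q1 = 3 * L 0 p"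
proof -
  obtain U V where u: "a 0 \<bullet> U = 0" "a 0 \<bullet> V = 8 *s V" "B 0 m = U + V" "S 0 m = 3 *s V - U"
    by (rule split_BS)
  obtain U' V' where u': "a 0 \<bullet> U' = 0" "a 0 \<bullet> V' = 8 *s V'" "B 0 n = U' + V'" "S 0 n = 3 *s V' - U'"
    by (rule split_BS)
  have f00: "a 0 \<bullet> (U \<bullet> U') = 0" and f08: "a 0 \<bullet> (U \<bullet> V') = 8 *s (U \<bullet> V')"
    and f80: "a 0 \<bullet> (V \<bullet> U') = 8 *s (V \<bullet> U')"
    and f88: "a 0 \<bullet> (V \<bullet> V') = (\<kappa> * L 0 (V \<bullet> V')) *s a 0"
    using fusion_00[of 0 U U'] fusion_08[of 0 U V'] fusion_08[of 0 U' V] fusion_88[of 0 V V'] u u'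
    by (simp_all add: mult_commute)
  have L00: "L 0 (U \<bullet> U') = 0"
    using L_axis_mult[of 0 "U \<bullet> U'"] k0 by (simp add: f00 L_simps)
  have L08: "L 0 (U \<bullet> V') = 0" and L80: "L 0 (V \<bullet> U') = 0"
    using L_axis_mult[of 0 "U \<bullet> V'"] L_axis_mult[of 0 "V \<bullet> U'"] k8
    by (simp_all add: f08 f80 L_simps)
  have p: "p = U \<bullet> U' + U \<bullet> V' + V \<bullet> U' + V \<bullet> V'"
    and q1: "q1 = 3 *s (U \<bullet> V') - U \<bullet> U' + 3 *s (V \<bullet> V') - V \<bullet> U'"
    and q2: "q2 = 3 *s (V \<bullet> U') - U \<bullet> U' + 3 *s (V \<bullet> V') - U \<bullet> V'"
    and r: "r = 9 *s (V \<bullet> V') - 3 *s (V \<bullet> U') - 3 *s (U \<bullet> V') + U \<bullet> U'"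
    unfolding p_def q1_def q2_def r_def u u'
    by (rule vec_eqI, simp add: lin_fun_simps bilin algebra_simps)+
  show "L 0 q1 = 3 * L 0 p"
    by (simp add: p q1 L_simps L00 L08 L80)
  show "a 0 \<bullet> (2 *s p - q1 - q2) = - ((4 * \<kappa> * L 0 p) *s a 0)"
    by (rule vec_eqI)
      (simp add: p q1 q2 L_simps L00 L08 L80 bilin f00 f08 f80 f88 lin_fun_simps algebra_simps)
  show "2 *s r = 6 *s p + 6 *s q1 - 2 *s q2 - a 0 \<bullet> (3 *s p - q2)"
    by (rule vec_eqI)
      (simp add: p q1 q2 r L_simps L00 L08 L80 bilin f00 f08 f80 f88 lin_fun_simps algebra_simps)
qed

end

section \<open>Products of axes with the fixed elements\<close>

context axis_orbit
begin

lemma reindex_s: "axis_orbit.s scale mult (\<lambda>i. a (c * i + d)) i n = s (c * i + d) (c * n)"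
  unfolding axis_orbit.s_def[OF reindex] s_def by (simp add: distrib_left add.assoc add.left_commute add.commute)

lemma reindex_lam:
  "axis_orbit.lam (\<lambda>i. a (c * i + d)) (\<lambda>i. L (c * i + d)) i n = lam (c * i + d) (c * n)"
  unfolding axis_orbit.lam_def[OF reindex] lam_def by (simp add: distrib_left add.assoc add.left_commute add.commute)

lemma s_period: "n dvd i - j \<Longrightarrow> s i n = s j n"
proof -
  assume "n dvd i - j"
  then obtain t where t: "i = j + n * t" by (metis add.commute diff_add_cancel dvdE)
  have "s (j + n * t) n = s j n"
  proof (induction t rule: int_induct[where k = 0])
    case (step1 t)
    then show ?case using s_shift[of "j + n * (t + 1)" n] by (simp add: algebra_simps)
  next
    case (step2 t)
    then show ?case using s_shift[of "j + n * t" n] by (simp add: algebra_simps)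
  qed simp
  then show ?thesis by (simp add: t)
qed

lemma lam_mod: "lam i n = lam (i mod 2) n"
  by (rule lam_parity) presburger

text \<open>
  The indices of \<open>s\<close> and \<open>lam\<close> are reduced to \<open>{0..<n}\<close> and \<open>{0, 1}\<close> here and below, so that rewriting brings
  all products of axes with numerals as indices to a common normal form.
\<close>

lemma axis_mult_axis_up: "i < j \<Longrightarrow> a i \<bullet> a j = s (i mod (j - i)) (j - i) + 2 *s (a i + a j)"
  using s_period[of "j - i" i "i mod (j - i)"] by (simp add: axis_mult_axis minus_mod_eq_mult_div)

lemma axis_mult_axis_down: "j < i \<Longrightarrow> a i \<bullet> a j = s (j mod (i - j)) (i - j) + 2 *s (a j + a i)"
  using axis_mult_axis_up[of j i] by (simp add: mult_commute)

lemma axis_mult_s: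
  "n dvd i - j \<Longrightarrow> a i \<bullet> s j n = 6 *s (a (i + n) + a (i - n)) + 6 *s s j n
    + ((6 - \<kappa>) * e (i mod 2) n - 12 * lam (i mod 2) n) *s a i"
proof -
  assume "n dvd i - j"
  then have "s j n = s i n" by (metis s_period)
  moreover have "a i \<bullet> s i n = 6 *s (a (i + n) + a (i - n)) + 6 *s s i n
    + ((6 - \<kappa>) * e i n - 12 * lam i n) *s a i"
  proof (rule vec_eqI)
    fix f :: "'v \<Rightarrow> 'f" assume f: "lin_fun f"
    show "f (a i \<bullet> s i n) = f (6 *s (a (i + n) + a (i - n)) + 6 *s s i n
      + ((6 - \<kappa>) * e i n - 12 * lam i n) *s a i)"
      using arg_cong[OF axis_mult_S[of i n], of f] unfolding S_def B_def
      by (simp add: bilin idem lin_fun_simps[OF f]) algebra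
  qed
  ultimately show ?thesis by (simp add: e_def lam_mod[of i])
qed

lemma numeral_nonzero: "(4::'f) \<noteq> 0" "(6::'f) \<noteq> 0" "(8::'f) \<noteq> 0" "(18::'f) \<noteq> 0"
  "(12::'f) \<noteq> 0" "(16::'f) \<noteq> 0"
proof -
  have "(4::'f) = 2 * 2" "(6::'f) = 2 * 3" "(8::'f) = 2 * 2 * 2" "(18::'f) = 2 * 3 * 3"
    "(12::'f) = 2 * 2 * 3" "(16::'f) = 2 * 2 * 2 * 2" by simp_all
  then show "(4::'f) \<noteq> 0" "(6::'f) \<noteq> 0" "(8::'f) \<noteq> 0" "(18::'f) \<noteq> 0"
    "(12::'f) \<noteq> 0" "(16::'f) \<noteq> 0"
    using two three by (metis mult_eq_0_iff)+
qed

abbreviation "\<sigma> \<equiv> s 0 1"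

lemmas prods = axis_mult_axis_up axis_mult_axis_down idem axis_mult_s
  trans[OF mult_commute axis_mult_s]

lemma L_axis: "i < j \<Longrightarrow> L i (a j) = lam (i mod 2) (j - i)"
  "j < i \<Longrightarrow> L i (a j) = lam (i mod 2) (i - j)"
proof -
  have "L i (a j) = lam (i mod 2) (j - i)"
    using lam_mod[of i "j - i"] by (simp add: lam_def)
  moreover from this have "L i (a j) = lam (i mod 2) (i - j)"
    using lam_minus[of "i mod 2" "i - j"] by simp
  ultimately show "i < j \<Longrightarrow> L i (a j) = lam (i mod 2) (j - i)"
    "j < i \<Longrightarrow> L i (a j) = lam (i mod 2) (i - j)" by simp_all
qed

lemma L_s: "n dvd i - j \<Longrightarrow> L i (s j n) = - e (i mod 2) n"
proof -
  assume "n dvd i - j"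
  then have "L i (s j n) = L i (S i n) - e i n"
    by (simp add: S_def L_simps L_self s_period[of n i j])
  then show ?thesis using lam_mod[of i n] by (simp add: L_S e_def)
qed

lemmas Ls = L_simps L_self L_axis L_s

text \<open>
  \<open>P i\<close> vanishes if and only if \<open>lam i 1\<close> has the exceptional value \<open>(18 * \<beta> - 1) / 8\<close>, where \<open>\<kappa> = 2 / \<beta>\<close>.
\<close>

definition P :: "int \<Rightarrow> 'f" where "P i = 8 * \<kappa> * lam i 1 + \<kappa> - 36"

definition D :: "int \<Rightarrow> 'f" where
  "D i = \<kappa>^2 * lam (1 - i) 1 - 8 * \<kappa> * lam i 1 - 8 * \<kappa> * lam (1 - i) 1 - 3 * \<kappa> + 60"

text \<open>
  The coefficients of \<open>a i\<close> in \<open>a i \<bullet> s (i + 1) 2\<close> and in \<open>\<sigma> \<bullet> \<sigma>\<close>, computed around \<open>a i\<close>, are \<open>w i\<close> and \<open>g i\<close>; the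
  coefficients of \<open>\<sigma>\<close> are \<open>D i\<close> and, further below, \<open>E i\<close>. Only
  \<open>w\<close> has a denominator; it comes from solving \<open>L 0 q1 = 3 * L 0 p\<close> for the projection of \<open>s 1 2\<close> to \<open>a 0\<close>.
\<close>

definition w3 :: "int \<Rightarrow> 'f" where
  "w3 i = 396 - 24 * \<kappa> - 12 * \<kappa> * lam i 2 - (240 * \<kappa> - 12 * \<kappa>^2) * lam i 1
     - (48 * \<kappa> - 6 * \<kappa>^2) * lam (1 - i) 1 + (32 * \<kappa>^2 - \<kappa>^3) * lam i 1 ^ 2
     + (16 * \<kappa>^2 - 2 * \<kappa>^3) * lam i 1 * lam (1 - i) 1"

definition w :: "int \<Rightarrow> 'f" where "w i = w3 i / 3"

lemma w: "3 * w i = w3 i"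
  using three by (simp add: w_def)

definition g :: "int \<Rightarrow> 'f" where
  "g i = 12 * \<kappa> - 288 + 12 * \<kappa> * lam i 2 + (208 * \<kappa> - 8 * \<kappa>^2) * lam i 1
     + (32 * \<kappa> - 4 * \<kappa>^2) * lam (1 - i) 1 + (\<kappa>^3 - 32 * \<kappa>^2) * lam i 1 ^ 2
     + (2 * \<kappa>^3 - 16 * \<kappa>^2) * lam i 1 * lam (1 - i) 1"

text \<open>
  The product \<open>s 1 2\<close> enters \<open>p\<close> through \<open>a 1 \<bullet> a (-1)\<close>, while \<open>q1 = q2\<close> involves only products that are known;
  so the first equation of \<open>pair_fusion\<close> can be solved for \<open>a 0 \<bullet> s 1 2\<close>.
\<close>

lemma axis_mult_adj_0:
  "a 0 \<bullet> s 1 2 = w 0 *s a 0 + D 0 *s (a 1 + a (-1) + \<sigma>) + 6 *s (a 2 + a (-2)) + 6 *s s 0 2"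
  (is "?l = ?r")
proof (rule vec_eqI)
  fix f :: "'v \<Rightarrow> 'f" assume f: "lin_fun f"
  let ?p = "B 0 1 \<bullet> B 0 1" and ?q1 = "B 0 1 \<bullet> S 0 1" and ?q2 = "S 0 1 \<bullet> B 0 1"
  have "12 * (f ?l - f ?r) = 3 * (f (a 0 \<bullet> (2 *s ?p - ?q1 - ?q2)) - f (- ((4 * \<kappa> * L 0 ?p) *s a 0)))
    - 4 * \<kappa> * f (a 0) * (3 * L 0 ?p - L 0 ?q1) - 4 * f (a 0) * (3 * w 0 - w3 0)"
    by (simp add: B_def S_def D_def w3_def bilin prods Ls lin_fun_simps[OF f] e_def) algebra
  also have "\<dots> = 0"
    by (simp only: pair_fusion(1,3) w) simp
  finally show "f ?l = f ?r"
    using numeral_nonzero(5) by simp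
qed

definition E :: "int \<Rightarrow> 'f" where
  "E i = 24 * \<kappa> * lam i 1 + (16 * \<kappa> - 2 * \<kappa>^2) * lam (1 - i) 1 + 4 * \<kappa> - 120"

text \<open>
  The second equation of \<open>pair_fusion\<close>, where \<open>r = S 0 1 \<bullet> S 0 1\<close> contains \<open>\<sigma> \<bullet> \<sigma>\<close> and everything else is known.
  Its coefficient at \<open>a 1 + a (-1)\<close> is the source of the exceptional value of the projections.
\<close>

lemma sigma_sq_0:
  "\<sigma> \<bullet> \<sigma> = g 0 *s a 0 + (3 * P 0) *s (a 1 + a (-1)) + E 0 *s \<sigma> - 12 *s s 0 2 + 6 *s s 1 2"
  (is "?l = ?r")
proof (rule vec_eqI)
  fix f :: "'v \<Rightarrow> 'f" assume f: "lin_fun f"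
  let ?p = "B 0 1 \<bullet> B 0 1" and ?q1 = "B 0 1 \<bullet> S 0 1" and ?q2 = "S 0 1 \<bullet> B 0 1"
    and ?rr = "S 0 1 \<bullet> S 0 1"
  have "2 * (f ?l - f ?r) = f (2 *s ?rr) - f (6 *s ?p + 6 *s ?q1 - 2 *s ?q2 - a 0 \<bullet> (3 *s ?p - ?q2))
    - 2 * f (a 0) * (3 * w 0 - w3 0)"
    by (simp add: B_def S_def D_def E_def P_def g_def w3_def bilin prods axis_mult_adj_0 Ls
      lin_fun_simps[OF f] e_def) algebra
  also have "\<dots> = 0"
    by (simp only: pair_fusion(2) w) simp
  finally show "f ?l = f ?r"
    using two by simp
qed

end

section \<open>A linear relation and an invariant subspace\<close>

context axis_orbit
begin

lemma axis_mult_adj: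
  assumes "odd (i - j)"
  shows "a i \<bullet> s j 2 = w (i mod 2) *s a i + D (i mod 2) *s (a (i + 1) + a (i - 1) + \<sigma>)
    + 6 *s (a (i + 2) + a (i - 2)) + 6 *s s (i mod 2) 2"
proof -
  interpret sh: axis_orbit scale mult \<kappa> "\<lambda>j. a (1 * j + i)" "\<lambda>j. \<tau> (1 * j + i)" "\<lambda>j. L (1 * j + i)"
    by (rule reindex)
  have s: "s (1 + i) 2 = s j 2" "s i 2 = s (i mod 2) 2" "s i 1 = \<sigma>"
    using assms by (auto intro!: s_period)
  have l: "lam (1 + i) n = lam (1 - i mod 2) n" "lam i n = lam (i mod 2) n" for n
    by (rule lam_parity, presburger)+
  show ?thesis
    using sh.axis_mult_adj_0
    unfolding reindex_s reindex_lam sh.w_def sh.w3_def sh.D_def w_def w3_def D_def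
    by (simp add: l s add.commute)
qed

lemma sigma_sq:
  "\<sigma> \<bullet> \<sigma> = g i *s a i + (3 * P i) *s (a (i + 1) + a (i - 1)) + E i *s \<sigma> - 12 *s s i 2
     + 6 *s s (i + 1) 2"
proof -
  interpret sh: axis_orbit scale mult \<kappa> "\<lambda>j. a (1 * j + i)" "\<lambda>j. \<tau> (1 * j + i)" "\<lambda>j. L (1 * j + i)"
    by (rule reindex)
  have s: "s i 1 = \<sigma>"
    by (auto intro!: s_period)
  have l: "lam (1 + i) n = lam (1 - i) n" for n
    by (auto intro!: lam_parity)
  show ?thesis
    using sh.sigma_sq_0
    unfolding reindex_s reindex_lam sh.g_def sh.P_def sh.E_def g_def P_def E_def
    by (simp add: l s add.commute)
qed

text \<open>
  The difference of the expressions for \<open>\<sigma> \<bullet> \<sigma>\<close> around \<open>a 0\<close> and around \<open>a 1\<close>.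
\<close>

abbreviation rel_vec :: 'v where
  "rel_vec \<equiv> (3 * P 0) *s a (-1) + (g 0 - 3 * P 1) *s a 0 + (3 * P 0 - g 1) *s a 1 - (3 * P 1) *s a 2
    + (E 0 - E 1) *s \<sigma> + 18 *s (s 1 2 - s 0 2)"

lemma rel: "rel_vec = 0"
proof -
  have s: "s 2 2 = s 0 2" by (rule s_period) simp
  show ?thesis
  proof (rule vec_eqI)
    fix f :: "'v \<Rightarrow> 'f" assume f: "lin_fun f"
    have "f rel_vec = f (g 0 *s a 0 + (3 * P 0) *s (a 1 + a (-1)) + E 0 *s \<sigma> - 12 *s s 0 2 + 6 *s s 1 2)
      - f (g 1 *s a 1 + (3 * P 1) *s (a 2 + a 0) + E 1 *s \<sigma> - 12 *s s 1 2 + 6 *s s 0 2)"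
      by (simp add: lin_fun_simps[OF f] algebra_simps)
    also have "\<dots> = 0"
      using sigma_sq[of 0] sigma_sq[of 1] by (simp add: s)
    finally show "f rel_vec = f 0" by (simp add: lin_fun_simps[OF f])
  qed
qed

lemma \<tau>_s: "\<tau> j (s i n) = s (2 * j - i - n) n"
  using s_sym[of "2 * j - i - n" n] by (simp add: s_def \<tau>_simps algebra_simps mult_commute)

lemma \<tau>_zero: "\<tau> j 0 = 0"
  using \<tau>_scale[of j 0 0] by simp

lemma \<tau>_s': "n dvd 2 * j - i - k \<Longrightarrow> \<tau> j (s i n) = s k n"
  using s_period[of n "2 * j - i - n" k] dvd_add_triv_right_iff[of n "2 * j - i - n - k"]
  by (simp add: \<tau>_s algebra_simps)

text \<open>
  All elements \<open>s\<close> in \<open>rel\<close> are fixed by \<open>\<tau> 0\<close>, so they disappear from its antisymmetrisation.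
\<close>

lemma rel_\<tau>: "(3 * P 1) *s (a 2 - a (-2)) = - (g 1 *s (a 1 - a (-1)))"
proof -
  have t: "\<tau> 0 \<sigma> = \<sigma>" "\<tau> 0 (s 0 2) = s 0 2" "\<tau> 0 (s 1 2) = s 1 2"
    by (auto intro!: \<tau>_s')
  note r' = arg_cong[OF rel, of "\<tau> 0", simplified \<tau>_simps \<tau>_zero t]
  show ?thesis
  proof (rule vec_eqI)
    fix f :: "'v \<Rightarrow> 'f" assume f: "lin_fun f"
    show "f ((3 * P 1) *s (a 2 - a (-2))) = f (- (g 1 *s (a 1 - a (-1))))"
      using arg_cong[OF rel, of f] arg_cong[OF r', of f]
      by (simp add: lin_fun_simps[OF f]) algebra
  qed
qed

lemma reindex_coeffs:
  assumes "c = 1 \<or> c = -1"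
  shows "axis_orbit.P \<kappa> (\<lambda>i. a (c * i + d)) (\<lambda>i. L (c * i + d)) i = P (c * i + d)"
    and "axis_orbit.g \<kappa> (\<lambda>i. a (c * i + d)) (\<lambda>i. L (c * i + d)) i = g (c * i + d)"
proof -
  have l: "lam (c * (1 - i) + d) n = lam (1 - (c * i + d)) n" for n
    using assms by (intro lam_parity) auto
  have m: "lam i (c * n) = lam i n" for i n
    using assms lam_minus by auto
  show "axis_orbit.P \<kappa> (\<lambda>i. a (c * i + d)) (\<lambda>i. L (c * i + d)) i = P (c * i + d)"
    and "axis_orbit.g \<kappa> (\<lambda>i. a (c * i + d)) (\<lambda>i. L (c * i + d)) i = g (c * i + d)"
    unfolding axis_orbit.P_def[OF reindex] axis_orbit.g_def[OF reindex] reindex_lam P_def g_def l m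
    by (rule refl)+
qed

lemma axes_in_subspace:
  assumes "subspace W" "a 0 \<in> W" "a 1 \<in> W" "\<tau> 0 ` W \<subseteq> W" "\<tau> 1 ` W \<subseteq> W"
  shows "a i \<in> W"
proof (rule index_induct[where Q = "\<lambda>i. a i \<in> W"])
  show "a (- i) \<in> W" "a (2 - i) \<in> W" if "a i \<in> W" for i
    using imageI[OF that, of "\<tau> 0"] imageI[OF that, of "\<tau> 1"] assms(4,5) by (auto simp: \<tau>_axis)
qed (use assms in auto)

lemma \<tau>_span: "x \<in> span X \<Longrightarrow> \<tau> j x \<in> span (\<tau> j ` X)"
proof (induction rule: span_induct_alt)
  case base
  then show ?case by (simp add: \<tau>_zero span_zero)
next
  case (step c x y)
  then show ?case by (simp add: \<tau>_simps span_add span_scale span_base)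
qed

lemma axes_in_span:
  assumes "a 0 \<in> span X" "a 1 \<in> span X" "\<And>x. x \<in> X \<Longrightarrow> \<tau> 0 x \<in> span X" "\<And>x. x \<in> X \<Longrightarrow> \<tau> 1 x \<in> span X"
  shows "a i \<in> span X"
proof (rule axes_in_subspace)
  have *: "\<tau> j ` span X \<subseteq> span X" if "\<And>x. x \<in> X \<Longrightarrow> \<tau> j x \<in> span X" for j
  proof
    fix y assume "y \<in> \<tau> j ` span X"
    then have "y \<in> span (\<tau> j ` X)" using \<tau>_span by auto
    also have "\<dots> \<subseteq> span X" using that by (intro span_minimal) auto
    finally show "y \<in> span X" .
  qed
  show "\<tau> 0 ` span X \<subseteq> span X" "\<tau> 1 ` span X \<subseteq> span X" using * assms by blast+
qed (use assms in auto)

definition U :: "'v set" where "U = span (range a \<union> {\<sigma>, s 0 2, s 1 2})"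

lemma U_sub: "subspace U" by (simp add: U_def)

lemmas U_closed = subspace_add[OF U_sub] subspace_diff[OF U_sub] subspace_scale[OF U_sub]
  subspace_0[OF U_sub] subspace_neg[OF U_sub]

lemma U_gens: "a i \<in> U" "\<sigma> \<in> U" "s 0 2 \<in> U" "s 1 2 \<in> U"
  by (auto simp: U_def intro: span_base)

lemma U_s: "s i 1 \<in> U" "s i 2 \<in> U"
proof -
  have "s i 1 = \<sigma>" by (rule s_period) simp
  then show "s i 1 \<in> U" by (simp add: U_gens)
  have "s i 2 = s (i mod 2) 2" by (rule s_period) presburger
  moreover have "i mod 2 = 0 \<or> i mod 2 = 1" by presburger
  ultimately show "s i 2 \<in> U" by (metis U_gens(3,4))
qed

lemma \<tau>_U: "x \<in> U \<Longrightarrow> \<tau> j x \<in> U"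
proof -
  have "\<tau> j ` (range a \<union> {\<sigma>, s 0 2, s 1 2}) \<subseteq> U"
    by (auto simp: \<tau>_axis \<tau>_s U_gens U_s)
  moreover assume "x \<in> U"
  ultimately show ?thesis using \<tau>_span[of x "range a \<union> {\<sigma>, s 0 2, s 1 2}" j] span_minimal[OF _ U_sub]
    unfolding U_def by blast
qed

lemma mult_span_into:
  assumes "subspace T" "\<And>x. x \<in> X \<Longrightarrow> u \<bullet> x \<in> T" "x \<in> span X"
  shows "u \<bullet> x \<in> T"
  using assms(3)
proof (induction rule: span_induct_alt)
  case base
  then show ?case using prod_zero_left[of u] mult_commute[of 0 u] subspace_0[OF assms(1)] by simp
next
  case (step c x y)
  then show ?case by (simp add: bilin assms(2) subspace_add[OF assms(1)] subspace_scale[OF assms(1)])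
qed

lemma axis_mult_U:
  assumes "\<And>n. a i \<bullet> a n \<in> U" and "x \<in> U"
  shows "a i \<bullet> x \<in> U"
proof (rule mult_span_into[OF U_sub _ assms(2)[unfolded U_def]])
  fix x assume x: "x \<in> range a \<union> {\<sigma>, s 0 2, s 1 2}"
  have "a i \<bullet> s j 2 \<in> U" for j
  proof (cases "odd (i - j)")
    case True
    then show ?thesis by (simp add: axis_mult_adj U_closed U_gens U_s)
  next
    case False
    then show ?thesis by (simp add: axis_mult_s U_closed U_gens U_s)
  qed
  moreover have "a i \<bullet> \<sigma> \<in> U" by (simp add: axis_mult_s U_closed U_gens U_s)
  ultimately show "a i \<bullet> x \<in> U" using x assms(1) by auto
qed

lemma rel_s: "s 1 2 \<in> span ({a (-1), a 0, a 1, a 2} \<union> {\<sigma>, s 0 2})" (is "_ \<in> ?W")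
proof -
  have "18 *s s 1 2 = 18 *s s 0 2 - (rel_vec - 18 *s (s 1 2 - s 0 2))"
    unfolding rel by (simp add: scale_right_diff_distrib)
  also have "\<dots> = 18 *s s 0 2 - ((3 * P 0) *s a (-1) + (g 0 - 3 * P 1) *s a 0 + (3 * P 0 - g 1) *s a 1
      - (3 * P 1) *s a 2 + (E 0 - E 1) *s \<sigma>)"
    by (simp only: add_diff_cancel_right')
  also have "\<dots> \<in> ?W" by (intro span_diff span_add span_scale; auto intro: span_base)
  finally have "inverse 18 *s (18 *s s 1 2) \<in> ?W" by (rule span_scale)
  then show ?thesis using numeral_nonzero(4) by simp
qed

lemma U_eq: "U = span (range a \<union> {\<sigma>, s 0 2})"
proof -
  have "s 1 2 \<in> span (range a \<union> {\<sigma>, s 0 2})"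
    using rel_s span_mono[of "{a (-1), a 0, a 1, a 2} \<union> {\<sigma>, s 0 2}" "range a \<union> {\<sigma>, s 0 2}"] by auto
  moreover have "range a \<union> {\<sigma>, s 0 2, s 1 2} = insert (s 1 2) (range a \<union> {\<sigma>, s 0 2})" by auto
  ultimately show ?thesis unfolding U_def by (simp add: span_redundant)
qed

text \<open>
  Products of axes with \<open>\<sigma>\<close> and \<open>s 0 2\<close> are known explicitly. Products among the latter need no formula: the
  second equation of \<open>pair_fusion\<close> expresses them by products in which an axis or a sum of axes
  is a factor.
\<close>

lemma U_mult:
  assumes aa: "\<And>i n. a i \<bullet> a n \<in> U" and "x \<in> U" "y \<in> U"
  shows "x \<bullet> y \<in> U"
proof -
  note aU = axis_mult_U[OF aa]
  have aU': "x \<bullet> a i \<in> U" if "x \<in> U" for i x using aU[OF that] by (simp add: mult_commute)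
  have ss: "s 0 m \<bullet> s 0 n \<in> U" if m: "s 0 m \<in> U" and n: "s 0 n \<in> U" for m n
  proof -
    have BU: "B 0 m \<in> U" "B 0 n \<in> U" and SU: "S 0 m \<in> U" "S 0 n \<in> U"
      using m n by (simp_all add: B_def S_def U_closed U_gens)
    have B: "B 0 k \<bullet> x \<in> U" "x \<bullet> B 0 k \<in> U" if "x \<in> U" for x k
      using aU[OF that] by (simp_all add: B_def bilin U_closed mult_commute[of x])
    have "2 *s (S 0 m \<bullet> S 0 n) \<in> U"
      unfolding pair_fusion(2) by (intro U_closed aU B BU SU)
    then have "inverse 2 *s (2 *s (S 0 m \<bullet> S 0 n)) \<in> U" by (rule U_closed)
    then have "S 0 m \<bullet> S 0 n \<in> U" using two by simp
    moreover have "s 0 m \<bullet> s 0 n = S 0 m \<bullet> S 0 n - e 0 m *s (a 0 \<bullet> S 0 n) - e 0 n *s (s 0 m \<bullet> a 0)"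
      by (simp add: S_def bilin algebra_simps)
    ultimately show ?thesis using aU[OF SU(2)] aU'[OF m] by (simp add: U_closed)
  qed
  have gU: "u \<bullet> v \<in> U" if "u \<in> range a \<union> {\<sigma>, s 0 2}" "v \<in> range a \<union> {\<sigma>, s 0 2}" for u v
    using that by (auto intro: aU aU' ss U_gens)
  have "u \<bullet> y \<in> U" if u: "u \<in> range a \<union> {\<sigma>, s 0 2}" for u
    using mult_span_into[OF U_sub gU[OF u] assms(3)[unfolded U_eq]] .
  then have "y \<bullet> x \<in> U"
    using mult_span_into[OF U_sub _ assms(2)[unfolded U_eq]] by (metis mult_commute)
  then show ?thesis by (simp add: mult_commute)
qed

lemma generate:
  assumes gen: "\<And>T. subspace T \<Longrightarrow> a 0 \<in> T \<Longrightarrow> a 1 \<in> T \<Longrightarrow>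
      (\<And>x y. x \<in> T \<Longrightarrow> y \<in> T \<Longrightarrow> x \<bullet> y \<in> T) \<Longrightarrow> T = UNIV"
    and W: "\<And>i. a i \<in> span W" "\<And>x. x \<in> W \<Longrightarrow> a 0 \<bullet> x \<in> U" "\<And>x. x \<in> W \<Longrightarrow> a 1 \<bullet> x \<in> U"
  shows "span (W \<union> {\<sigma>, s 0 2}) = UNIV"
proof -
  have t: "a (2 * j - i) \<bullet> a n \<in> U" if "\<And>n. a i \<bullet> a n \<in> U" for i j n
    using \<tau>_U[OF that[of "2 * j - n"], of j] by (simp add: \<tau>_simps)
  have "\<forall>n. a i \<bullet> a n \<in> U" for i
  proof (rule index_induct[where Q = "\<lambda>i. \<forall>n. a i \<bullet> a n \<in> U"])
    show "\<forall>n. a (- i) \<bullet> a n \<in> U" "\<forall>n. a (2 - i) \<bullet> a n \<in> U" if "\<forall>n. a i \<bullet> a n \<in> U" for i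
      using t[of i 0] t[of i 1] that by auto
  qed (use mult_span_into[OF U_sub] W in blast)+
  then have aa: "a i \<bullet> a n \<in> U" for i n by blast
  have "U = UNIV"
    by (rule gen) (fact U_sub U_gens | rule U_mult[OF aa]; assumption)+
  moreover have "U \<subseteq> span (W \<union> {\<sigma>, s 0 2})"
    unfolding U_eq using W(1) span_mono[of W "W \<union> {\<sigma>, s 0 2}"]
    by (intro span_minimal) (auto intro: span_base)
  ultimately show ?thesis by auto
qed

end

section \<open>Few exceptional projections\<close>

locale generated_orbit = axis_orbit scale mult \<kappa> a \<tau> L
  for scale :: "'f::field \<Rightarrow> 'v::ab_group_add \<Rightarrow> 'v" (infixr "*s" 75)
    and mult :: "'v \<Rightarrow> 'v \<Rightarrow> 'v" (infixl "\<bullet>" 70)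
    and \<kappa> a \<tau> L +
  assumes gen: "subspace T \<Longrightarrow> a 0 \<in> T \<Longrightarrow> a 1 \<in> T \<Longrightarrow>
    (\<And>x y. x \<in> T \<Longrightarrow> y \<in> T \<Longrightarrow> x \<bullet> y \<in> T) \<Longrightarrow> T = UNIV"
begin

lemma mirror: "generated_orbit scale mult \<kappa> (\<lambda>i. a (-1 * i + 1)) (\<lambda>i. \<tau> (-1 * i + 1)) (\<lambda>i. L (-1 * i + 1))"
  by (intro generated_orbit.intro reindex) (unfold_locales, rule gen, simp_all)

text \<open>
  The combinatorial core of all four cases: the span of a set that contains \<open>a 0\<close> and \<open>a 1\<close> and is stable
  under the two reflections contains every axis, and it suffices to multiply its elements by these
  two axes, since \<open>U\<close> is invariant under the dihedral group.
\<close>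

lemma generate_window:
  assumes "a 0 \<in> span X" "a 1 \<in> span X" "\<And>x. x \<in> X \<Longrightarrow> \<tau> 0 x \<in> span X"
    "\<And>x. x \<in> X \<Longrightarrow> \<tau> 1 x \<in> span X"
    and "\<And>x. x \<in> X \<Longrightarrow> a 0 \<bullet> x \<in> U" "\<And>x. x \<in> X \<Longrightarrow> a 1 \<bullet> x \<in> U"
  shows "span (X \<union> {\<sigma>, s 0 2}) = UNIV"
proof (rule generate)
  show "a i \<in> span X" for i by (rule axes_in_span) (fact assms)+
qed (fact gen assms)+

text \<open>
  Products of axes at distance at most two need no argument: they involve \<open>\<sigma>\<close>, \<open>s 0 2\<close> and \<open>s 1 2\<close> only.
\<close>

lemma axis_prod_U: "\<bar>i - j\<bar> \<le> 2 \<Longrightarrow> a i \<bullet> a j \<in> U"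
proof -
  assume "\<bar>i - j\<bar> \<le> 2"
  then consider "j = i - 2" | "j = i - 1" | "j = i" | "j = i + 1" | "j = i + 2" by force
  then show ?thesis
    by cases (simp_all add: prods U_closed U_gens U_s)
qed

text \<open>
  Equal axes have equal involutions, so one coincidence of axes propagates through the orbit.
\<close>

lemma cong_axes: "a i = a j \<Longrightarrow> a (2 * i - k) = a (2 * j - k)"
  using \<tau>_cong[of i j] \<tau>_axis by metis

lemma degenerate_odd:
  assumes "a 1 = a (-1)"
  shows "span ({a 0, a 1, a 2} \<union> {\<sigma>, s 0 2}) = UNIV"
proof (rule generate_window)
  have "a 2 = a (-2)" using cong_axes[OF assms, of 0] by simp
  then show "\<tau> 0 x \<in> span {a 0, a 1, a 2}" if "x \<in> {a 0, a 1, a 2}" for x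
    using that assms by (auto simp: \<tau>_axis intro: span_base)
qed (auto simp: \<tau>_axis intro: span_base intro!: axis_prod_U)

lemma degenerate_even:
  assumes "a 0 = a 2"
  shows "span ({a (-1), a 0, a 1} \<union> {\<sigma>, s 0 2}) = UNIV"
proof (rule generate_window)
  have "a (-1) = a 3" using cong_axes[OF assms, of 1] by simp
  then show "\<tau> 1 x \<in> span {a (-1), a 0, a 1}" if "x \<in> {a (-1), a 0, a 1}" for x
    using that assms by (auto simp: \<tau>_axis intro: span_base)
qed (auto simp: \<tau>_axis intro: span_base intro!: axis_prod_U)

lemma rel_\<tau>_mirror: "(3 * P 0) *s (a (-1) - a 3) = - (g 0 *s (a 0 - a 2))"
proof -
  interpret mir: generated_orbit scale mult \<kappa> "\<lambda>i. a (-1 * i + 1)" "\<lambda>i. \<tau> (-1 * i + 1)" "\<lambda>i. L (-1 * i + 1)"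
    by (rule mirror)
  show ?thesis using mir.rel_\<tau> reindex_coeffs[of "-1" 1] by simp
qed

lemma solve: "c \<noteq> 0 \<Longrightarrow> c *s x \<in> span X \<Longrightarrow> x \<in> span X"
  using span_scale[of "c *s x" X "inverse c"] by simp

text \<open>
  The antisymmetrised relation and its mirror image extend the window \<open>-1, ..., 2\<close> by one step to the
  left if \<open>P 1 \<noteq> 0\<close>, and to the right if \<open>P 0 \<noteq> 0\<close>.
\<close>

lemma left_end:
  assumes "P 1 \<noteq> 0"
  shows "a (-2) \<in> span {a (-1), a 0, a 1, a 2}"
proof (rule solve)
  show "3 * P 1 \<noteq> 0" using assms three by simp
  have "(3 * P 1) *s a (-2) = (3 * P 1) *s a 2 + g 1 *s (a 1 - a (-1))"
    using rel_\<tau> by (simp add: scale_right_diff_distrib) (simp add: algebra_simps)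
  then show "(3 * P 1) *s a (-2) \<in> span {a (-1), a 0, a 1, a 2}"
    by (simp add: span_add span_scale span_diff span_base)
qed

lemma right_end:
  assumes "P 0 \<noteq> 0"
  shows "a 3 \<in> span {a (-1), a 0, a 2}"
proof (rule solve)
  show "3 * P 0 \<noteq> 0" using assms three by simp
  have "(3 * P 0) *s a 3 = (3 * P 0) *s a (-1) + g 0 *s (a 0 - a 2)"
    using rel_\<tau>_mirror by (simp add: scale_right_diff_distrib) (simp add: algebra_simps)
  then show "(3 * P 0) *s a 3 \<in> span {a (-1), a 0, a 2}"
    by (simp add: span_add span_scale span_diff span_base)
qed

lemma window4:
  assumes "a (-2) \<in> span {a (-1), a 0, a 1, a 2}" "a 3 \<in> span {a (-1), a 0, a 1, a 2}"
  shows "span ({a (-1), a 0, a 1, a 2} \<union> {\<sigma>, s 0 2}) = UNIV"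
  by (rule generate_window) (use assms in \<open>auto simp: \<tau>_axis intro: span_base intro!: axis_prod_U\<close>)

lemma span_none_exceptional:
  assumes "P 0 \<noteq> 0" "P 1 \<noteq> 0"
  shows "span ({a (-1), a 0, a 1, a 2} \<union> {\<sigma>, s 0 2}) = UNIV"
proof (rule window4[OF left_end])
  have "{a (-1), a 0, a 2} \<subseteq> {a (-1), a 0, a 1, a 2}" by auto
  then show "a 3 \<in> span {a (-1), a 0, a 1, a 2}" using right_end[OF assms(1)] span_mono by blast
qed (fact assms)

text \<open>
  The coefficient of \<open>a 0\<close> in \<open>a 0 \<bullet> rel_vec\<close> when \<open>P 1 = g 1 = 0\<close>.
\<close>

definition y0 :: 'f where "y0 = \<kappa> * g 0 + 12 * P 0 + (E 0 - E 1) * ((6-\<kappa>) * e 0 1 - 12 * lam 0 1)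
  + 18 * w 0 - 18 * ((6-\<kappa>) * e 0 2 - 12 * lam 0 2)"

text \<open>
  Under these hypotheses the coefficients of \<open>a 1\<close>, \<open>a (-1)\<close> and \<open>\<sigma>\<close> in \<open>4 *s (a 0 \<bullet> rel_vec)\<close> agree, those of
  \<open>a 2\<close> and \<open>s 0 2\<close> vanish, and \<open>a (-2)\<close> cancels.
\<close>

lemma a0_rel:
  assumes "P 1 = 0" "g 1 = 0"
  shows "(3 * \<kappa> * (\<kappa> - 4) * (16 * lam 0 1 - 1)) *s (a 1 + a (-1) + \<sigma>) = - (4 * y0) *s a 0"
    (is "?l = ?r")
proof (rule vec_eqI)
  fix f :: "'v \<Rightarrow> 'f" assume f: "lin_fun f"
  have "f ?l - f ?r = 4 * f (a 0 \<bullet> rel_vec)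
    - P 1 * ((3 * \<kappa> - 96) * f (a 1 + a (-1) + \<sigma>) - 24 * f (a 2)
      - 12 * f (s 0 2) - (12 * \<kappa> + 24) * f (a 0))
    + g 1 * f (8 *s a 1 + 8 *s a 0 + 4 *s \<sigma>)"
    by (simp add: P_def E_def D_def y0_def e_def bilin prods axis_mult_adj lin_fun_simps[OF f]) algebra
  also have "\<dots> = 0"
    unfolding rel using assms prod_zero_left[of "a 0"] mult_commute[of 0 "a 0"] by (simp add: lin_fun_simps[OF f])
  finally show "f ?l = f ?r" by simp
qed

text \<open>
  The part of \<open>a 1 \<bullet> rel_vec\<close> that is antisymmetric under \<open>\<tau> 0\<close>.
\<close>

lemma a1_rel:
  assumes "P 1 = 0" "g 1 = 0"
  shows "(6 * (E 0 - E 1) - 18 * D 1) *s (a 2 - a (-2)) +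
    (2 * g 0 + 3 * P 0 * \<kappa> + (E 0 - E 1) * ((6 - \<kappa>) * e 1 1 - 12 * lam 1 1)
      + 18 * ((6 - \<kappa>) * e 1 2 - 12 * lam 1 2) - 18 * w 1) *s (a 1 - a (-1)) = 0"
    (is "?l = 0")
proof -
  have t: "\<tau> 0 \<sigma> = \<sigma>" "\<tau> 0 (s 1 2) = s 1 2"
    by (auto intro!: \<tau>_s')
  have R: "a 1 \<bullet> rel_vec = 0"
    unfolding rel using prod_zero_left[of "a 1"] mult_commute[of 0 "a 1"] by simp
  have "?l = a 1 \<bullet> rel_vec - \<tau> 0 (a 1 \<bullet> rel_vec)"
  proof (rule vec_eqI)
    fix f :: "'v \<Rightarrow> 'f" assume f: "lin_fun f"
    show "f ?l = f (a 1 \<bullet> rel_vec - \<tau> 0 (a 1 \<bullet> rel_vec))"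
      by (simp add: assms bilin prods axis_mult_adj \<tau>_add \<tau>_scale \<tau>_diff \<tau>_minus \<tau>_axis t
        lin_fun_simps[OF f]) algebra
  qed
  then show ?thesis by (simp add: R \<tau>_zero)
qed

lemma cancel_factor: "c * x = 0 \<Longrightarrow> c \<noteq> 0 \<Longrightarrow> x = (0::'f)"
  by simp

lemma scaled_sum_solve:
  assumes "c \<noteq> 0" "c *s x = y"
  shows "x = (1 / c) *s y"
  using assms by auto

text \<open>
  Here \<open>a 1 + a (-1) + \<sigma>\<close> is a multiple of \<open>a 0\<close>. Multiplying this by \<open>\<sigma>\<close> expresses \<open>s 0 2\<close> by the axes with indices
  \<open>-2, ..., 2\<close>, with equal nonzero coefficients at \<open>a 2\<close> and \<open>a (-2)\<close>. Since \<open>\<tau> 1\<close> fixes \<open>s 0 2\<close>, the axis \<open>a 4\<close> lies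
  in the same span.
\<close>

lemma second_exceptional_generic:
  assumes P0: "P 0 \<noteq> 0" and P1: "P 1 = 0" and g1: "g 1 = 0" and l: "16 * lam 0 1 \<noteq> 1"
  shows "span ({a (-2), a (-1), a 0, a 1, a 2} \<union> {\<sigma>, s 0 2}) = UNIV" (is "span (?X \<union> _) = _")
proof -
  have "3 * \<kappa> * (\<kappa> - 4) * (16 * lam 0 1 - 1) \<noteq> 0" using l three k0 k4 by simp
  from scaled_sum_solve[OF this a0_rel[OF P1 g1]] obtain c where c: "a 1 + a (-1) + \<sigma> = c *s a 0"
    unfolding scale_scale by blast
  then have sig: "\<sigma> = c *s a 0 - a 1 - a (-1)" by (simp add: algebra_simps)
  have sq: "3 *s ((a 1 + a (-1) + \<sigma>) \<bullet> \<sigma>) = 3 *s (c *s a 0 \<bullet> \<sigma>)" by (simp only: c)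
  define z1 where "z1 = 3*\<kappa>^2*lam 1 1 - 24*\<kappa>*lam 1 1 - 2*E 0 - E 1 - 6*\<kappa> + 6*P 0"
  define z0 where "z0 = -3*c*\<kappa>^2*lam 0 1 + 24*c*\<kappa>*lam 0 1 + 2*E 0*c + E 1*c + 6*c*\<kappa> - 18*c^2 + 2*g 0 + 36"
  have s02: "18 *s s 0 2 = 18 *s (a 2 + a (-2)) + z1 *s (a 1 + a (-1)) + z0 *s a 0"
    (is "?l = ?r")
  proof (rule vec_eqI)
    fix f :: "'v \<Rightarrow> 'f" assume f: "lin_fun f"
    have "f ?r - f ?l = f (3 *s ((a 1 + a (-1) + \<sigma>) \<bullet> \<sigma>)) - f (3 *s (c *s a 0 \<bullet> \<sigma>))
      - f rel_vec - (2 * E 0 + E 1 + 36 - 18 * c) * (f (a 1 + a (-1) + \<sigma>) - f (c *s a 0))"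
      by (simp add: P1 g1 z0_def z1_def bilin prods sigma_sq_0 e_def lin_fun_simps[OF f]) algebra
    also have "\<dots> = 0"
      unfolding sq rel c by (simp add: lin_fun_simps[OF f])
    finally show "f ?l = f ?r" by simp
  qed
  have "\<tau> 1 (18 *s s 0 2) = 18 *s s 0 2" by (simp add: \<tau>_simps \<tau>_s'[of 2 1 0 0])
  then have eq: "18 *s (a 0 + a 4) + z1 *s (a 1 + a 3) + z0 *s a 2
     = 18 *s (a 2 + a (-2)) + z1 *s (a 1 + a (-1)) + z0 *s a 0"
    unfolding s02 by (simp add: \<tau>_simps)
  have a3: "a 3 \<in> span ?X"
  proof -
    have "{a (-1), a 0, a 2} \<subseteq> ?X" by auto
    then show ?thesis using right_end[OF P0] span_mono by blast
  qed
  have a4: "a 4 \<in> span ?X"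
  proof (rule solve[OF numeral_nonzero(4)])
    have "18 *s a 4 = 18 *s (a 2 + a (-2)) + z1 *s (a 1 + a (-1)) + z0 *s a 0
       - (18 *s a 0 + z1 *s (a 1 + a 3) + z0 *s a 2)"
      using eq by (simp add: scale_right_distrib) (simp add: algebra_simps)
    then show "18 *s a 4 \<in> span ?X"
      using a3 by (simp add: span_add span_scale span_diff span_base)
  qed
  show ?thesis
  proof (rule generate_window)
    show "\<tau> 0 x \<in> span ?X" if "x \<in> ?X" for x
      using that by (auto simp: \<tau>_axis intro: span_base)
    show "\<tau> 1 x \<in> span ?X" if "x \<in> ?X" for x
      using that a3 a4 by (auto simp: \<tau>_axis intro: span_base)
    show "a 0 \<bullet> x \<in> U" if "x \<in> ?X" for x
      using that by (auto intro!: axis_prod_U)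
    have "a 1 \<bullet> a (-2) \<in> U"
    proof -
      \<comment> \<open>the product of \<open>a 2\<close> with \<open>a (-1) - a 3\<close> is known because \<open>a (-1) - a 3\<close> is a multiple of \<open>a 0 - a 2\<close>\<close>
      have "(3 * P 0) *s (a 2 \<bullet> a (-1)) = (3 * P 0) *s (a 2 \<bullet> a 3) - g 0 *s (a 2 \<bullet> a 0 - a 2 \<bullet> a 2)"
        using arg_cong[OF rel_\<tau>_mirror, of "\<lambda>x. a 2 \<bullet> x"]
        by (simp add: bilin scale_right_diff_distrib) (simp add: algebra_simps)
      also have "\<dots> \<in> U" by (intro U_closed axis_prod_U) auto
      finally have "(1 / (3 * P 0)) *s ((3 * P 0) *s (a 2 \<bullet> a (-1))) \<in> U" by (rule U_closed(3))
      then have "a 2 \<bullet> a (-1) \<in> U" using P0 three by simp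
      then have "\<tau> 0 (a 2 \<bullet> a (-1)) \<in> U" by (rule \<tau>_U)
      then show ?thesis by (simp add: \<tau>_simps mult_commute)
    qed
    then show "a 1 \<bullet> x \<in> U" if "x \<in> ?X" for x
      using that by (auto intro!: axis_prod_U)
  qed (auto intro: span_base)
qed

lemma enlarge: "span X = UNIV \<Longrightarrow> X \<subseteq> span Y \<Longrightarrow> span Y = UNIV"
  using span_minimal[OF _ subspace_span] by blast

text \<open>
  If \<open>lam 0 1 = 1 / 16\<close>, then \<open>a0_rel\<close> says only that \<open>y0 = 0\<close>, and the relation obtained from \<open>a 1\<close> is used.
  It gives \<open>a (-2)\<close> unless the coefficient \<open>9 * (\<kappa> - 24) * (\<kappa> + 24) / 8\<close> vanishes, that is, unless \<open>\<kappa> = -24\<close>,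
  because \<open>\<kappa> = 24\<close> would imply \<open>P 0 = 0\<close>. For \<open>\<kappa> = -24\<close> all projections are determined numbers, and the relation
  reads \<open>X1 *s (a 1 - a (-1)) = 0\<close> with \<open>X1 = 2592 * (- 26)\<close>, which is nonzero because \<open>\<kappa> = -24\<close> differs from \<open>2\<close>.
\<close>

lemma second_exceptional_sixteenth:
  assumes P0: "P 0 \<noteq> 0" and P1: "P 1 = 0" and g1: "g 1 = 0" and l: "16 * lam 0 1 = 1"
    and ne: "a 1 \<noteq> a (-1)"
  shows "span ({a (-1), a 0, a 1, a 2} \<union> {\<sigma>, s 0 2}) = UNIV"
proof -
  define X2 X1 where "X2 = 6 * (E 0 - E 1) - 18 * D 1"
    and "X1 = 2 * g 0 + 3 * P 0 * \<kappa> + (E 0 - E 1) * ((6 - \<kappa>) * e 1 1 - 12 * lam 1 1)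
      + 18 * ((6 - \<kappa>) * e 1 2 - 12 * lam 1 2) - 18 * w 1"
  have rel1: "X2 *s (a 2 - a (-2)) + X1 *s (a 1 - a (-1)) = 0"
    using a1_rel[OF P1 g1] by (simp add: X1_def X2_def)
  have X2: "8 * X2 = 9 * ((\<kappa> - 24) * (\<kappa> + 24))"
  proof -
    have "8 * X2 - 9 * ((\<kappa> - 24) * (\<kappa> + 24)) =
        (96 * \<kappa> - 3 * \<kappa>^2) * (16 * lam 0 1 - 1) + (96 - 12 * \<kappa>) * P 1"
      by (simp add: X2_def E_def D_def P_def) algebra
    then show ?thesis by (simp add: l P1)
  qed
  have k24: "\<kappa> \<noteq> 24"
  proof
    assume k: "\<kappa> = 24"
    have "P 0 = 12 * (16 * lam 0 1 - 1)" unfolding P_def unfolding k by simp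
    then show False using P0 l by simp
  qed
  have "X2 \<noteq> 0"
  proof
    assume X20: "X2 = 0"
    have "(9::'f) = 3 * 3" by simp
    then have "(9::'f) \<noteq> 0" using three by (metis mult_eq_0_iff)
    moreover have "9 * ((\<kappa> - 24) * (\<kappa> + 24)) = 0" unfolding X2[symmetric] X20 by simp
    ultimately have "\<kappa> - 24 = 0 \<or> \<kappa> + 24 = 0" by (metis mult_eq_0_iff)
    then have k: "\<kappa> = - 24" using k24 by (simp add: eq_neg_iff_add_eq_0)
    have "12 * (16 * lam 1 1 + 5) = - P 1" unfolding P_def unfolding k by simp
    then have "16 * lam 1 1 + 5 = 0" using numeral_nonzero(5) P1 by - (rule cancel_factor[of 12], simp_all)
    then have m: "16 * lam 1 1 = -5" by (simp add: eq_neg_iff_add_eq_0)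
    have "18 * (16 * lam 1 2 + 11) = - g 1"
      unfolding g_def unfolding k using l m by simp algebra
    then have "16 * lam 1 2 + 11 = 0"
      using numeral_nonzero(4) g1 by - (rule cancel_factor[of 18], simp_all)
    then have m2: "16 * lam 1 2 = - 11" by (simp add: eq_neg_iff_add_eq_0)
    have "(- (4 * y0)) *s a 0 = 0" using a0_rel[OF P1 g1] by (simp add: l)
    then have y0: "y0 = 0" using a_nonzero numeral_nonzero(1) by simp
    have w0: "w 0 = 96 * lam 0 2 - 90"
    proof -
      have "3 * w 0 = 3 * (96 * lam 0 2 - 90)" unfolding w unfolding w3_def unfolding k using l m by simp algebra
      then show ?thesis using mult_left_cancel[OF three] by blast
    qed
    have w1: "w 1 = - 156"
    proof -
      have "3 * w 1 = 3 * (- 156)" unfolding w unfolding w3_def unfolding k using l m m2 by simp algebra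
      then show ?thesis using mult_left_cancel[OF three] by blast
    qed
    have g0: "g 0 = 378 - 288 * lam 0 2" unfolding g_def unfolding k using l m by simp algebra
    have EE: "E 0 - E 1 = 360" unfolding E_def unfolding k using l m by simp algebra
    have P0': "P 0 = - 72" unfolding P_def unfolding k using l by simp algebra
    have "18 * (18 * (16 * lam 0 2 - 81)) = - y0"
      unfolding y0_def unfolding EE g0 w0 P0' e_def unfolding k using l by simp algebra
    then have "18 * (18 * (16 * lam 0 2 - 81)) = 0" by (simp add: y0)
    then have "16 * lam 0 2 - 81 = 0"
      using cancel_factor[OF cancel_factor numeral_nonzero(4)] numeral_nonzero(4) by blast
    then have l2: "16 * lam 0 2 = 81" by simp
    have "X1 = 2592 * (- 26)"
      unfolding X1_def unfolding EE g0 w1 P0' e_def unfolding k using l m l2 m2 by simp algebra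
    moreover have "(2592::'f) = 2 * 2 * 2 * 18 * 18" by simp
    moreover have "(- 26 :: 'f) \<noteq> 0" using k2 unfolding k by (simp add: eq_neg_iff_add_eq_0)
    ultimately have "X1 \<noteq> 0" using two numeral_nonzero(4) by (metis mult_eq_0_iff)
    then show False using rel1 ne by (simp add: X20)
  qed
  have "a (-2) \<in> span {a (-1), a 0, a 1, a 2}"
  proof (rule solve[OF \<open>X2 \<noteq> 0\<close>])
    have "X2 *s a (-2) = X2 *s a 2 + X1 *s (a 1 - a (-1))"
      using rel1 by (simp add: scale_right_diff_distrib) (simp add: algebra_simps)
    then show "X2 *s a (-2) \<in> span {a (-1), a 0, a 1, a 2}"
      by (simp add: span_add span_scale span_diff span_base)
  qed
  moreover have "{a (-1), a 0, a 2} \<subseteq> {a (-1), a 0, a 1, a 2}" by auto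
  then have "a 3 \<in> span {a (-1), a 0, a 1, a 2}" using right_end[OF P0] span_mono by blast
  ultimately show ?thesis by (rule window4)
qed

lemma span_second_exceptional:
  assumes P0: "P 0 \<noteq> 0" and P1: "P 1 = 0"
  shows "span ({a (-2), a (-1), a 0, a 1, a 2} \<union> {\<sigma>, s 0 2}) = UNIV" (is "span ?X = _")
proof (cases "a 1 = a (-1)")
  case True
  show ?thesis by (rule enlarge[OF degenerate_odd[OF True]]) (auto intro: span_base)
next
  case False
  have "g 1 *s (a 1 - a (-1)) = 0" using rel_\<tau> by (simp add: P1)
  then have g1: "g 1 = 0" using False by simp
  show ?thesis
  proof (cases "16 * lam 0 1 = 1")
    case True
    show ?thesis
      by (rule enlarge[OF second_exceptional_sixteenth[OF P0 P1 g1 True False]]) (auto intro: span_base)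
  next
    case False
    then show ?thesis by (rule second_exceptional_generic[OF P0 P1 g1])
  qed
qed

lemma \<tau>_involution: "\<tau> i (\<tau> i v) = v"
proof -
  obtain x y z where v: "v = L i v *s a i + x + y + z" and t: "\<tau> i x = x" "\<tau> i y = y" "\<tau> i z = - z"
    using eigen_split[of v i] by blast
  have "\<tau> i (\<tau> i (L i v *s a i + x + y + z)) = L i v *s a i + x + y + z"
    by (simp add: \<tau>_simps t)
  then show ?thesis by (simp only: v[symmetric])
qed

text \<open>
  The mirror image of the previous case yields the window \<open>-1, ..., 3\<close>, and the translation \<open>\<tau> 0 \<circ> \<tau> 1\<close> moves it by
  \<open>-2\<close>.
\<close>

lemma span_first_exceptional:
  assumes "P 0 = 0" "P 1 \<noteq> 0"
  shows "span ({a (-3), a (-2), a (-1), a 0, a 1} \<union> {\<sigma>, s 1 2}) = UNIV" (is "span ?Y = _")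
proof -
  interpret mir: generated_orbit scale mult \<kappa> "\<lambda>i. a (-1 * i + 1)" "\<lambda>i. \<tau> (-1 * i + 1)" "\<lambda>i. L (-1 * i + 1)"
    by (rule mirror)
  let ?X = "{a 3, a 2, a 1, a 0, a (-1)} \<union> {\<sigma>, s 1 2}"
  have s: "s 1 (-1) = \<sigma>" "s 1 (-2) = s 1 2"
    using s_sym[of 0 1] s_sym[of "-1" 2] s_period[of 2 "-1" 1] by simp_all
  have "mir.P 0 \<noteq> 0" "mir.P 1 = 0" using assms reindex_coeffs(1)[of "-1" 1 0] reindex_coeffs(1)[of "-1" 1 1] by simp_all
  from mir.span_second_exceptional[OF this] have X: "span ?X = UNIV" unfolding reindex_s by (simp add: s)
  have "v \<in> span ?Y" for v
  proof -
    have "\<tau> 1 (\<tau> 0 v) \<in> span ?X" using X by simp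
    from \<tau>_span[OF \<tau>_span[OF this, of 1], of 0] have "v \<in> span (\<tau> 0 ` \<tau> 1 ` ?X)"
      by (simp only: \<tau>_involution)
    also have "\<tau> 0 ` \<tau> 1 ` ?X = ?Y"
      by (simp add: \<tau>_axis \<tau>_s'[of 1 1 0 0] \<tau>_s'[of 1 0 0 0] \<tau>_s'[of 2 1 1 1] \<tau>_s'[of 2 0 1 1] insert_commute)
    finally show ?thesis .
  qed
  then show ?thesis by auto
qed

text \<open>
  If both projections are exceptional they are equal, so \<open>\<sigma>\<close> drops out of \<open>rel\<close>, and what remains of the
  antisymmetrised relations are multiples of \<open>a 1 - a (-1)\<close> and of \<open>a 0 - a 2\<close>.
\<close>

lemma both_exceptional_reduce:
  assumes P0: "P 0 = 0" and P1: "P 1 = 0"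
  shows "lam 0 1 = lam 1 1"
    and "a 1 \<noteq> a (-1) \<Longrightarrow> g 1 = 0" and "a 0 \<noteq> a 2 \<Longrightarrow> g 0 = 0"
    and "g 0 = 0 \<Longrightarrow> g 1 = 0 \<Longrightarrow> s 1 2 = s 0 2"
proof -
  have "8 * \<kappa> * (lam 0 1 - lam 1 1) = P 0 - P 1" by (simp add: P_def algebra_simps)
  then show l: "lam 0 1 = lam 1 1" using P0 P1 k0 numeral_nonzero(3) by simp
  show "g 1 = 0" if "a 1 \<noteq> a (-1)" using rel_\<tau> that by (simp add: P1)
  show "g 0 = 0" if "a 0 \<noteq> a 2" using rel_\<tau>_mirror that by (simp add: P0)
  show "s 1 2 = s 0 2" if "g 0 = 0" "g 1 = 0"
    using rel numeral_nonzero(4) by (simp add: P0 P1 that E_def l)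
qed

text \<open>
  The two computations of \<open>a 0 \<bullet> s 0 2\<close>, as \<open>axis_mult_s\<close> and as \<open>axis_mult_adj\<close>, are compared; the axes
  \<open>a 2\<close> and \<open>a (-2)\<close> occur in both with the same coefficient.
\<close>

lemma both_exceptional_axis:
  assumes P0: "P 0 = 0" and P1: "P 1 = 0" and s: "s 1 2 = s 0 2"
  shows "((\<kappa> - 4) * (\<kappa> - 24)) *s (a 1 + a (-1) + \<sigma>)
     = (8 * w 0 - 8 * ((6 - \<kappa>) * e 0 2 - 12 * lam 0 2)) *s a 0" (is "?l = ?r")
proof (rule vec_eqI)
  fix f :: "'v \<Rightarrow> 'f" assume f: "lin_fun f"
  have l: "lam 1 1 = lam 0 1" using both_exceptional_reduce(1)[OF P0 P1] by simp
  have "f ?l - f ?r = 8 * (f (a 0 \<bullet> s 0 2) - f (a 0 \<bullet> s 1 2)) + (\<kappa> - 16) * P 0 * f (a 1 + a (-1) + \<sigma>)"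
    by (simp add: P_def D_def e_def bilin prods axis_mult_adj l lin_fun_simps[OF f]) algebra
  also have "\<dots> = 0" by (simp add: s P0)
  finally show "f ?l = f ?r" by simp
qed

text \<open>
  Now \<open>\<sigma>\<close> lies in the span of \<open>a 0, a 1, a (-1)\<close>, and by the mirror image in the span of \<open>a 0, a 1, a 2\<close>.
\<close>

lemma both_exceptional_not24:
  assumes P0: "P 0 = 0" and P1: "P 1 = 0" and s: "s 1 2 = s 0 2" and k24: "\<kappa> \<noteq> 24"
  shows "span ({a (-1), a 0, a 1} \<union> {\<sigma>, s 0 2}) = UNIV" (is "span (?X \<union> _) = _")
proof -
  interpret mir: generated_orbit scale mult \<kappa> "\<lambda>i. a (-1 * i + 1)" "\<lambda>i. \<tau> (-1 * i + 1)" "\<lambda>i. L (-1 * i + 1)"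
    by (rule mirror)
  have k: "(\<kappa> - 4) * (\<kappa> - 24) \<noteq> 0" using k4 k24 by simp
  obtain c where c: "a 1 + a (-1) + \<sigma> = c *s a 0"
    using scaled_sum_solve[OF k both_exceptional_axis[OF P0 P1 s]] unfolding scale_scale by blast
  have m12: "mir.s 1 2 = s 0 2" "mir.s 0 2 = s 1 2" "mir.s 0 1 = \<sigma>"
    using s_sym[of "-2" 2] s_sym[of "-1" 2] s_sym[of 0 1] s_period[of 2 "-2" 0] s_period[of 2 "-1" 1]
    unfolding reindex_s by simp_all
  have ms: "mir.s 1 2 = mir.s 0 2" unfolding m12 s ..
  have mP: "mir.P 0 = 0" "mir.P 1 = 0"
    using P0 P1 reindex_coeffs(1)[of "-1" 1 0] reindex_coeffs(1)[of "-1" 1 1] by simp_all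
  obtain c' where "a (-1 * 1 + 1) + a (-1 * (-1) + 1) + \<sigma> = c' *s a (-1 * 0 + 1)"
    using scaled_sum_solve[OF k mir.both_exceptional_axis[OF mP ms]] unfolding scale_scale m12 by blast
  then have c': "a 0 + a 2 + \<sigma> = c' *s a 1" by simp
  have sig: "\<sigma> = c *s a 0 - a 1 - a (-1)" using c by (simp add: algebra_simps)
  have "a 2 = c' *s a 1 - a 0 - \<sigma>" using c' by (simp add: algebra_simps)
  then have a2: "a 2 \<in> span ?X" unfolding sig by (simp add: span_add span_scale span_diff span_base)
  have "\<tau> 1 (a 1 + a (-1) + \<sigma>) = \<tau> 1 (c *s a 0)" by (simp only: c)
  then have "a 1 + a 3 + \<sigma> = c *s a 2" by (simp add: \<tau>_simps \<tau>_s'[of 1 1 0 0])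
  then have "a 3 = c *s a 2 - a 1 - \<sigma>" by (simp add: algebra_simps)
  then have a3: "a 3 \<in> span ?X" unfolding sig using a2 by (simp add: span_add span_scale span_diff span_base)
  show ?thesis
    by (rule generate_window)
      (use a2 a3 in \<open>auto simp: \<tau>_axis intro: span_base intro!: axis_prod_U\<close>)
qed

lemma both_exceptional_cases:
  assumes P0: "P 0 = 0" and P1: "P 1 = 0"
  shows "span ({a (-2), a (-1), a 0, a 1, a 2, a 3} \<union> {\<sigma>, s 0 2}) = UNIV
    \<or> (\<kappa> = 24 \<and> 16 * lam 0 1 = 1 \<and> 16 * lam 1 1 = 1 \<and> g 0 = 0 \<and> g 1 = 0 \<and> s 1 2 = s 0 2
       \<and> a 0 \<noteq> a 2 \<and> a 1 \<noteq> a (-1))" (is "?A \<or> _")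
proof (cases "a 1 = a (-1) \<or> a 0 = a 2")
  case True
  then have ?A
  proof
    assume "a 1 = a (-1)"
    show ?A by (rule enlarge[OF degenerate_odd[OF \<open>a 1 = a (-1)\<close>]]) (auto intro: span_base)
  next
    assume "a 0 = a 2"
    show ?A by (rule enlarge[OF degenerate_even[OF \<open>a 0 = a 2\<close>]]) (auto intro: span_base)
  qed
  then show ?thesis ..
next
  case False
  then have g: "g 0 = 0" "g 1 = 0" using both_exceptional_reduce[OF P0 P1] by auto
  have s: "s 1 2 = s 0 2" using both_exceptional_reduce(4)[OF P0 P1 g] .
  show ?thesis
  proof (cases "\<kappa> = 24")
    case True
    have "12 * (16 * lam 0 1 - 1) = P 0" unfolding P_def unfolding True by simp
    then have "16 * lam 0 1 - 1 = 0" using P0 numeral_nonzero(5) by - (rule cancel_factor[of 12], simp_all)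
    then have "16 * lam 0 1 = 1" by simp
    then show ?thesis using True False g s both_exceptional_reduce(1)[OF P0 P1] by auto
  next
    case False
    have ?A by (rule enlarge[OF both_exceptional_not24[OF P0 P1 s False]]) (auto intro: span_base)
    then show ?thesis ..
  qed
qed

end

section \<open>Two exceptional projections and eigenvalues 24, 0, 8, 2\<close>

text \<open>
  The remaining parameters: all projections between axes at distance one or two are \<open>1 / 16\<close>, and the
  elements \<open>s i 2\<close> coincide. Since \<open>\<kappa> - 4 = 20\<close>, the characteristic is not five.
\<close>

locale six_orbit = axis_orbit scale mult \<kappa> a \<tau> L
  for scale :: "'f::field \<Rightarrow> 'v::ab_group_add \<Rightarrow> 'v" (infixr "*s" 75)
    and mult :: "'v \<Rightarrow> 'v \<Rightarrow> 'v" (infixl "\<bullet>" 70)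
    and \<kappa> a \<tau> L +
  assumes k: "\<kappa> = 24" and lam_near: "n = 1 \<or> n = 2 \<Longrightarrow> 16 * lam i n = 1"
    and s_two: "s i 2 = s 0 2"
begin

lemma five: "(5::'f) \<noteq> 0"
proof -
  have *: "\<kappa> - 4 = 5 * (4::'f)" by (simp add: k)
  show ?thesis
  proof
    assume "(5::'f) = 0"
    then have "\<kappa> - 4 = 0" unfolding * by simp
    then show False using k4 by simp
  qed
qed

lemma reindex_six:
  assumes "c = 1 \<or> c = -1"
  shows "six_orbit scale mult \<kappa> (\<lambda>i. a (c * i + d)) (\<lambda>i. \<tau> (c * i + d)) (\<lambda>i. L (c * i + d))"
proof (intro six_orbit.intro reindex, unfold_locales)
  show "\<kappa> = 24" by (rule k)
  show "16 * axis_orbit.lam (\<lambda>i. a (c * i + d)) (\<lambda>i. L (c * i + d)) i n = 1" if "n = 1 \<or> n = 2" for i n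
    using assms lam_near[OF that] unfolding reindex_lam by (auto simp: lam_minus)
  have "s i (- 2) = s 0 2" for i
    using s_sym[of "i - 2" 2] s_two by simp
  then show "axis_orbit.s scale mult (\<lambda>i. a (c * i + d)) i 2 = axis_orbit.s scale mult (\<lambda>i. a (c * i + d)) 0 2" for i
    using assms s_two[of "c * i + d"] s_two[of "c * 0 + d"] unfolding reindex_s by auto
qed

abbreviation "\<sigma>\<^sub>2 \<equiv> s 0 2"

lemma s_one: "s i 1 = \<sigma>" by (rule s_period) simp

lemma coefficient_near: assumes "n = 1 \<or> n = 2"
  shows "(6 - \<kappa>) * e i n - 12 * lam i n = -12" "8 * e i n = 5"
proof -
  have "(6 - \<kappa>) * e i n - 12 * lam i n = 24 * (16 * lam i n) - 36" "8 * e i n = 16 - 11 * (16 * lam i n)"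
    unfolding e_def unfolding k by (simp_all add: algebra_simps)
  then show "(6 - \<kappa>) * e i n - 12 * lam i n = -12" "8 * e i n = 5" by (simp_all add: lam_near[OF assms])
qed

lemma axis_mult_s1: "a i \<bullet> \<sigma> = 6 *s (a (i + 1) + a (i - 1)) + 6 *s \<sigma> - 12 *s a i"
  using axis_mult_s[of 1 i 0] coefficient_near(1)[of 1 "i mod 2"] by simp

lemma axis_mult_s2: "a i \<bullet> \<sigma>\<^sub>2 = 6 *s (a (i + 2) + a (i - 2)) + 6 *s \<sigma>\<^sub>2 - 12 *s a i"
  using axis_mult_s[of 2 i i] coefficient_near(1)[of 2 "i mod 2"] s_two[of i] by simp

lemma axis_mult_s3:
  "3 dvd i - j \<Longrightarrow> a i \<bullet> s j 3 = 6 *s (a (i + 3) + a (i - 3)) + 6 *s s j 3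
     + (384 * lam (i mod 2) 3 - 36) *s a i"
proof -
  have c: "(6 - \<kappa>) * e (i mod 2) 3 - 12 * lam (i mod 2) 3 = 384 * lam (i mod 2) 3 - 36"
    unfolding e_def unfolding k by (simp add: algebra_simps)
  assume "3 dvd i - j"
  then show ?thesis by (simp only: axis_mult_s c)
qed

lemma idem6: "a i \<bullet> a i = 24 *s a i" by (simp add: idem k)

lemmas prods6 = axis_mult_axis_up axis_mult_axis_down idem6 axis_mult_s1 axis_mult_s2 axis_mult_s3
  trans[OF mult_commute axis_mult_s1] trans[OF mult_commute axis_mult_s2]
  trans[OF mult_commute axis_mult_s3]

definition \<eta> :: 'f where "\<eta> = 1 / 16"

lemma \<eta>: "16 * \<eta> = 1"
  using numeral_nonzero(6) by (simp add: \<eta>_def)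

lemma lam_near': "n = 1 \<or> n = 2 \<Longrightarrow> lam i n = \<eta>"
  using lam_near[of n i] \<eta> mult_left_cancel[OF numeral_nonzero(6)] by metis

lemma e_near: "n = 1 \<or> n = 2 \<Longrightarrow> e i n = 10 * \<eta>"
proof -
  assume n: "n = 1 \<or> n = 2"
  have "e i n = 10 * \<eta> - 2 * (16 * \<eta> - 1)" unfolding e_def lam_near'[OF n] unfolding k
    by (simp add: algebra_simps)
  then show ?thesis by (simp add: \<eta>)
qed

lemmas Ls6 = Ls lam_near' e_near

lemma near_vectors:
  "8 *s B 0 1 = 8 *s (a 1 + a (-1)) - a 0" "8 *s B 0 2 = 8 *s (a 2 + a (-2)) - a 0"
  "8 *s S 0 1 = 8 *s \<sigma> + 5 *s a 0" "8 *s S 0 2 = 8 *s \<sigma>\<^sub>2 + 5 *s a 0"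
proof -
  have "8 * (2 * lam 0 1) = 1" "8 * (2 * lam 0 2) = 1" using lam_near[of 1 0] lam_near[of 2 0] by simp_all
  then show "8 *s B 0 1 = 8 *s (a 1 + a (-1)) - a 0" "8 *s B 0 2 = 8 *s (a 2 + a (-2)) - a 0"
    unfolding B_def by (simp_all add: scale_right_diff_distrib)
  show "8 *s S 0 1 = 8 *s \<sigma> + 5 *s a 0" "8 *s S 0 2 = 8 *s \<sigma>\<^sub>2 + 5 *s a 0"
    unfolding S_def by (simp_all add: scale_right_distrib coefficient_near)
qed

text \<open>
  \<open>pair_fusion\<close> for \<open>m = 1\<close> and \<open>n = 2\<close>, multiplied by \<open>64\<close> to clear the denominators of the near projections.
\<close>

lemma fusion_12:
  defines "b1 \<equiv> 8 *s (a 1 + a (-1)) - a 0" and "b2 \<equiv> 8 *s (a 2 + a (-2)) - a 0"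
    and "c1 \<equiv> 8 *s \<sigma> + 5 *s a 0" and "c2 \<equiv> 8 *s \<sigma>\<^sub>2 + 5 *s a 0"
  shows "a 0 \<bullet> (2 *s (b1 \<bullet> b2) - b1 \<bullet> c2 - c1 \<bullet> b2) = - ((96 * L 0 (b1 \<bullet> b2)) *s a 0)"
    and "2 *s (c1 \<bullet> c2) = 6 *s (b1 \<bullet> b2) + 6 *s (b1 \<bullet> c2) - 2 *s (c1 \<bullet> b2) - a 0 \<bullet> (3 *s (b1 \<bullet> b2) - c1 \<bullet> b2)"
    and "L 0 (b1 \<bullet> c2) = 3 * L 0 (b1 \<bullet> b2)"
proof -
  have d: "b1 = 8 *s B 0 1" "b2 = 8 *s B 0 2" "c1 = 8 *s S 0 1" "c2 = 8 *s S 0 2"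
    by (simp_all only: b1_def b2_def c1_def c2_def near_vectors)
  show "a 0 \<bullet> (2 *s (b1 \<bullet> b2) - b1 \<bullet> c2 - c1 \<bullet> b2) = - ((96 * L 0 (b1 \<bullet> b2)) *s a 0)"
    using arg_cong[OF pair_fusion(1)[of 1 2], of "\<lambda>x. 64 *s x"] unfolding d k
    by (simp add: bilin L_simps scale_right_diff_distrib)
  show "2 *s (c1 \<bullet> c2) = 6 *s (b1 \<bullet> b2) + 6 *s (b1 \<bullet> c2) - 2 *s (c1 \<bullet> b2) - a 0 \<bullet> (3 *s (b1 \<bullet> b2) - c1 \<bullet> b2)"
    using arg_cong[OF pair_fusion(2)[of 1 2], of "\<lambda>x. 64 *s x"] unfolding d
    by (simp add: bilin L_simps scale_right_diff_distrib scale_right_distrib)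
  show "L 0 (b1 \<bullet> c2) = 3 * L 0 (b1 \<bullet> b2)"
    using pair_fusion(3)[of 1 2] unfolding d by (simp add: bilin L_simps)
qed

lemma \<tau>_negated: "\<tau> i d = - d \<Longrightarrow> a i \<bullet> d = 2 *s d"
proof -
  assume t: "\<tau> i d = - d"
  obtain x y z where d: "d = L i d *s a i + x + y + z"
    and e: "a i \<bullet> z = 2 *s z" and f: "\<tau> i x = x" "\<tau> i y = y" "\<tau> i z = - z"
    using eigen_split[of d i] by blast
  have "\<tau> i d = L i d *s a i + x + y - z" by (subst d) (simp add: \<tau>_simps f)
  then have "- d = L i d *s a i + x + y - z" by (simp only: t)
  then have "- d + 2 *s z = L i d *s a i + x + y + z"
    by (simp add: scale_left_distrib[of 1 1, simplified])
  then have "2 *s z = 2 *s d" unfolding d[symmetric]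
    by (simp add: scale_left_distrib[of 1 1 d, simplified]) (simp add: algebra_simps)
  then have "d = z" using two by simp
  then show ?thesis using e by simp
qed

abbreviation "\<omega> i \<equiv> 4 - 96 * lam i 3"

text \<open>
  \<open>pair_fusion\<close> yields \<open>a 0 \<bullet> (s 1 3 + s 2 3)\<close>. The difference \<open>s 1 3 - s 2 3\<close> is negated by \<open>\<tau> 0\<close>, hence an
  eigenvector of \<open>a 0\<close> for the eigenvalue \<open>2\<close>.
\<close>

lemma axis_mult_s13_0:
  "a 0 \<bullet> s 1 3 = \<omega> 0 *s a 0 + 10 *s (a 1 + a (-1) + a 2 + a (-2)) + 6 *s (a 3 + a (-3))
     + 10 *s (\<sigma> + \<sigma>\<^sub>2) + 6 *s s 0 3 + (s 1 3 - s 2 3)"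
  (is "?l = ?r")
proof (rule vec_eqI)
  fix f :: "'v \<Rightarrow> 'f" assume f: "lin_fun f"
  let ?b1 = "8 *s (a 1 + a (-1)) - a 0" and ?b2 = "8 *s (a 2 + a (-2)) - a 0"
    and ?c1 = "8 *s \<sigma> + 5 *s a 0" and ?c2 = "8 *s \<sigma>\<^sub>2 + 5 *s a 0"
  have d: "a 0 \<bullet> (s 1 3 - s 2 3) = 2 *s (s 1 3 - s 2 3)"
    by (rule \<tau>_negated) (simp add: \<tau>_diff \<tau>_s'[of 3 0 1 2] \<tau>_s'[of 3 0 2 1])
  have "768 * (f ?l - f ?r) =
      3 * (f (a 0 \<bullet> (2 *s (?b1 \<bullet> ?b2) - ?b1 \<bullet> ?c2 - ?c1 \<bullet> ?b2))
        - f (- ((96 * L 0 (?b1 \<bullet> ?b2)) *s a 0)))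
      - 96 * f (a 0) * (3 * L 0 (?b1 \<bullet> ?b2) - L 0 (?b1 \<bullet> ?c2))
      + 384 * (f (a 0 \<bullet> (s 1 3 - s 2 3)) - f (2 *s (s 1 3 - s 2 3)))
      + 52224 * f (a 0) * (16 * \<eta> - 1)"
    by (simp add: bilin prods6 Ls6 lin_fun_simps[OF f]) algebra
  also have "\<dots> = 0" by (simp only: fusion_12 d \<eta>) simp
  finally have *: "768 * (f ?l - f ?r) = 0" .
  have "(768::'f) = 16 * 16 * 3" by simp
  then have "(768::'f) \<noteq> 0" using numeral_nonzero(6) three by (metis mult_eq_0_iff)
  with * have "f ?l - f ?r = 0" by (metis mult_eq_0_iff)
  then show "f ?l = f ?r" by simp
qed

lemma \<sigma>_mult_s2:
  "\<sigma> \<bullet> \<sigma>\<^sub>2 = 3 *s (s 1 3 + s 2 3) - 12 *s s 0 3 - 24 *s \<sigma> - 18 *s \<sigma>\<^sub>2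
     - 30 *s (a 1 + a (-1) + a 2 + a (-2)) - (3 * \<omega> 0 + 36) *s a 0"
  (is "?l = ?r")
proof (rule vec_eqI)
  fix f :: "'v \<Rightarrow> 'f" assume f: "lin_fun f"
  let ?b1 = "8 *s (a 1 + a (-1)) - a 0" and ?b2 = "8 *s (a 2 + a (-2)) - a 0"
    and ?c1 = "8 *s \<sigma> + 5 *s a 0" and ?c2 = "8 *s \<sigma>\<^sub>2 + 5 *s a 0"
  have d: "a 0 \<bullet> (s 1 3 - s 2 3) = 2 *s (s 1 3 - s 2 3)"
    by (rule \<tau>_negated) (simp add: \<tau>_diff \<tau>_s'[of 3 0 1 2] \<tau>_s'[of 3 0 2 1])
  have "128 * (f ?l - f ?r) =
      f (2 *s (?c1 \<bullet> ?c2)) - f (6 *s (?b1 \<bullet> ?b2) + 6 *s (?b1 \<bullet> ?c2) - 2 *s (?c1 \<bullet> ?b2)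
      - a 0 \<bullet> (3 *s (?b1 \<bullet> ?b2) - ?c1 \<bullet> ?b2))
      + 192 * (f (a 0 \<bullet> (s 1 3 - s 2 3)) - f (2 *s (s 1 3 - s 2 3)))"
    by (simp add: bilin prods6 axis_mult_s13_0 Ls6 lin_fun_simps[OF f]) algebra
  also have "\<dots> = 0" by (simp only: fusion_12 d) simp
  finally have *: "128 * (f ?l - f ?r) = 0" .
  have "(128::'f) = 16 * 2 * 2 * 2" by simp
  then have "(128::'f) \<noteq> 0" using numeral_nonzero(6) two by (metis mult_eq_0_iff)
  with * have "f ?l - f ?r = 0" by (metis mult_eq_0_iff)
  then show "f ?l = f ?r" by simp
qed

lemma \<tau>_s_mod: "\<tau> j (s i n) = s ((2 * j - i) mod n) n"
  by (rule \<tau>_s') (simp add: minus_mod_eq_mult_div)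

text \<open>
  The coefficient of \<open>a i - a (i + 2)\<close> in \<open>s i 3 - s (i + 2) 3\<close>, see \<open>s03_s23\<close>. It replaces the unknown projection
  \<open>lam i 3\<close>.
\<close>

definition K :: "int \<Rightarrow> 'f" where "K i = (96 * lam i 3 - 6) / 5"

lemma K: "5 * K i = 96 * lam i 3 - 6"
  using five by (simp add: K_def)

lemma axis_mult_s13:
  assumes "3 dvd i - j + 1"
  shows "a i \<bullet> s j 3 = \<omega> (i mod 2) *s a i + 10 *s (a (i + 1) + a (i - 1) + a (i + 2) + a (i - 2))
     + 6 *s (a (i + 3) + a (i - 3)) + 10 *s (\<sigma> + \<sigma>\<^sub>2) + 6 *s s (i mod 3) 3
     + (s ((i + 1) mod 3) 3 - s ((i + 2) mod 3) 3)"
proof -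
  interpret sh: six_orbit scale mult \<kappa> "\<lambda>j. a (1 * j + i)" "\<lambda>j. \<tau> (1 * j + i)" "\<lambda>j. L (1 * j + i)"
    by (rule reindex_six) simp
  have s: "s (1 + i) 1 = \<sigma>" "s i 1 = \<sigma>" "s i 2 = \<sigma>\<^sub>2" by (rule s_one s_two)+
  have plain: "a i \<bullet> s (i + 1) 3 = \<omega> i *s a i + 10 *s (a (i + 1) + a (i - 1) + a (i + 2) + a (i - 2))
     + 6 *s (a (i + 3) + a (i - 3)) + 10 *s (\<sigma> + \<sigma>\<^sub>2) + 6 *s s i 3 + (s (i + 1) 3 - s (i + 2) 3)"
    using sh.axis_mult_s13_0 unfolding reindex_s reindex_lam by (simp add: s add.commute)
  have r: "s j 3 = s (i + 1) 3" "s ((i + 1) mod 3) 3 = s (i + 1) 3" "s ((i + 2) mod 3) 3 = s (i + 2) 3"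
    "s (i mod 3) 3 = s i 3"
    using assms by (auto intro!: s_period) presburger+
  show ?thesis unfolding r lam_mod[of i 3, symmetric] by (rule plain)
qed

lemma axis_mult_s23:
  assumes "3 dvd i - j - 1"
  shows "a i \<bullet> s j 3 = \<omega> (i mod 2) *s a i + 10 *s (a (i + 1) + a (i - 1) + a (i + 2) + a (i - 2))
     + 6 *s (a (i + 3) + a (i - 3)) + 10 *s (\<sigma> + \<sigma>\<^sub>2) + 6 *s s (i mod 3) 3
     - (s ((i + 1) mod 3) 3 - s ((i + 2) mod 3) 3)"
proof -
  have 1: "s ((2 * i - (i + 1)) mod 3) 3 = s j 3" "s ((2 * i - (i + 1)) mod 3) 3 = s ((i + 2) mod 3) 3"
    "s ((2 * i - (i + 2)) mod 3) 3 = s ((i + 1) mod 3) 3" "s ((2 * i - i mod 3) mod 3) 3 = s (i mod 3) 3"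
    "s ((2 * i - (i + 1) mod 3) mod 3) 3 = s ((i + 2) mod 3) 3"
    "s ((2 * i - (i + 2) mod 3) mod 3) 3 = s ((i + 1) mod 3) 3"
    using assms by (auto intro!: s_period) presburger+
  have "a i \<bullet> s (i + 1) 3 = \<omega> (i mod 2) *s a i + 10 *s (a (i + 1) + a (i - 1) + a (i + 2) + a (i - 2))
     + 6 *s (a (i + 3) + a (i - 3)) + 10 *s (\<sigma> + \<sigma>\<^sub>2) + 6 *s s (i mod 3) 3
     + (s ((i + 1) mod 3) 3 - s ((i + 2) mod 3) 3)"
    by (rule axis_mult_s13) simp
  from arg_cong[OF this, of "\<tau> i"] show ?thesis
    unfolding \<tau>_add \<tau>_scale \<tau>_mult \<tau>_diff \<tau>_axis \<tau>_s_mod 1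
    by (simp add: add.commute algebra_simps)
qed

lemmas prods7 = prods6 s_two[of 1] axis_mult_s13 axis_mult_s23

text \<open>
  Two ways to write the same vector, by elements \<open>s\<close> and by axes; the mirror image is \<open>Gm_l\<close> and \<open>Gm_r\<close>.
  The equation is the invariance of \<open>\<sigma> \<bullet> \<sigma>\<^sub>2\<close> under \<open>\<tau> 1\<close>, which exchanges \<open>s 0 3\<close> and \<open>s 2 3\<close>.
\<close>

abbreviation "G_l \<equiv> s 0 3 - s 2 3"
abbreviation "G_r \<equiv> 2 *s (a 3 + a 4 - a (-1) - a (-2)) + K 0 *s (a 0 - a 2)"

lemma s03_s23: "G_l = G_r"
proof (rule vec_eqI)
  fix f :: "'v \<Rightarrow> 'f" assume f: "lin_fun f"
  have t: "\<tau> 1 (\<sigma> \<bullet> \<sigma>\<^sub>2) = \<sigma> \<bullet> \<sigma>\<^sub>2" by (simp add: \<tau>_mult \<tau>_s_mod)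
  have "15 * (f G_l - f G_r) = f (\<tau> 1 (\<sigma> \<bullet> \<sigma>\<^sub>2)) - f (\<sigma> \<bullet> \<sigma>\<^sub>2)
      - 3 * f (a 0 - a 2) * (5 * K 0 - (96 * lam 0 3 - 6))"
    by (simp add: \<sigma>_mult_s2 \<tau>_simps \<tau>_s_mod lin_fun_simps[OF f]) algebra
  also have "\<dots> = 0" by (simp add: t K)
  finally have *: "15 * (f G_l - f G_r) = 0" .
  have "(15::'f) = 5 * 3" by simp
  then have "(15::'f) \<noteq> 0" using five three by (metis mult_eq_0_iff)
  with * have "f G_l - f G_r = 0" by (metis mult_eq_0_iff)
  then show "f G_l = f G_r" by simp
qed

abbreviation "Gm_l \<equiv> s 1 3 - s 2 3"
abbreviation "Gm_r \<equiv> 2 *s (a (-2) + a (-3) - a 2 - a 3) + K 1 *s (a 1 - a (-1))"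

lemma reindex_K:
  assumes "c = 1 \<or> c = -1"
  shows "six_orbit.K (\<lambda>i. a (c * i + d)) (\<lambda>i. L (c * i + d)) i = K (c * i + d)"
  using assms unfolding six_orbit.K_def[OF reindex_six[OF assms]] reindex_lam K_def by (auto simp: lam_minus)

lemma s13_s23: "Gm_l = Gm_r"
proof -
  interpret mir: six_orbit scale mult \<kappa> "\<lambda>j. a (-1 * j + 1)" "\<lambda>j. \<tau> (-1 * j + 1)" "\<lambda>j. L (-1 * j + 1)"
    by (rule reindex_six) simp
  have s: "s 1 (-3) = s 1 3" "s (-1) (-3) = s 2 3"
    using s_sym[of "-2" 3] s_period[of 3 "-2" 1] s_sym[of "-4" 3] s_period[of 3 "-4" 2] by simp_all
  show ?thesis using mir.s03_s23 reindex_K[of "-1" 1 0] unfolding reindex_s by (simp add: s)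
qed

lemma s03_s13: "s 0 3 - s 1 3 = 2 *s (a (-3) + a (-4) - a 1 - a 2) + K 0 *s (a 0 - a (-2))"
  using arg_cong[OF s03_s23, of "\<tau> 0"] by (simp add: \<tau>_simps \<tau>_s_mod)

text \<open>
  Multiplying \<open>s03_s23\<close> by \<open>a 0\<close> and by \<open>a 2\<close> brings in \<open>s 0 4\<close> and \<open>s 2 4\<close>; everything else cancels in the sum of
  the two products and the equation itself.
\<close>

lemma s04_s24: "s 0 4 = s 2 4"
proof (rule vec_eqI)
  fix f :: "'v \<Rightarrow> 'f" assume f: "lin_fun f"
  have "- 2 * (f (s 0 4) - f (s 2 4)) = f (a 0 \<bullet> G_l) - f (a 0 \<bullet> G_r) + f (a 2 \<bullet> G_l) - f (a 2 \<bullet> G_r)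
     + f G_l - f G_r + 5 * f (a 0 - a 2) * (5 * K 0 - (96 * lam 0 3 - 6))"
    by (simp add: bilin prods7 lin_fun_simps[OF f]) algebra
  also have "\<dots> = 0" by (simp add: s03_s23 K)
  finally show "f (s 0 4) = f (s 2 4)" using two by simp
qed

lemma s14_s34: "s 1 4 = s 3 4"
proof -
  interpret mir: six_orbit scale mult \<kappa> "\<lambda>j. a (-1 * j + 1)" "\<lambda>j. \<tau> (-1 * j + 1)" "\<lambda>j. L (-1 * j + 1)"
    by (rule reindex_six) simp
  have s: "s 1 (-4) = s 1 4" "s (-1) (-4) = s 3 4"
    using s_sym[of "-3" 4] s_period[of 4 "-3" 1] s_sym[of "-5" 4] s_period[of 4 "-5" 3] by simp_all
  show ?thesis using mir.s04_s24 unfolding reindex_s by (simp add: s)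
qed

text \<open>
  The even axes form an orbit with exceptional projections again, in which \<open>\<sigma>\<^sub>2\<close> plays the role of \<open>\<sigma>\<close>. The
  coefficient of \<open>a 0\<close> in its square must vanish, since all other terms are fixed by \<open>\<tau> 1\<close>; this also
  determines the projection at distance four.
\<close>

lemma s2_sq_even:
  assumes "a 0 \<noteq> a 2"
  shows "\<sigma>\<^sub>2 \<bullet> \<sigma>\<^sub>2 = - 36 *s \<sigma>\<^sub>2 - 6 *s s 0 4" and "lam 0 4 = \<eta>"
proof -
  interpret ev: axis_orbit scale mult \<kappa> "\<lambda>j. a (2 * j + 0)" "\<lambda>j. \<tau> (2 * j + 0)" "\<lambda>j. L (2 * j + 0)"
    by (rule reindex)
  have P: "ev.P 0 = 0" and E: "ev.E 0 = - 36" and g: "ev.g 0 = 288 * (lam 0 4 - \<eta>)"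
  proof -
    have "ev.P 0 = 12 * (16 * \<eta> - 1)"
      unfolding ev.P_def reindex_lam unfolding k by (simp add: lam_near', algebra?)
    then show "ev.P 0 = 0" by (simp add: \<eta>)
    have "ev.E 0 = - 36 - 12 * (16 * \<eta> - 1)"
      unfolding ev.E_def reindex_lam unfolding k by (simp add: lam_near', algebra?)
    then show "ev.E 0 = - 36" by (simp add: \<eta>)
    have "ev.g 0 = 288 * (lam 0 4 - \<eta>) + 864 * \<eta> * (16 * \<eta> - 1)"
      unfolding ev.g_def reindex_lam unfolding k by (simp add: lam_near', algebra?)
    then show "ev.g 0 = 288 * (lam 0 4 - \<eta>)" by (simp add: \<eta>)
  qed
  have sq: "\<sigma>\<^sub>2 \<bullet> \<sigma>\<^sub>2 = ev.g 0 *s a 0 - 36 *s \<sigma>\<^sub>2 - 6 *s s 0 4" (is "_ = ?r")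
  proof (rule vec_eqI)
    fix f :: "'v \<Rightarrow> 'f" assume f: "lin_fun f"
    show "f (\<sigma>\<^sub>2 \<bullet> \<sigma>\<^sub>2) = f ?r"
      using arg_cong[OF ev.sigma_sq_0, of f] unfolding reindex_s P E
      by (simp add: s04_s24 lin_fun_simps[OF f])
  qed
  have "\<tau> 1 (\<sigma>\<^sub>2 \<bullet> \<sigma>\<^sub>2) = \<sigma>\<^sub>2 \<bullet> \<sigma>\<^sub>2" by (simp add: \<tau>_simps \<tau>_s_mod)
  then have "ev.g 0 *s (a 2 - a 0) = 0"
    unfolding sq by (simp add: \<tau>_simps \<tau>_s_mod s04_s24 scale_right_diff_distrib)
  then have g0: "ev.g 0 = 0" using assms by auto
  then show "\<sigma>\<^sub>2 \<bullet> \<sigma>\<^sub>2 = - 36 *s \<sigma>\<^sub>2 - 6 *s s 0 4" using sq by simp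
  have "(288::'f) = 2 * 3 * 3 * 16" by simp
  then have "(288::'f) \<noteq> 0" using two three numeral_nonzero(6) by (metis mult_eq_0_iff)
  then show "lam 0 4 = \<eta>" using g g0 by simp
qed

text \<open>
  The square of \<open>\<sigma>\<^sub>2\<close> is the same for the even and for the odd axes.
\<close>

lemma s04_s14:
  assumes "a 0 \<noteq> a 2" "a 1 \<noteq> a (-1)"
  shows "s 0 4 = s 1 4"
proof -
  interpret mir: six_orbit scale mult \<kappa> "\<lambda>j. a (-1 * j + 1)" "\<lambda>j. \<tau> (-1 * j + 1)" "\<lambda>j. L (-1 * j + 1)"
    by (rule reindex_six) simp
  have s: "s 1 (-4) = s 1 4" "s 1 (-2) = \<sigma>\<^sub>2"
    using s_sym[of "-3" 4] s_period[of 4 "-3" 1] s_sym[of "-1" 2] s_two[of "-1"] by simp_all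
  have "\<sigma>\<^sub>2 \<bullet> \<sigma>\<^sub>2 = - 36 *s \<sigma>\<^sub>2 - 6 *s s 1 4"
    using mir.s2_sq_even(1) assms(2) unfolding reindex_s by (simp add: s)
  then have "6 *s s 0 4 = 6 *s s 1 4" using s2_sq_even(1)[OF assms(1)] by simp
  then show ?thesis using scale_left_imp_eq[OF numeral_nonzero(2)] by blast
qed

text \<open>
  \<open>s 0 4 = s 1 4\<close> can be read off from \<open>a 0\<close> times \<open>s03_s23\<close> and from \<open>a 1\<close> times its mirror image. The
  difference of these products is a relation between axes and \<open>\<sigma>\<^sub>2\<close>, whose projection to \<open>a 0\<close> forces
  \<open>K 0 = K 1\<close>, so that \<open>\<sigma>\<^sub>2\<close> drops out.
\<close>

abbreviation "Kvec \<equiv> (4 - 2 * K 1) *s a (-1) + (3 * K 0 - 2) *s a (-2) - 2 *s a (-3) - 6 *s a (-4)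
  + (6 - 3 * K 1) *s a 1 + (2 * K 0 + 2) *s a 2 + 2 *s a 3 - 4 *s a 4 + (K 0 - K 1) *s \<sigma>\<^sub>2"

lemma Kvec_zero:
  assumes "a 0 \<noteq> a 2" "a 1 \<noteq> a (-1)"
  shows "Kvec = 0"
proof (rule vec_eqI)
  fix f :: "'v \<Rightarrow> 'f" assume f: "lin_fun f"
  let ?Gt_l = "s 0 3 - s 1 3"
  let ?Gt_r = "2 *s (a (-3) + a (-4) - a 1 - a 2) + K 0 *s (a 0 - a (-2))"
  have "f Kvec = f (a 0 \<bullet> G_l) - f (a 0 \<bullet> G_r) - f (a 1 \<bullet> Gm_l) + f (a 1 \<bullet> Gm_r)
     + 3 * (f ?Gt_l - f ?Gt_r) + 2 * (f (s 0 4) - f (s 1 4))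
     + 5 * f (a 0) * (5 * K 0 - (96 * lam 0 3 - 6))
     - 5 * f (a 1) * (5 * K 1 - (96 * lam 1 3 - 6))"
    by (simp add: bilin prods7 lin_fun_simps[OF f]) algebra
  also have "\<dots> = 0" by (simp only: s03_s23 s13_s23 s03_s13 K s04_s14[OF assms]) simp
  finally show "f Kvec = f 0" by (simp add: lin_fun_simps[OF f])
qed

lemma K_eq:
  assumes "a 0 \<noteq> a 2" "a 1 \<noteq> a (-1)"
  shows "K 1 = K 0"
proof -
  have "5 * \<eta> * (K 1 - K 0) = L 0 Kvec"
    by (simp add: Ls6 s2_sq_even(2)[OF assms(1)]) algebra
  also have "\<dots> = 0" unfolding Kvec_zero[OF assms] by (simp add: L_simps)
  finally show ?thesis using five \<eta> by auto
qed

text \<open>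
  The part of the relation \<open>Kvec = 0\<close> that is symmetric under \<open>\<tau> 0\<close>, combined with the antisymmetric relation that
  expresses \<open>(s 0 3 - s 2 3) - (s 0 3 - s 1 3) = s 1 3 - s 2 3\<close> by axes.
\<close>

abbreviation "M_l \<equiv> 2 *s (a 4 + a 3 - a (-2) - a (-3))"
abbreviation "M_r \<equiv> (K 0 - 2) *s (a 2 - a (-1))"

lemma M:
  assumes "a 0 \<noteq> a 2" "a 1 \<noteq> a (-1)"
  shows "M_l = M_r"
proof (rule vec_eqI)
  fix f :: "'v \<Rightarrow> 'f" assume f: "lin_fun f"
  have "- 10 * (f M_l - f M_r) = 5 * (f (s 0 3 - s 2 3) - f G_r - f (s 0 3 - s 1 3)
    + f (2 *s (a (-3) + a (-4) - a 1 - a 2) + K 0 *s (a 0 - a (-2))) - f (s 1 3 - s 2 3) + f Gm_r)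
    + f Kvec + f (\<tau> 0 Kvec)"
    by (simp add: K_eq[OF assms] \<tau>_simps \<tau>_s_mod lin_fun_simps[OF f]) algebra
  also have "\<dots> = 0" by (simp only: s03_s23 s13_s23 s03_s13 Kvec_zero[OF assms] \<tau>_zero lin_fun_simps[OF f]) simp
  finally have *: "- 10 * (f M_l - f M_r) = 0" .
  have "(- 10::'f) = - (5 * 2)" by simp
  then have "(- 10::'f) \<noteq> 0" using five two by (metis mult_eq_0_iff neg_equal_0_iff_equal)
  with * have "f M_l - f M_r = 0" by (metis mult_eq_0_iff)
  then show "f M_l = f M_r" by simp
qed

lemma s_four:
  assumes "a 0 \<noteq> a 2" "a 1 \<noteq> a (-1)"
  shows "s 1 4 = s 0 4" "s 2 4 = s 0 4" "s 3 4 = s 0 4"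
  using s04_s14[OF assms] s04_s24 s14_s34 by simp_all

text \<open>
  This is \<open>a 0 \<bullet> M_l = a 0 \<bullet> M_r\<close>: the elements \<open>s 0 3\<close> from \<open>a 3\<close> and \<open>a (-3)\<close> cancel.
\<close>

lemma s04_eq:
  assumes "a 0 \<noteq> a 2" "a 1 \<noteq> a (-1)"
  shows "2 *s s 0 4 = K 0 *s \<sigma>\<^sub>2 - (K 0 - 2) *s \<sigma>" (is "?l = ?r")
proof (rule vec_eqI)
  fix f :: "'v \<Rightarrow> 'f" assume f: "lin_fun f"
  have "f ?l - f ?r = f (a 0 \<bullet> M_l) - f (a 0 \<bullet> M_r) - 2 * (f M_l - f M_r)"
    by (simp add: bilin prods7 lin_fun_simps[OF f]) algebra
  also have "\<dots> = 0" by (simp only: M[OF assms]) simp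
  finally show "f ?l = f ?r" by simp
qed

lemma s04_U:
  assumes "a 0 \<noteq> a 2" "a 1 \<noteq> a (-1)"
  shows "s 0 4 \<in> U"
proof -
  have "2 *s s 0 4 \<in> U" unfolding s04_eq[OF assms] by (intro U_closed U_gens)
  then have "inverse 2 *s (2 *s s 0 4) \<in> U" by (rule U_closed)
  then show ?thesis using two by simp
qed

lemma s03_U:
  assumes "a 0 \<noteq> a 2" "a 1 \<noteq> a (-1)"
  shows "s i 3 \<in> U"
proof -
  have eq: "2 *s s 0 3 = (3 * K 0 - 10) *s a 0 - 6 *s (a (-1) + a (-2)) - 10 *s a 1 + (2 * K 0 - 10) *s a 2
    - 4 *s (a 3 + a 4) - 8 *s \<sigma> + (K 0 - 8) *s \<sigma>\<^sub>2 + Gm_r - 2 *s s 0 4" (is "?l = ?r")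
  proof (rule vec_eqI)
    fix f :: "'v \<Rightarrow> 'f" assume f: "lin_fun f"
    have "f ?r - f ?l = f (a 0 \<bullet> G_l) - f (a 0 \<bullet> G_r) + 5 * f (a 0) * (5 * K 0 - (96 * lam 0 3 - 6))
       - (f Gm_l - f Gm_r)"
      by (simp add: bilin prods7 lin_fun_simps[OF f]) algebra
    also have "\<dots> = 0" by (simp only: s03_s23 s13_s23 K) simp
    finally show "f ?l = f ?r" by simp
  qed
  have "2 *s s 0 3 \<in> U" unfolding eq by (intro U_closed U_gens s04_U assms)
  then have "inverse 2 *s (2 *s s 0 3) \<in> U" by (rule U_closed)
  then have 0: "s 0 3 \<in> U" using two by simp
  have 2: "s 2 3 \<in> U" using \<tau>_U[OF 0, of 1] by (simp add: \<tau>_s_mod)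
  have 1: "s 1 3 \<in> U" using \<tau>_U[OF 2, of 0] by (simp add: \<tau>_s_mod)
  have "s i 3 = s (i mod 3) 3" by (rule s_period) (simp add: minus_mod_eq_mult_div)
  moreover have "i mod 3 = 0 \<or> i mod 3 = 1 \<or> i mod 3 = 2" by presburger
  ultimately show ?thesis using 0 1 2 by auto
qed

text \<open>
  From \<open>a j = a i + d\<close> and \<open>a i \<bullet> d = 2 *s d\<close> the idempotency of both axes gives \<open>d \<bullet> d = (\<kappa> - 4) *s d\<close>. The left side is
  fixed by \<open>\<tau> i\<close> and the right side is negated.
\<close>

lemma axis_plus_negated:
  assumes "\<tau> i d = - d" "a j = a i + d"
  shows "d = 0"
proof -
  have d: "a i \<bullet> d = 2 *s d" "d \<bullet> a i = 2 *s d" using \<tau>_negated[OF assms(1)] by (simp_all add: mult_commute)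
  have dd: "d \<bullet> d = 20 *s d"
  proof (rule vec_eqI)
    fix f :: "'v \<Rightarrow> 'f" assume f: "lin_fun f"
    show "f (d \<bullet> d) = f (20 *s d)"
      using arg_cong[OF idem6[of j], of f] unfolding assms(2)
      by (simp add: bilin idem6 d lin_fun_simps[OF f], algebra?)
  qed
  have "\<tau> i (d \<bullet> d) = d \<bullet> d" by (simp add: \<tau>_mult assms(1) bilin)
  then have "20 *s (- d) = 20 *s d" unfolding dd by (simp only: \<tau>_scale assms(1))
  then have n: "- (20 *s d) = 20 *s d" by simp
  have "40 *s d = 20 *s d + 20 *s d" using scale_left_distrib[of 20 20 d] by simp
  also have "\<dots> = - (20 *s d) + 20 *s d" by (simp only: n)
  finally have "40 *s d = 0" by simp
  moreover have "(40::'f) = 2 * 2 * 2 * 5" by simp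
  then have "(40::'f) \<noteq> 0" using two five by (metis mult_eq_0_iff)
  ultimately show ?thesis by simp
qed

abbreviation "X6 \<equiv> {a (-2), a (-1), a 0, a 1, a 2, a 3}"

text \<open>
  Write \<open>c = K 0 - 2\<close>. If \<open>c \<noteq> 0\<close>, the product \<open>a (-1) \<bullet> a 4\<close> can be computed from \<open>M\<close> times \<open>a (-1)\<close> and from the
  translate of \<open>M\<close> times \<open>a 4\<close>; the results differ by \<open>c\<close> times a combination of axes in which \<open>a (-3)\<close> has the
  coefficient \<open>18\<close> after eliminating \<open>a 4\<close>.
\<close>

lemma ends:
  assumes "a 0 \<noteq> a 2" "a 1 \<noteq> a (-1)"
  shows "a (-3) \<in> span X6" "a 4 \<in> span X6"
proof -
  define c where "c = K 0 - 2"
  note M = M[OF assms, folded c_def]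
  show a3: "a (-3) \<in> span X6"
  proof (cases "c = 0")
    case True
    then have "2 *s (a 4 + a 3 - a (-2) - a (-3)) = 0" by (simp only: M scale_zero_left)
    then have "a 4 + a 3 - a (-2) - a (-3) = 0" using two by (simp only: scale_eq_0_iff) simp
    then have M0: "a 4 + a 3 = a (-2) + a (-3)" by (metis diff_diff_eq eq_iff_diff_eq_0)
    have M1: "a (-2) + a (-1) = a 4 + a 5"
      using arg_cong[OF M0, of "\<tau> 1"] by (simp add: \<tau>_simps)
    have M2: "a 6 + a 5 = a 0 + a (-1)"
      using arg_cong[OF M0, of "\<lambda>x. \<tau> 1 (\<tau> 0 x)"] by (simp add: \<tau>_simps)
    have "a (-3) - a 3 = 0"
    proof (rule axis_plus_negated)
      show "\<tau> 0 (a (-3) - a 3) = - (a (-3) - a 3)" by (simp add: \<tau>_simps)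
      show "a 6 = a 0 + (a (-3) - a 3)"
      proof (rule vec_eqI)
        fix f :: "'v \<Rightarrow> 'f" assume f: "lin_fun f"
        show "f (a 6) = f (a 0 + (a (-3) - a 3))"
          using arg_cong[OF M0, of f] arg_cong[OF M1, of f] arg_cong[OF M2, of f]
          by (simp only: lin_fun_simps[OF f]) algebra
      qed
    qed
    then show ?thesis by (simp add: span_base)
  next
    case False
    have N: "2 *s (a 6 + a 5 - a 0 - a (-1)) = c *s (a 4 - a 1)" (is "?N_l = ?N_r")
      using arg_cong[OF M, of "\<lambda>x. \<tau> 1 (\<tau> 0 x)"] by (simp add: \<tau>_simps)
    let ?M_r = "c *s (a 2 - a (-1))"
    have "s 1 3 - s 2 3 + 20 *s (a (-1) - a 4) = 0" (is "?D = 0")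
    proof (rule vec_eqI)
      fix f :: "'v \<Rightarrow> 'f" assume f: "lin_fun f"
      have "c * f ?D = f (a (-1) \<bullet> M_l) - f (a (-1) \<bullet> ?M_r) + f (a 4 \<bullet> ?N_l) - f (a 4 \<bullet> ?N_r)
        - 2 * (f M_l - f ?M_r) - 2 * (f ?N_l - f ?N_r)"
        by (simp add: bilin prods7 s_four[OF assms] lin_fun_simps[OF f], algebra?)
      also have "\<dots> = 0" by (simp only: M N) simp
      finally show "f ?D = f 0" using False by (simp add: lin_fun_simps[OF f])
    qed
    then have D: "20 *s a 4 = Gm_r + 20 *s a (-1)"
      unfolding s13_s23 by (simp add: scale_right_diff_distrib) (simp add: algebra_simps)
    have e: "18 *s a (-3) = 20 *s a (-1) - 18 *s a (-2) - 2 *s a 2 + 18 *s a 3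
        + K 1 *s (a 1 - a (-1)) - (10 * c) *s (a 2 - a (-1))"
      (is "?l = ?r")
    proof (rule vec_eqI)
      fix f :: "'v \<Rightarrow> 'f" assume f: "lin_fun f"
      have "f ?r - f ?l = 10 * (f M_l - f ?M_r) - (f (20 *s a 4) - f (Gm_r + 20 *s a (-1)))"
        by (simp add: lin_fun_simps[OF f], algebra?)
      also have "\<dots> = 0" by (simp only: M D) simp
      finally show "f ?l = f ?r" by simp
    qed
    have "18 *s a (-3) \<in> span X6" unfolding e by (simp add: span_add span_scale span_diff span_base)
    then have "inverse 18 *s (18 *s a (-3)) \<in> span X6" by (rule span_scale)
    then show ?thesis using numeral_nonzero(4) by simp
  qed
  have "2 *s a 4 = c *s (a 2 - a (-1)) - 2 *s a 3 + 2 *s a (-2) + 2 *s a (-3)"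
    unfolding M[symmetric] by (simp add: scale_right_diff_distrib scale_right_distrib)
  also have "\<dots> \<in> span X6" using a3 by (simp add: span_add span_scale span_diff span_base)
  finally have "inverse 2 *s (2 *s a 4) \<in> span X6" by (rule span_scale)
  then show "a 4 \<in> span X6" using two by simp
qed

end

lemma (in generated_orbit) span_both_exceptional:
  assumes P0: "P 0 = 0" and P1: "P 1 = 0"
  shows "span ({a (-2), a (-1), a 0, a 1, a 2, a 3} \<union> {\<sigma>, s 0 2}) = UNIV" (is "span (?X \<union> _) = _")
proof (rule disjE[OF both_exceptional_cases[OF P0 P1]])
  assume "\<kappa> = 24 \<and> 16 * lam 0 1 = 1 \<and> 16 * lam 1 1 = 1 \<and> g 0 = 0 \<and> g 1 = 0 \<and> s 1 2 = s 0 2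
       \<and> a 0 \<noteq> a 2 \<and> a 1 \<noteq> a (-1)"
  then have k: "\<kappa> = 24" and l: "16 * lam 0 1 = 1" "16 * lam 1 1 = 1" and g: "g 0 = 0" "g 1 = 0"
    and s: "s 1 2 = s 0 2" and ne: "a 0 \<noteq> a 2" "a 1 \<noteq> a (-1)" by auto
  have i01: "i mod 2 = 0 \<or> i mod 2 = 1" for i :: int by presburger
  have "18 * (16 * lam 0 2 - 1) = g 0" "18 * (16 * lam 1 2 - 1) = g 1"
    unfolding g_def unfolding k using l by (simp, algebra)+
  then have "18 * (16 * lam 0 2 - 1) = 0" "18 * (16 * lam 1 2 - 1) = 0" by (simp_all only: g)
  then have l2: "16 * lam 0 2 = 1" "16 * lam 1 2 = 1"
    using cancel_factor[OF _ numeral_nonzero(4)] by fastforce+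
  interpret six: six_orbit scale mult \<kappa> a \<tau> L
  proof
    show "\<kappa> = 24" by (rule k)
    show "16 * lam i n = 1" if "n = 1 \<or> n = 2" for i n
      using that i01[of i] l l2 lam_mod[of i n] by metis
    show "s i 2 = s 0 2" for i
      using s_period[of 2 i "i mod 2"] i01[of i] s by (metis dvd_minus_mod)
  qed
  show ?thesis
  proof (rule generate_window)
    show "\<tau> 0 x \<in> span ?X" "\<tau> 1 x \<in> span ?X" if "x \<in> ?X" for x
      using that six.ends[OF ne] by (auto simp: \<tau>_axis intro: span_base)
    have far: "a 0 \<bullet> a 3 \<in> U" "a 1 \<bullet> a (-2) \<in> U"
      by (simp_all add: prods U_closed U_gens six.s03_U[OF ne])
    show "a 0 \<bullet> x \<in> U" "a 1 \<bullet> x \<in> U" if "x \<in> ?X" for x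
      using that far by (auto intro!: axis_prod_U)
  qed (auto intro: span_base)
qed

section \<open>Projections and the involution of a single axis\<close>

context comm_nonassoc_algebra
begin

lemma algebra_bilinear:
  "mult x (y + z) = mult x y + mult x z" "mult x (scale c y) = scale c (mult x y)"
  "mult 0 x = 0" "mult x 0 = 0" "mult (- x) y = - mult x y" "mult x (- y) = - mult x y"
  "mult (x - y) z = mult x z - mult y z" "mult x (y - z) = mult x y - mult x z"
proof -
  show add: "mult x (y + z) = mult x y + mult x z" for x y z by (metis mult_commute mult_add_left)
  show sc: "mult x (scale c y) = scale c (mult x y)" for x y c by (metis mult_commute mult_scale_left)
  show z: "mult 0 x = 0" for x using mult_scale_left[of 0 0 x] by simp
  then show "mult x 0 = 0" by (metis mult_commute)
  show m: "mult (- x) y = - mult x y" for x y using mult_scale_left[of "-1" x y] by simp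
  show m': "mult x (- y) = - mult x y" for x y by (metis mult_commute m)
  show "mult (x - y) z = mult x z - mult y z" using mult_add_left[of x "- y" z] by (simp add: m)
  show "mult x (y - z) = mult x y - mult x z" using add[of x y "- z"] by (simp add: m')
qed

lemma eigenspace_closed:
  "v \<in> eigenspace scale mult x l \<Longrightarrow> w \<in> eigenspace scale mult x l \<Longrightarrow> v + w \<in> eigenspace scale mult x l"
  "v \<in> eigenspace scale mult x l \<Longrightarrow> scale c v \<in> eigenspace scale mult x l"
  "0 \<in> eigenspace scale mult x l"
  by (simp_all add: eigenspace_def mult_add_left mult_scale_left scale_right_distrib algebra_bilinear
      scale_left_commute)

end

locale monster_axis = comm_nonassoc_algebra scale mult
  for scale :: "'f::field \<Rightarrow> 'v::ab_group_add \<Rightarrow> 'v" and mult +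
  fixes \<alpha> \<beta> :: 'f and x :: 'v
  assumes axis: "primitive_monster_axis scale mult \<alpha> \<beta> x"
    and dist: "distinct [0, 1, \<alpha>, \<beta>]"
begin

abbreviation "Ei \<equiv> eigenspace scale mult x"
abbreviation "Dec \<equiv> eigen_decomposition scale mult x {1, 0, \<alpha>, \<beta>}"

definition proj :: "'v \<Rightarrow> 'f \<Rightarrow> 'v" where "proj v = (THE u. Dec v u)"

lemma neqs: "0 \<noteq> \<alpha>" "0 \<noteq> \<beta>" "1 \<noteq> \<alpha>" "1 \<noteq> \<beta>" "\<alpha> \<noteq> \<beta>" "\<alpha> \<noteq> 0" "\<beta> \<noteq> 0" "\<alpha> \<noteq> 1" "\<beta> \<noteq> 1" "\<beta> \<noteq> \<alpha>"
  using dist by auto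

lemma axis_facts: "x \<noteq> 0" "mult x x = x" "\<exists>!u. Dec v u" "Ei 1 = range (\<lambda>c. scale c x)"
  using axis by (auto simp: primitive_monster_axis_def)

lemma fusion: "l \<in> {1, 0, \<alpha>, \<beta>} \<Longrightarrow> m \<in> {1, 0, \<alpha>, \<beta>} \<Longrightarrow> v \<in> Ei l \<Longrightarrow> w \<in> Ei m \<Longrightarrow>
    mult v w \<in> eigenspace_sum scale mult x (monster_fusion \<alpha> \<beta> l m)"
  using axis by (auto simp: primitive_monster_axis_def)

lemma Dec_proj: "Dec v (proj v)"
  unfolding proj_def by (rule theI'[OF axis_facts(3)])

lemma proj_unique: "Dec v u \<Longrightarrow> proj v = u"
  using axis_facts(3)[of v] Dec_proj by blast

lemma Dec_alt: "Dec v u \<longleftrightarrow> (\<forall>l\<in>{1,0,\<alpha>,\<beta>}. u l \<in> Ei l) \<and> (\<forall>l. l \<notin> {1,0,\<alpha>,\<beta>} \<longrightarrow> u l = 0)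
   \<and> v = u 1 + u 0 + u \<alpha> + u \<beta>"
  by (simp add: eigen_decomposition_def neqs add.assoc)

lemma proj_eigen: "l \<in> {1, 0, \<alpha>, \<beta>} \<Longrightarrow> proj v l \<in> Ei l"
  using Dec_proj[of v] unfolding Dec_alt by blast

lemma proj_sum: "v = proj v 1 + proj v 0 + proj v \<alpha> + proj v \<beta>"
  using Dec_proj[of v] by (simp add: Dec_alt)

lemma proj_zero: "l \<notin> {1, 0, \<alpha>, \<beta>} \<Longrightarrow> proj v l = 0"
  using Dec_proj[of v] unfolding Dec_alt by blast

lemma proj_add: "proj (v + w) l = proj v l + proj w l"
proof -
  have "v + w = (proj v 1 + proj v 0 + proj v \<alpha> + proj v \<beta>) + (proj w 1 + proj w 0 + proj w \<alpha> + proj w \<beta>)"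
    by (rule arg_cong2[where f = "(+)", OF proj_sum proj_sum])
  also have "\<dots> = (proj v 1 + proj w 1) + (proj v 0 + proj w 0) + (proj v \<alpha> + proj w \<alpha>) + (proj v \<beta> + proj w \<beta>)"
    by (simp only: ac_simps)
  finally have "Dec (v + w) (\<lambda>l. proj v l + proj w l)"
    unfolding Dec_alt using proj_eigen proj_zero by (simp add: eigenspace_closed)
  then show ?thesis by (simp add: proj_unique)
qed

lemma proj_scale: "proj (scale c v) l = scale c (proj v l)"
proof -
  have "Dec (scale c v) (\<lambda>l. scale c (proj v l))"
    unfolding Dec_alt using arg_cong[OF proj_sum[of v], of "scale c"] proj_eigen proj_zero
    by (simp add: eigenspace_closed scale_right_distrib)
  then show ?thesis by (simp add: proj_unique)
qed

lemma proj_of_eigen: "l \<in> {1, 0, \<alpha>, \<beta>} \<Longrightarrow> v \<in> Ei l \<Longrightarrow> proj v = (\<lambda>m. if m = l then v else 0)"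
  by (rule proj_unique) (auto simp: Dec_alt eigenspace_closed neqs)

lemma proj_axis_mult: "proj (mult x v) 1 = proj v 1"
proof -
  have "Dec (mult x v) (\<lambda>l. scale l (proj v l))"
  proof -
    \<comment> \<open>the projections of \<open>mult x v\<close> are those of \<open>v\<close>, multiplied by the eigenvalues\<close>
    have m: "mult x (proj v l) = scale l (proj v l)" if "l \<in> {1, 0, \<alpha>, \<beta>}" for l
      using proj_eigen[OF that, of v] by (simp add: eigenspace_def mult_commute)
    have "mult x v = mult x (proj v 1 + proj v 0 + proj v \<alpha> + proj v \<beta>)"
      by (rule arg_cong[OF proj_sum])
    also have "\<dots> = scale 1 (proj v 1) + scale 0 (proj v 0) + scale \<alpha> (proj v \<alpha>) + scale \<beta> (proj v \<beta>)"
      by (simp only: algebra_bilinear m insert_iff simp_thms)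
    finally show ?thesis
      unfolding Dec_alt using proj_eigen proj_zero by (simp add: eigenspace_closed)
  qed
  then show ?thesis by (simp add: proj_unique)
qed

definition lamb :: "'v \<Rightarrow> 'f" where "lamb v = axis_lambda scale mult \<alpha> \<beta> x v"

lemma lamb: "proj v 1 = scale (lamb v) x"
proof -
  obtain c where c: "proj v 1 = scale c x" using proj_eigen[of 1 v] axis_facts(4) by auto
  have "lamb v = (THE c. scale c x = proj v 1)" by (simp add: lamb_def axis_lambda_def proj_def)
  also have "\<dots> = c" by (rule the_equality) (use c axis_facts(1) in auto)
  finally show ?thesis using c by simp
qed

lemma lamb_add: "lamb (v + w) = lamb v + lamb w"
proof -
  have "scale (lamb (v + w)) x = scale (lamb v + lamb w) x"
    using proj_add[of v w 1] by (simp add: lamb scale_left_distrib)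
  then show ?thesis using axis_facts(1) by simp
qed

lemma lamb_scale: "lamb (scale c v) = c * lamb v"
proof -
  have "scale (lamb (scale c v)) x = scale (c * lamb v) x"
    using proj_scale[of c v 1] by (simp add: lamb)
  then show ?thesis using axis_facts(1) by simp
qed

lemma lamb_axis_mult: "lamb (mult x v) = lamb v"
proof -
  have "scale (lamb (mult x v)) x = scale (lamb v) x"
    using proj_axis_mult[of v] by (simp add: lamb)
  then show ?thesis using axis_facts(1) by simp
qed

lemma axis_eigen: "x \<in> Ei 1" by (simp add: eigenspace_def axis_facts)

lemma lamb_self: "lamb x = 1"
proof -
  have "scale (lamb x) x = scale 1 x"
    using proj_of_eigen[OF _ axis_eigen] lamb[of x] by simp
  then show ?thesis using axis_facts(1) scale_cancel_right by blast
qed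

definition Ev :: "'v set" where "Ev = {v. proj v \<beta> = 0}"

lemma Ev_sub: "v \<in> Ev \<Longrightarrow> w \<in> Ev \<Longrightarrow> v + w \<in> Ev" "v \<in> Ev \<Longrightarrow> scale c v \<in> Ev" "0 \<in> Ev"
  using proj_scale[of 0 0 \<beta>] by (simp_all add: Ev_def proj_add proj_scale)

lemma Ei_Ev: "l \<in> {1, 0, \<alpha>} \<Longrightarrow> v \<in> Ei l \<Longrightarrow> v \<in> Ev"
  using proj_of_eigen[of l v] neqs by (auto simp: Ev_def)

lemma Ev_iff: "v \<in> Ev \<longleftrightarrow> v = proj v 1 + proj v 0 + proj v \<alpha>"
  using proj_sum[of v] by (simp add: Ev_def) (metis add.right_neutral add_left_cancel)

lemma fusion_values:
  "monster_fusion \<alpha> \<beta> 0 0 = {0}" "monster_fusion \<alpha> \<beta> 0 \<alpha> = {\<alpha>}" "monster_fusion \<alpha> \<beta> \<alpha> \<alpha> = {1, 0}"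
  "monster_fusion \<alpha> \<beta> \<beta> \<beta> = {1, 0, \<alpha>}"
  "l \<in> {1, 0, \<alpha>} \<Longrightarrow> monster_fusion \<alpha> \<beta> l \<beta> \<subseteq> {\<beta>}"
  "l \<in> {1, 0, \<alpha>} \<Longrightarrow> m \<in> {1, 0, \<alpha>} \<Longrightarrow> monster_fusion \<alpha> \<beta> l m \<subseteq> {1, 0, \<alpha>}"
  using neqs by (auto simp: monster_fusion_def doubleton_eq_iff)

lemma sum_into:
  assumes "v \<in> eigenspace_sum scale mult x N" "finite N" "0 \<in> T" "\<And>v w. v \<in> T \<Longrightarrow> w \<in> T \<Longrightarrow> v + w \<in> T"
    and "\<And>l v. l \<in> N \<Longrightarrow> v \<in> Ei l \<Longrightarrow> v \<in> T"
  shows "v \<in> T"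
proof -
  obtain u where u: "v = (\<Sum>l\<in>N. u l)" "\<forall>l\<in>N. u l \<in> Ei l"
    using assms(1) by (auto simp: eigenspace_sum_def)
  have "(\<Sum>l\<in>M. u l) \<in> T" if "finite M" "M \<subseteq> N" for M
    using that by (induction M rule: finite_induct) (use assms u in auto)
  then show ?thesis using u assms(2) by auto
qed

text \<open>
  The fusion law is graded by the group of order two: \<open>Ev\<close> is the even part and the eigenspace for \<open>\<beta>\<close> the
  odd part. Hence the map that negates the odd part is multiplicative.
\<close>

lemma Ev_Ev: assumes "v \<in> Ev" "w \<in> Ev" shows "mult v w \<in> Ev"
proof -
  have *: "mult p q \<in> Ev" if "l \<in> {1, 0, \<alpha>}" "m \<in> {1, 0, \<alpha>}" "p \<in> Ei l" "q \<in> Ei m" for l m p q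
  proof (rule sum_into[OF fusion[of l m p q]])
    show "finite (monster_fusion \<alpha> \<beta> l m)" using fusion_values(6)[OF that(1,2)] finite_subset by blast
    show "v \<in> Ev" if "k \<in> monster_fusion \<alpha> \<beta> l m" "v \<in> Ei k" for k v
      using fusion_values(6)[OF \<open>l \<in> _\<close> \<open>m \<in> _\<close>] that Ei_Ev by blast
  qed (use that Ev_sub in auto)
  have c: "mult (proj v l) (proj w m) \<in> Ev" if "l \<in> {1, 0, \<alpha>}" "m \<in> {1, 0, \<alpha>}" for l m
    using *[OF that proj_eigen proj_eigen] that by blast
  have "mult v w = mult (proj v 1 + proj v 0 + proj v \<alpha>) (proj w 1 + proj w 0 + proj w \<alpha>)"
    by (rule arg_cong2[where f = mult, OF iffD1[OF Ev_iff assms(1)] iffD1[OF Ev_iff assms(2)]])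
  also have "\<dots> \<in> Ev" by (simp add: mult_add_left algebra_bilinear(1) Ev_sub(1) c)
  finally show ?thesis .
qed

lemma Ev_Od: assumes "v \<in> Ev" "w \<in> Ei \<beta>" shows "mult v w \<in> Ei \<beta>"
proof -
  have *: "mult p w \<in> Ei \<beta>" if "l \<in> {1, 0, \<alpha>}" "p \<in> Ei l" for l p
  proof (rule sum_into[OF fusion[of l \<beta> p w]])
    show "finite (monster_fusion \<alpha> \<beta> l \<beta>)" using fusion_values(5)[OF that(1)] finite_subset by blast
    show "v \<in> Ei \<beta>" if "k \<in> monster_fusion \<alpha> \<beta> l \<beta>" "v \<in> Ei k" for k v
      using fusion_values(5)[OF \<open>l \<in> _\<close>] that by blast
  qed (use that assms eigenspace_closed in auto)
  have c: "mult (proj v l) w \<in> Ei \<beta>" if "l \<in> {1, 0, \<alpha>}" for l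
    using *[OF that proj_eigen] that by blast
  have "mult v w = mult (proj v 1 + proj v 0 + proj v \<alpha>) w"
    by (rule arg_cong2[where f = mult, OF iffD1[OF Ev_iff assms(1)] refl])
  also have "\<dots> \<in> Ei \<beta>" by (simp add: mult_add_left eigenspace_closed(1) c)
  finally show ?thesis .
qed

lemma Od_Od: assumes "v \<in> Ei \<beta>" "w \<in> Ei \<beta>" shows "mult v w \<in> Ev"
  by (rule sum_into[OF fusion[of \<beta> \<beta> v w]]) (use assms Ev_sub Ei_Ev in \<open>auto simp: fusion_values\<close>)

definition t :: "'v \<Rightarrow> 'v" where "t v = proj v 1 + proj v 0 + proj v \<alpha> - proj v \<beta>"

lemma t_eq: "t v = v - scale 2 (proj v \<beta>)"
proof -
  have "t v + scale 2 (proj v \<beta>) = v"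
    using proj_sum[of v] scale_left_distrib[of 1 1 "proj v \<beta>"] by (simp add: t_def add.assoc)
  then show ?thesis by (simp add: eq_diff_eq)
qed

lemma t_Ev: "v \<in> Ev \<Longrightarrow> t v = v" by (simp add: t_eq Ev_def)

lemma t_Od: "v \<in> Ei \<beta> \<Longrightarrow> t v = - v"
  using proj_of_eigen[of \<beta> v] neqs proj_scale[of 0 0] by (simp add: t_def)

lemma t_add: "t (v + w) = t v + t w"
  by (simp add: t_def proj_add)

lemma t_scale: "t (scale c v) = scale c (t v)"
  by (simp add: t_def proj_scale scale_right_distrib scale_right_diff_distrib)

lemma t_minus: "t (- v) = - t v"
  using t_scale[of "-1" v] by simp

lemma t_diff: "t (v - w) = t v - t w"
  using t_add[of v "- w"] by (simp add: t_minus)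

lemma split_Ev: obtains p q where "v = p + q" "p \<in> Ev" "q \<in> Ei \<beta>"
proof
  show "v = (proj v 1 + proj v 0 + proj v \<alpha>) + proj v \<beta>" by (rule proj_sum)
  show "proj v 1 + proj v 0 + proj v \<alpha> \<in> Ev"
    by (intro Ev_sub Ei_Ev[of 1] Ei_Ev[of 0] Ei_Ev[of \<alpha>] proj_eigen) auto
qed (simp add: proj_eigen)

lemma t_mult: "t (mult v w) = mult (t v) (t w)"
proof -
  obtain p q where v: "v = p + q" and p: "p \<in> Ev" and q: "q \<in> Ei \<beta>" by (rule split_Ev)
  obtain p' q' where w: "w = p' + q'" and p': "p' \<in> Ev" and q': "q' \<in> Ei \<beta>" by (rule split_Ev)
  have "mult q p' \<in> Ei \<beta>" using Ev_Od[OF p' q] by (simp add: mult_commute)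
  then show ?thesis
    unfolding v w by (simp add: t_add mult_add_left algebra_bilinear t_Ev t_Od p q p' q' Ev_Ev Ev_Od Od_Od)
qed

lemma t_t: "t (t v) = v"
proof -
  obtain p q where v: "v = p + q" and p: "p \<in> Ev" and q: "q \<in> Ei \<beta>" by (rule split_Ev)
  have "- q \<in> Ei \<beta>" using eigenspace_closed(2)[OF q, of "-1"] by simp
  then show ?thesis unfolding v by (simp add: t_add t_diff t_Ev t_Od p q)
qed

lemma t_auto: "algebra_automorphism scale mult t"
  unfolding algebra_automorphism_def
proof (intro conjI allI)
  show "Vector_Spaces.linear scale scale t" by (unfold_locales) (simp_all add: t_add t_scale)
  show "bij t" by (rule o_bij[of t]) (auto simp: t_t)
qed (rule t_mult)

text \<open>
  The defining description has the grading involution as its only solution, since the two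
  parts span the algebra.
\<close>

lemma miyamoto_eq: "miyamoto scale mult \<alpha> \<beta> x = t"
  unfolding miyamoto_def
proof (rule the_equality)
  have Ev: "v \<in> Ev" if "v \<in> eigenspace_sum scale mult x {1, 0, \<alpha>}" for v
    by (rule sum_into[OF that]) (auto intro: Ev_sub Ei_Ev)
  then show "algebra_automorphism scale mult t \<and> (\<forall>v\<in>eigenspace_sum scale mult x {1, 0, \<alpha>}. t v = v) \<and>
       (\<forall>v\<in>eigenspace scale mult x \<beta>. t v = - v)"
    using t_auto t_Ev t_Od by auto
  fix t' assume t': "algebra_automorphism scale mult t' \<and> (\<forall>v\<in>eigenspace_sum scale mult x {1, 0, \<alpha>}. t' v = v) \<and>
       (\<forall>v\<in>eigenspace scale mult x \<beta>. t' v = - v)"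
  show "t' = t"
  proof
    fix v
    have add: "t' (p + q) = t' p + t' q" for p q
      using t' by (simp add: algebra_automorphism_def Vector_Spaces.linear_iff)
    have "proj v 1 + proj v 0 + proj v \<alpha> \<in> eigenspace_sum scale mult x {1, 0, \<alpha>}"
      unfolding eigenspace_sum_def using proj_eigen[of _ v]
      by (auto intro!: exI[of _ "proj v"] simp: neqs add.assoc)
    then have "t' (proj v 1 + proj v 0 + proj v \<alpha>) = proj v 1 + proj v 0 + proj v \<alpha>" using t' by blast
    moreover have "t' (proj v \<beta>) = - proj v \<beta>" using t' proj_eigen[of \<beta> v] by auto
    moreover have "t' v = t' (proj v 1 + proj v 0 + proj v \<alpha> + proj v \<beta>)"
      by (rule arg_cong[OF proj_sum])
    ultimately show "t' v = t v" by (simp add: add t_def)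
  qed
qed

lemma t_axis: "t x = x"
  by (rule t_Ev[OF Ei_Ev[OF _ axis_eigen]]) simp

end

context comm_nonassoc_algebra
begin

text \<open>
  Automorphisms carry axes to axes and conjugate the associated involutions. For an involutive automorphism \<open>t\<close>,
  conjugation needs no inverse.
\<close>

context
  fixes t :: "'v \<Rightarrow> 'v"
  assumes aut: "algebra_automorphism scale mult t" and invol: "t (t v) = v"
begin

lemma auto_simps: "t (v + w) = t v + t w" "t (scale c v) = scale c (t v)" "t (mult v w) = mult (t v) (t w)" "t 0 = 0"
proof -
  show add: "t (v + w) = t v + t w" for v w
    using aut by (simp add: algebra_automorphism_def Vector_Spaces.linear_iff)
  show "t (scale c v) = scale c (t v)" "t (mult v w) = mult (t v) (t w)"
    using aut by (simp_all add: algebra_automorphism_def Vector_Spaces.linear_iff)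
  show "t 0 = 0" using add[of 0 0] by simp
qed

lemma t_inj: "t v = t w \<longleftrightarrow> v = w" by (metis invol)

lemma eigenspace_transport: "t v \<in> eigenspace scale mult (t x) l \<longleftrightarrow> v \<in> eigenspace scale mult x l"
  by (simp add: eigenspace_def t_inj flip: auto_simps(2,3))

lemma eigenspace_transport': "v \<in> eigenspace scale mult (t x) l \<longleftrightarrow> t v \<in> eigenspace scale mult x l"
  using eigenspace_transport[of "t v" x l] by (simp add: invol)

lemma t_sum: "t (\<Sum>l\<in>N. u l) = (\<Sum>l\<in>N. t (u l))"
  using sum_comp_morphism[of t u N] auto_simps by (simp add: o_def)

lemma decomposition_transport:
  "eigen_decomposition scale mult x N v u \<Longrightarrow> eigen_decomposition scale mult (t x) N (t v) (\<lambda>l. t (u l))"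
  by (simp add: eigen_decomposition_def eigenspace_transport auto_simps t_sum)

lemma decomposition_transport':
  "eigen_decomposition scale mult (t x) N v u \<Longrightarrow> eigen_decomposition scale mult x N (t v) (\<lambda>l. t (u l))"
  using eigenspace_transport' by (auto simp: eigen_decomposition_def auto_simps t_sum)

lemma sum_transport: "v \<in> eigenspace_sum scale mult x N \<Longrightarrow> t v \<in> eigenspace_sum scale mult (t x) N"
proof -
  assume "v \<in> eigenspace_sum scale mult x N"
  then obtain u where "v = (\<Sum>l\<in>N. u l)" "\<forall>l\<in>N. u l \<in> eigenspace scale mult x l"
    by (auto simp: eigenspace_sum_def)
  then show ?thesis
    unfolding eigenspace_sum_def by (auto simp: t_sum eigenspace_transport intro!: exI[of _ "\<lambda>l. t (u l)"])
qed

lemma axis_transport: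
  assumes "primitive_monster_axis scale mult \<alpha> \<beta> x"
  shows "primitive_monster_axis scale mult \<alpha> \<beta> (t x)"
  unfolding primitive_monster_axis_def
proof (intro conjI ballI allI)
  have ax: "x \<noteq> 0" "mult x x = x" "\<exists>!u. eigen_decomposition scale mult x {1, 0, \<alpha>, \<beta>} v u"
    "eigenspace scale mult x 1 = range (\<lambda>c. scale c x)" for v
    using assms by (auto simp: primitive_monster_axis_def)
  show "t x \<noteq> 0" using ax(1) auto_simps(4) t_inj by metis
  show "mult (t x) (t x) = t x" using ax(2) by (simp flip: auto_simps(3))
  show "\<exists>!u. eigen_decomposition scale mult (t x) {1, 0, \<alpha>, \<beta>} v u" for v
  proof -
    obtain u where u: "eigen_decomposition scale mult x {1, 0, \<alpha>, \<beta>} (t v) u" using ax(3) by blast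
    show ?thesis
    proof (rule ex1I)
      show "eigen_decomposition scale mult (t x) {1, 0, \<alpha>, \<beta>} v (\<lambda>l. t (u l))"
        using decomposition_transport[OF u] by (simp add: invol)
      fix u' assume "eigen_decomposition scale mult (t x) {1, 0, \<alpha>, \<beta>} v u'"
      then have "eigen_decomposition scale mult x {1, 0, \<alpha>, \<beta>} (t v) (\<lambda>l. t (u' l))"
        by (rule decomposition_transport')
      then have "(\<lambda>l. t (u' l)) = u" using ax(3) u by blast
      then show "u' = (\<lambda>l. t (u l))" by (auto simp: invol)
    qed
  qed
  show "mult v w \<in> eigenspace_sum scale mult (t x) (monster_fusion \<alpha> \<beta> l m)"
    if "l \<in> {1, 0, \<alpha>, \<beta>}" "m \<in> {1, 0, \<alpha>, \<beta>}" "v \<in> eigenspace scale mult (t x) l"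
      "w \<in> eigenspace scale mult (t x) m" for l m v w
  proof -
    have "mult (t v) (t w) \<in> eigenspace_sum scale mult x (monster_fusion \<alpha> \<beta> l m)"
      using assms that unfolding primitive_monster_axis_def eigenspace_transport' by blast
    from sum_transport[OF this] show ?thesis by (simp add: auto_simps invol)
  qed
  show "eigenspace scale mult (t x) 1 = range (\<lambda>c. scale c (t x))"
  proof -
    have "v \<in> eigenspace scale mult (t x) 1 \<longleftrightarrow> v \<in> range (\<lambda>c. scale c (t x))" for v
    proof -
      have "v \<in> eigenspace scale mult (t x) 1 \<longleftrightarrow> (\<exists>c. t v = scale c x)"
        unfolding eigenspace_transport' ax(4) by auto
      also have "\<dots> \<longleftrightarrow> (\<exists>c. v = scale c (t x))" using t_inj auto_simps(2) invol by metis
      finally show ?thesis by auto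
    qed
    then show ?thesis by blast
  qed
qed

lemma miyamoto_transport:
  assumes "primitive_monster_axis scale mult \<alpha> \<beta> x" "distinct [0, 1, \<alpha>, \<beta>]"
  shows "miyamoto scale mult \<alpha> \<beta> (t x) v = t (miyamoto scale mult \<alpha> \<beta> x (t v))"
    and "axis_lambda scale mult \<alpha> \<beta> (t x) (t v) = axis_lambda scale mult \<alpha> \<beta> x v"
proof -
  interpret x: monster_axis scale mult \<alpha> \<beta> x by unfold_locales (fact assms)+
  interpret tx: monster_axis scale mult \<alpha> \<beta> "t x"
    by unfold_locales (rule axis_transport[OF assms(1)], fact assms)
  have proj: "tx.proj (t v) = (\<lambda>l. t (x.proj v l))" for v
    by (rule tx.proj_unique[OF decomposition_transport[OF x.Dec_proj]])
  have m: "t (- v) = - t v" for v using auto_simps(2)[of "-1" v] by simp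
  have d: "t (v - w) = t v - t w" for v w using auto_simps(1)[of v "- w"] by (simp add: m)
  show "miyamoto scale mult \<alpha> \<beta> (t x) v = t (miyamoto scale mult \<alpha> \<beta> x (t v))"
    using proj[of "t v"] unfolding tx.miyamoto_eq x.miyamoto_eq tx.t_def x.t_def
    by (simp add: invol auto_simps d)
  have "scale (tx.lamb (t v)) (t x) = scale (x.lamb v) (t x)"
    using proj[of v] unfolding tx.lamb[symmetric] by (simp add: x.lamb auto_simps)
  then have "tx.lamb (t v) = x.lamb v" using tx.axis_facts(1) scale_cancel_right by blast
  then show "axis_lambda scale mult \<alpha> \<beta> (t x) (t v) = axis_lambda scale mult \<alpha> \<beta> x v"
    by (simp add: x.lamb_def tx.lamb_def)
qed

end

end

section \<open>The sequence of axes of a pair\<close>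

lemma bij_int_power_simps:
  assumes "bij (r :: 'v \<Rightarrow> 'v)"
  shows "bij_int_power r 0 v = v" and "bij_int_power r (k + 1) v = r (bij_int_power r k v)"
    and "bij_int_power r (k - 1) v = inv r (bij_int_power r k v)"
proof -
  have i: "r (inv r w) = w" "inv r (r w) = w" for w
    using assms by (simp_all add: bij_is_surj surj_f_inv_f bij_is_inj inv_f_f)
  show "bij_int_power r 0 v = v" by (simp add: bij_int_power_def)
  show up: "bij_int_power r (k + 1) v = r (bij_int_power r k v)" for k
  proof (cases "0 \<le> k")
    case True
    then have "nat (k + 1) = Suc (nat k)" by simp
    then show ?thesis using True by (simp add: bij_int_power_def)
  next
    case False
    then obtain n where n: "k = - int (Suc n)" using int_cases3 by (metis neg_int_cases not_le_imp_less gr0_implies_Suc)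
    show ?thesis
    proof (cases n)
      case 0
      then show ?thesis by (simp add: n bij_int_power_def i)
    next
      case (Suc m)
      have "nat (- (k + 1)) = Suc m" "nat (- k) = Suc (Suc m)" "\<not> 0 \<le> k + 1" "\<not> 0 \<le> k" using n Suc by auto
      then show ?thesis by (simp add: bij_int_power_def i)
    qed
  qed
  show "bij_int_power r (k - 1) v = inv r (bij_int_power r k v)"
    using up[of "k - 1"] by (simp add: i)
qed

locale monster_pair = comm_nonassoc_algebra scale mult
  for scale :: "'f::field \<Rightarrow> 'v::ab_group_add \<Rightarrow> 'v" and mult +
  fixes \<alpha> \<beta> :: 'f and a0 a1 :: 'v
  assumes axes: "primitive_monster_axis scale mult \<alpha> \<beta> a0" "primitive_monster_axis scale mult \<alpha> \<beta> a1"
    and dist: "distinct [0, 1, \<alpha>, \<beta>]"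
begin

abbreviation "a \<equiv> axis_seq scale mult \<alpha> \<beta> a0 a1"
abbreviation "miy \<equiv> miyamoto scale mult \<alpha> \<beta>"

lemma axis_locale: "primitive_monster_axis scale mult \<alpha> \<beta> x \<Longrightarrow> monster_axis scale mult \<alpha> \<beta> x"
  by (unfold_locales) (use dist in auto)

lemma miy_facts:
  assumes "primitive_monster_axis scale mult \<alpha> \<beta> x"
  shows "algebra_automorphism scale mult (miy x)" "miy x (miy x v) = v" "miy x x = x"
proof -
  interpret monster_axis scale mult \<alpha> \<beta> x by (rule axis_locale[OF assms])
  show "algebra_automorphism scale mult (miy x)" "miy x (miy x v) = v" "miy x x = x"
    unfolding miyamoto_eq by (rule t_auto t_t t_axis)+
qed

definition \<rho> :: "'v \<Rightarrow> 'v" where "\<rho> = miy a1 \<circ> miy a0"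

lemma \<rho>_apply: "\<rho> v = miy a1 (miy a0 v)" by (simp add: \<rho>_def)

lemma \<rho>_bij: "bij \<rho>" and \<rho>_inv: "inv \<rho> = miy a0 \<circ> miy a1"
proof -
  have 1: "\<rho> \<circ> (miy a0 \<circ> miy a1) = id" "(miy a0 \<circ> miy a1) \<circ> \<rho> = id"
    by (auto simp: \<rho>_def miy_facts axes)
  then show "bij \<rho>" by (rule o_bij[rotated])
  show "inv \<rho> = miy a0 \<circ> miy a1" using 1 inv_unique_comp by blast
qed

abbreviation "pw \<equiv> bij_int_power \<rho>"

lemmas pw = bij_int_power_simps[OF \<rho>_bij]

lemma pw_add: "pw k (pw m v) = pw (k + m) v"
proof (induction k rule: int_induct[where k = 0])
  case (step1 k)
  then show ?case using pw(2)[of k "pw m v"] pw(2)[of "k + m" v] by (simp add: algebra_simps)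
next
  case (step2 k)
  then show ?case using pw(3)[of k "pw m v"] pw(3)[of "k + m" v] by (simp add: algebra_simps)
qed (simp add: pw)

lemma miy_pw: assumes "x = a0 \<or> x = a1" shows "miy x (pw k v) = pw (- k) (miy x v)"
proof (induction k rule: int_induct[where k = 0])
  case (step1 k)
  have "miy x (\<rho> w) = inv \<rho> (miy x w)" for w
    unfolding \<rho>_inv using assms by (auto simp: \<rho>_apply miy_facts axes)
  then show ?case using pw(2)[of k v] pw(3)[of "- k" "miy x v"] step1 by simp
next
  case (step2 k)
  have "miy x (inv \<rho> w) = \<rho> (miy x w)" for w
    unfolding \<rho>_inv using assms by (auto simp: \<rho>_apply miy_facts axes)
  then show ?case using pw(3)[of k v] pw(2)[of "- k" "miy x v"] step2 by (simp add: algebra_simps)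
qed (simp add: pw)

lemma a_even: "a (2 * k) = pw k a0" and a_odd: "a (2 * k + 1) = pw k a1"
  by (simp_all add: axis_seq_def \<rho>_def)

text \<open>
  The generating involutions invert \<open>\<rho>\<close>, and they exchange \<open>pw k a0\<close> with \<open>pw (- k) a0\<close> or \<open>pw (1 - k) a0\<close>, and similarly for
  \<open>a1\<close>, because \<open>\<rho> a0 = miy a1 a0\<close> and \<open>inv \<rho> a1 = miy a0 a1\<close>.
\<close>

lemma miy_seq: "miy a0 (a i) = a (- i)" "miy a1 (a i) = a (2 - i)"
proof -
  have 0: "miy a0 a1 = pw (-1) a1" using pw(3)[of 0 a1] by (simp add: pw(1) \<rho>_inv miy_facts axes)
  have 1: "miy a1 a0 = pw 1 a0" using pw(2)[of 0 a0] by (simp add: pw(1) \<rho>_apply miy_facts axes)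
  have "miy a0 (a i) = a (- i) \<and> miy a1 (a i) = a (2 - i)"
  proof (cases "even i")
    case True
    then obtain k where i: "i = 2 * k" by blast
    have "- i = 2 * (- k)" "2 - i = 2 * (- k + 1)" using i by auto
    then show ?thesis unfolding i by (simp only: a_even miy_pw miy_facts axes 1 pw_add simp_thms)
  next
    case False
    then obtain k where i: "i = 2 * k + 1" by (rule oddE)
    have "- i = 2 * (- k + - 1) + 1" "2 - i = 2 * (- k) + 1" using i by auto
    then show ?thesis unfolding i by (simp only: a_odd miy_pw miy_facts axes 0 pw_add simp_thms)
  qed
  then show "miy a0 (a i) = a (- i)" "miy a1 (a i) = a (2 - i)" by auto
qed

lemma a01: "a 0 = a0" "a 1 = a1"
  using a_even[of 0] a_odd[of 0] by (simp_all add: pw)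

text \<open>
  Each axis of the sequence arises from a generator by reflections, and \<open>miyamoto_transport\<close> moves the
  statement along.
\<close>

lemma seq_reflect: "primitive_monster_axis scale mult \<alpha> \<beta> (a j) \<and> (\<forall>i. miy (a j) (a i) = a (2 * j - i))"
proof (rule index_induct[where Q = "\<lambda>j. primitive_monster_axis scale mult \<alpha> \<beta> (a j) \<and> (\<forall>i. miy (a j) (a i) = a (2 * j - i))"])
  show "primitive_monster_axis scale mult \<alpha> \<beta> (a 0) \<and> (\<forall>i. miy (a 0) (a i) = a (2 * 0 - i))"
    "primitive_monster_axis scale mult \<alpha> \<beta> (a 1) \<and> (\<forall>i. miy (a 1) (a i) = a (2 * 1 - i))"
    using axes miy_seq by (simp_all add: a01)
next
  fix j assume j: "primitive_monster_axis scale mult \<alpha> \<beta> (a j) \<and> (\<forall>i. miy (a j) (a i) = a (2 * j - i))"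
  show "primitive_monster_axis scale mult \<alpha> \<beta> (a (- j)) \<and> (\<forall>i. miy (a (- j)) (a i) = a (2 * (- j) - i))"
    using axis_transport[of "miy a0" \<alpha> \<beta> "a j"] miyamoto_transport(1)[of "miy a0" \<alpha> \<beta> "a j"] j dist
    by (simp add: miy_facts axes miy_seq)
  show "primitive_monster_axis scale mult \<alpha> \<beta> (a (2 - j)) \<and> (\<forall>i. miy (a (2 - j)) (a i) = a (2 * (2 - j) - i))"
    using axis_transport[of "miy a1" \<alpha> \<beta> "a j"] miyamoto_transport(1)[of "miy a1" \<alpha> \<beta> "a j"] j dist
    by (simp add: miy_facts axes miy_seq algebra_simps)
qed

lemma seq_axis: "primitive_monster_axis scale mult \<alpha> \<beta> (a j)" and seq_miy: "miy (a j) (a i) = a (2 * j - i)"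
  using seq_reflect by blast+

end

text \<open>
  After multiplying the product by \<open>2 / \<beta>\<close> the eigenvalue \<open>c\<close> corresponds to \<open>c * \<beta> / 2\<close>, which for \<open>c = 0, 8, 2\<close> is
  \<open>0, \<alpha>, \<beta>\<close>. Projections and involutions depend on the eigenspaces only and stay the same.
\<close>

lemma (in monster_pair) orbit:
  assumes al: "\<alpha> = 4 * \<beta>" and half: "\<beta> \<noteq> 1 / 2" and two: "(2::'f) \<noteq> 0" and three: "(3::'f) \<noteq> 0"
  shows "axis_orbit scale (\<lambda>x y. scale (2 / \<beta>) (mult x y)) (2 / \<beta>) a (\<lambda>i. miy (a i))
     (\<lambda>i. axis_lambda scale mult \<alpha> \<beta> (a i))"
proof -
  let ?\<kappa> = "2 / \<beta>"
  let ?m = "\<lambda>x y. scale ?\<kappa> (mult x y)"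
  have b0: "\<beta> \<noteq> 0" and b1: "\<beta> \<noteq> 1" and a1: "4 * \<beta> \<noteq> 1" using dist al by auto
  have k: "?\<kappa> \<noteq> 0" using b0 two by simp
  interpret M: comm_nonassoc_algebra scale ?m
  proof
    show "?m x y = ?m y x" for x y by (rule arg_cong[OF mult_commute])
  qed (simp_all add: mult_add_left mult_scale_left scale_right_distrib mult.commute)
  have eig: "?m (a i) x = scale c x \<longleftrightarrow> x \<in> eigenspace scale mult (a i) (c * \<beta> / 2)" for i x c
  proof -
    have "?\<kappa> * (c * \<beta> / 2) = c" using b0 two by simp
    then have h: "scale c x = scale ?\<kappa> (scale (c * \<beta> / 2) x)" by (simp only: scale_scale)
    have "?m (a i) x = scale c x \<longleftrightarrow> scale ?\<kappa> (mult (a i) x) = scale ?\<kappa> (scale (c * \<beta> / 2) x)"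
      by (subst h) (rule refl)
    also have "\<dots> \<longleftrightarrow> mult (a i) x = scale (c * \<beta> / 2) x" by (rule iffI, erule scale_left_imp_eq[OF k], erule arg_cong)
    finally show ?thesis by (simp add: eigenspace_def mult_commute)
  qed
  have e8: "8 * \<beta> / 2 = \<alpha>" and e2: "2 * \<beta> / 2 = \<beta>"
  proof -
    have "8 * \<beta> = 2 * \<alpha>" unfolding al by simp
    then show "8 * \<beta> / 2 = \<alpha>" using two by simp
  qed (use two in simp)
  have E0: "?m (a i) x = 0 \<longleftrightarrow> x \<in> eigenspace scale mult (a i) 0" for i x
    using eig[of i x 0] by simp
  have E8: "?m (a i) x = scale 8 x \<longleftrightarrow> x \<in> eigenspace scale mult (a i) \<alpha>" for i x
    using eig[of i x 8] by (simp only: e8)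
  have E2: "?m (a i) x = scale 2 x \<longleftrightarrow> x \<in> eigenspace scale mult (a i) \<beta>" for i x
    using eig[of i x 2] by (simp only: e2)
  have ma: "monster_axis scale mult \<alpha> \<beta> (a i)" for i by (rule axis_locale[OF seq_axis])
  have lf: "M.lin_fun (axis_lambda scale mult \<alpha> \<beta> (a i))" for i
    unfolding M.lin_fun_def
    using monster_axis.lamb_add[OF ma] monster_axis.lamb_scale[OF ma] by (simp add: monster_axis.lamb_def[OF ma])
  show ?thesis
  proof (unfold_locales, goal_cases)
    case 1 show ?case by (rule two)
  next
    case 2 show ?case by (rule three)
  next
    case 3 show ?case by (rule k)
  next
    case 4
    have "2 * 1 \<noteq> 2 * \<beta>" using b1 mult_left_cancel[OF two] by metis
    then show ?case using b0 by (simp add: divide_eq_eq)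
  next
    case 5
    show ?case
    proof
      assume "2 / \<beta> = 4"
      then have "2 * 1 = 2 * (2 * \<beta>)" using b0 by (simp add: divide_eq_eq)
      then have "1 = 2 * \<beta>" using mult_left_cancel[OF two] by blast
      then show False using half two by (simp add: eq_divide_eq mult.commute)
    qed
  next
    case 6
    show ?case
    proof
      assume "2 / \<beta> = 8"
      then have "2 * 1 = 2 * (4 * \<beta>)" using b0 by (simp add: divide_eq_eq)
      then have "1 = 4 * \<beta>" using mult_left_cancel[OF two] by blast
      then show False using a1 by simp
    qed
  next
    case (7 i) show ?case using monster_axis.axis_facts(1)[OF ma] .
  next
    case (8 i) show ?case using monster_axis.axis_facts(2)[OF ma] by simp
  next
    case (9 i) show ?case by (rule lf)
  next
    case (10 i) show ?case using monster_axis.lamb_self[OF ma[of i]] by (simp add: monster_axis.lamb_def[OF ma])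
  next
    case (11 i x)
    show ?case
      using monster_axis.lamb_axis_mult[OF ma[of i], of x] monster_axis.lamb_scale[OF ma[of i], of ?\<kappa>]
      by (simp add: monster_axis.lamb_def[OF ma])
  next
    case (12 i x y) show ?case using monster_axis.t_add[OF ma] by (simp only: monster_axis.miyamoto_eq[OF ma])
  next
    case (13 i c x) show ?case using monster_axis.t_scale[OF ma] by (simp only: monster_axis.miyamoto_eq[OF ma])
  next
    case (14 i x y)
    show ?case using monster_axis.t_scale[OF ma] monster_axis.t_mult[OF ma] by (simp only: monster_axis.miyamoto_eq[OF ma])
  next
    case (15 j i) show ?case by (rule seq_miy)
  next
    case (16 i j) then show ?case by simp
  next
    case (17 j i v)
    show ?case
      using miyamoto_transport(2)[of "miy (a j)" \<alpha> \<beta> "a i" v] seq_axis miy_facts dist by (simp add: seq_miy)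
  next
    case (18 v i)
    interpret x: monster_axis scale mult \<alpha> \<beta> "a i" by (rule ma)
    have "v = scale (axis_lambda scale mult \<alpha> \<beta> (a i) v) (a i) + x.proj v 0 + x.proj v \<alpha> + x.proj v \<beta>"
      using x.proj_sum[of v] by (simp only: x.lamb x.lamb_def)
    moreover have c: "x.proj v 0 \<in> x.Ei 0" "x.proj v \<alpha> \<in> x.Ei \<alpha>" "x.proj v \<beta> \<in> x.Ei \<beta>"
      by (simp_all add: x.proj_eigen)
    moreover have "x.t (x.proj v 0) = x.proj v 0" "x.t (x.proj v \<alpha>) = x.proj v \<alpha>"
      "x.t (x.proj v \<beta>) = - x.proj v \<beta>"
      using x.t_Ev x.Ei_Ev[of 0, OF _ c(1)] x.Ei_Ev[of \<alpha>, OF _ c(2)] x.t_Od c(3) by auto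
    ultimately show ?case unfolding E0 E8 E2 x.miyamoto_eq by blast
  next
    case (19 i x y)
    interpret x: monster_axis scale mult \<alpha> \<beta> "a i" by (rule ma)
    have "mult x y \<in> eigenspace scale mult (a i) 0"
      by (rule x.sum_into[OF x.fusion[of 0 0 x y]]) (use 19[unfolded E0] in \<open>auto simp: x.fusion_values eigenspace_closed\<close>)
    then show ?case unfolding E0 by (rule eigenspace_closed)
  next
    case (20 i x y)
    interpret x: monster_axis scale mult \<alpha> \<beta> "a i" by (rule ma)
    have "mult x y \<in> eigenspace scale mult (a i) \<alpha>"
      by (rule x.sum_into[OF x.fusion[of 0 \<alpha> x y]]) (use 20[unfolded E0 E8] in \<open>auto simp: x.fusion_values eigenspace_closed\<close>)
    then show ?case unfolding E8 by (rule eigenspace_closed)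
  next
    case (21 i x y)
    interpret x: monster_axis scale mult \<alpha> \<beta> "a i" by (rule ma)
    let ?T = "{p. mult (a i) p = scale (x.lamb p) (a i)}"
    have "mult x y \<in> ?T"
    proof (rule x.sum_into[OF x.fusion[of \<alpha> \<alpha> x y]])
      show "v \<in> ?T" if l: "l \<in> monster_fusion \<alpha> \<beta> \<alpha> \<alpha>" and v: "v \<in> eigenspace scale mult (a i) l" for l v
      proof -
        have "l = 1 \<or> l = 0" using l by (simp add: x.fusion_values)
        then have c: "scale l v = x.proj v 1" using x.proj_of_eigen[of l v] v by auto
        have "mult (a i) v = scale l v" using v by (simp add: eigenspace_def mult_commute)
        also have "\<dots> = scale (x.lamb v) (a i)" unfolding c by (rule x.lamb)
        finally show ?thesis by simp
      qed
    qed (use 21[unfolded E8] x.lamb_scale[of 0 0] in \<open>auto simp: x.fusion_values algebra_bilinear x.lamb_add scale_left_distrib\<close>)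
    then show ?case using x.lamb_scale[of ?\<kappa> "mult x y"]
      by (simp add: algebra_bilinear x.lamb_def)
  qed
qed

lemma char_nonzero:
  assumes "CHAR('f::field) \<noteq> 2" "CHAR('f) \<noteq> 3"
  shows "(2::'f) \<noteq> 0" and "(3::'f) \<noteq> 0"
proof -
  have not_dvd: "\<not> CHAR('f) dvd n" if "n = 2 \<or> n = 3" for n
  proof
    assume d: "CHAR('f) dvd n"
    then have "CHAR('f) \<le> 3" using that by (auto dest: dvd_imp_le)
    moreover have "CHAR('f) \<noteq> 0"
    proof
      assume "CHAR('f) = 0"
      then have "0 dvd n" using d by (simp only:)
      then show False using that by auto
    qed
    moreover have "CHAR('f) \<noteq> 1" using CHAR_not_1[where 'a = 'f] by simp
    ultimately show False using assms by linarith
  qed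
  show "(2::'f) \<noteq> 0" "(3::'f) \<noteq> 0"
    using not_dvd[of 2] not_dvd[of 3] of_nat_eq_0_iff_char_dvd[where 'a = 'f, of 2]
      of_nat_eq_0_iff_char_dvd[where 'a = 'f, of 3] by simp_all
qed

theorem theorem7p12:
  fixes scale :: "'f::field \<Rightarrow> 'v::ab_group_add \<Rightarrow> 'v"
    and mult :: "'v \<Rightarrow> 'v \<Rightarrow> 'v"
    and \<beta> :: 'f
    and a0 a1 :: 'v
  defines "a \<equiv> axis_seq scale mult (4 * \<beta>) \<beta> a0 a1"
    and "s \<equiv> axis_s scale mult (4 * \<beta>) \<beta> a0 a1"
    and "lam \<equiv> axis_lambda scale mult (4 * \<beta>) \<beta>"
  assumes "CHAR('f) \<noteq> 2" and "CHAR('f) \<noteq> 3"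
    and "\<beta> \<noteq> 1 / 2"
    and "distinct [0, 1, 4 * \<beta>, \<beta>]"
    and "two_generated_primitive_monster_algebra scale mult (4 * \<beta>) \<beta> a0 a1"
  shows "(lam a0 a1 \<noteq> (18 * \<beta> - 1) / 8 \<and> lam a1 a0 \<noteq> (18 * \<beta> - 1) / 8 \<longrightarrow>
            module.span scale {a (-1), a 0, a 1, a 2, s 0 1, s 0 2} = UNIV) \<and>
         (lam a0 a1 \<noteq> (18 * \<beta> - 1) / 8 \<and> lam a1 a0 = (18 * \<beta> - 1) / 8 \<longrightarrow>
            module.span scale {a (-2), a (-1), a 0, a 1, a 2, s 0 1, s 0 2} = UNIV) \<and>
         (lam a0 a1 = (18 * \<beta> - 1) / 8 \<and> lam a1 a0 \<noteq> (18 * \<beta> - 1) / 8 \<longrightarrow>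
            module.span scale {a (-3), a (-2), a (-1), a 0, a 1, s 0 1, s 1 2} = UNIV) \<and>
         (lam a0 a1 = (18 * \<beta> - 1) / 8 \<and> lam a1 a0 = (18 * \<beta> - 1) / 8 \<longrightarrow>
            module.span scale {a (-2), a (-1), a 0, a 1, a 2, a 3, s 0 1, s 0 2} = UNIV)"
proof -
  note two = char_nonzero(1)[OF assms(4,5)] and three = char_nonzero(2)[OF assms(4,5)]
  have alg: "comm_nonassoc_algebra scale mult"
    and ax: "primitive_monster_axis scale mult (4 * \<beta>) \<beta> a0" "primitive_monster_axis scale mult (4 * \<beta>) \<beta> a1"
    and hull: "subalgebra scale mult hull {a0, a1} = UNIV"
    using assms(8) by (simp_all add: two_generated_primitive_monster_algebra_def)
  interpret A: comm_nonassoc_algebra scale mult by (rule alg)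
  interpret pair: monster_pair scale mult "4 * \<beta>" \<beta> a0 a1
    by unfold_locales (fact ax assms(7))+
  have b0: "\<beta> \<noteq> 0" using assms(7) by auto
  define \<kappa> where "\<kappa> = 2 / \<beta>"
  have k: "\<kappa> * \<beta> = 2" "\<kappa> \<noteq> 0" using b0 two by (simp_all add: \<kappa>_def)
  let ?m = "\<lambda>x y. scale \<kappa> (mult x y)"
  let ?L = "\<lambda>i. axis_lambda scale mult (4 * \<beta>) \<beta> (a i)"
  interpret O: axis_orbit scale ?m \<kappa> a "\<lambda>i. pair.miy (a i)" ?L
    unfolding \<kappa>_def a_def by (rule pair.orbit) (fact refl assms(6) two three)+
  have a01: "a 0 = a0" "a 1 = a1" by (simp_all add: a_def pair.a01)
  interpret O: generated_orbit scale ?m \<kappa> a "\<lambda>i. pair.miy (a i)" ?L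
  proof
    fix T assume T: "A.subspace T" "a 0 \<in> T" "a 1 \<in> T" "\<And>x y. x \<in> T \<Longrightarrow> y \<in> T \<Longrightarrow> ?m x y \<in> T"
    have "mult x y \<in> T" if "x \<in> T" "y \<in> T" for x y
    proof -
      have "scale (inverse \<kappa>) (?m x y) \<in> T" using T(1) T(4)[OF that] by (rule A.subspace_scale)
      then show ?thesis using k(2) by simp
    qed
    then have "subalgebra scale mult T" using T(1) by (simp add: subalgebra_def)
    moreover have "{a0, a1} \<subseteq> T" using T(2,3) by (simp add: a01)
    ultimately have "subalgebra scale mult hull {a0, a1} \<subseteq> T" by (rule hull_minimal[rotated])
    then show "T = UNIV" using hull by auto
  qed
  have s: "O.s i n = scale \<kappa> (s i n)" for i n
  proof -
    have "scale 2 v = scale \<kappa> (scale \<beta> v)" for v by (simp add: k(1))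
    then show ?thesis unfolding O.s_def s_def axis_s_def Let_def a_def[symmetric]
      by (simp only: A.scale_right_diff_distrib)
  qed
  have l01: "O.lam 0 1 = lam a0 a1" "O.lam 1 1 = lam a1 a0"
    using O.lam_minus[of 1 1] by (simp_all add: O.lam_def a01 lam_def)
  have eight: "(8::'f) \<noteq> 0" by (rule O.numeral_nonzero)
  have P_iff: "8 * \<kappa> * x + \<kappa> - 36 = 0 \<longleftrightarrow> x = (18 * \<beta> - 1) / 8" for x
  proof -
    have "8 * \<kappa> * x + \<kappa> - 36 = 8 * \<kappa> * x + \<kappa> - 18 * (\<kappa> * \<beta>)" by (simp add: k)
    also have "\<dots> = \<kappa> * (8 * x - (18 * \<beta> - 1))" by (simp add: algebra_simps)
    finally have "8 * \<kappa> * x + \<kappa> - 36 = 0 \<longleftrightarrow> 8 * x = 18 * \<beta> - 1" using k(2) by simp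
    also have "\<dots> \<longleftrightarrow> x = (18 * \<beta> - 1) / 8" using eight by (simp add: eq_divide_eq mult.commute)
    finally show ?thesis .
  qed
  have P: "O.P 0 = 0 \<longleftrightarrow> lam a0 a1 = (18 * \<beta> - 1) / 8" "O.P 1 = 0 \<longleftrightarrow> lam a1 a0 = (18 * \<beta> - 1) / 8"
    unfolding O.P_def l01 by (rule P_iff)+
  \<comment> \<open>the elements \<open>s\<close> of the two products differ by the factor \<open>\<kappa>\<close>, so the spans agree\<close>
  have fin: "A.span (X \<union> {s 0 1, y}) = UNIV" if "A.span (X \<union> {scale \<kappa> (s 0 1), scale \<kappa> y}) = UNIV" for X y
    by (rule O.enlarge[OF that]) (auto intro: A.span_base A.span_scale)
  have "lam a0 a1 \<noteq> (18 * \<beta> - 1) / 8 \<and> lam a1 a0 \<noteq> (18 * \<beta> - 1) / 8 \<longrightarrow>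
            A.span ({a (-1), a 0, a 1, a 2} \<union> {s 0 1, s 0 2}) = UNIV"
    using O.span_none_exceptional fin unfolding s P by blast
  moreover have "lam a0 a1 \<noteq> (18 * \<beta> - 1) / 8 \<and> lam a1 a0 = (18 * \<beta> - 1) / 8 \<longrightarrow>
            A.span ({a (-2), a (-1), a 0, a 1, a 2} \<union> {s 0 1, s 0 2}) = UNIV"
    using O.span_second_exceptional fin unfolding s P by blast
  moreover have "lam a0 a1 = (18 * \<beta> - 1) / 8 \<and> lam a1 a0 \<noteq> (18 * \<beta> - 1) / 8 \<longrightarrow>
            A.span ({a (-3), a (-2), a (-1), a 0, a 1} \<union> {s 0 1, s 1 2}) = UNIV"
    using O.span_first_exceptional fin unfolding s P by blast
  moreover have "lam a0 a1 = (18 * \<beta> - 1) / 8 \<and> lam a1 a0 = (18 * \<beta> - 1) / 8 \<longrightarrow>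
            A.span ({a (-2), a (-1), a 0, a 1, a 2, a 3} \<union> {s 0 1, s 0 2}) = UNIV"
    using O.span_both_exceptional fin unfolding s P by blast
  ultimately show ?thesis by (simp only: Un_insert_left Un_empty_left)
qed

end
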